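(* There exist a constant $c > 0$, an integer $n_0 \in \mathbb{N}$, and a set $S \subset \mathbb{Z}^2$ such that no four distinct points of $S$ lie on a common circle or on a common line, and $|S \cap [n]^2| \ge cn$ for all integers $n \ge n_0$.
   Context: $\mathbb{N} = \{1,2,3,\dots\}$ and $[n] = \{1,2,\dots,n\}$, so $[n]^2 \subset \mathbb{Z}^2$ is the $n \times n$ grid. Circles and lines are those of the Euclidean plane $\mathbb{R}^2$. *)

theory Defs
  imports "HOL-Analysis.Analysis"
begin

text \<open>
  The Euclidean plane is \<^typ>\<open>real \<times> real\<close>, whose product metric
  is the Euclidean one (\<^term>\<open>sqrt ((dist a c)\<^sup>2 + (dist b d)\<^sup>2)\<close>).
\<close>

definition to_plane :: "int \<times> int \<Rightarrow> real \<times> real" where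
  "to_plane p = (of_int (fst p), of_int (snd p))"

text \<open>Degenerate circles of radius \<open>0\<close> are excluded.\<close>

definition concyclic :: "(real \<times> real) set \<Rightarrow> bool" where
  "concyclic A \<longleftrightarrow> (\<exists>z r. r > 0 \<and> A \<subseteq> sphere z r)"

definition no_four_on_circle_or_line :: "(int \<times> int) set \<Rightarrow> bool" where
  "no_four_on_circle_or_line S \<longleftrightarrow>
     (\<forall>T. T \<subseteq> S \<and> card T = 4 \<longrightarrow>
        \<not> concyclic (to_plane ` T) \<and> \<not> collinear (to_plane ` T))"

definition grid :: "nat \<Rightarrow> (int \<times> int) set" where
  "grid n = {1..int n} \<times> {1..int n}"

end

theory Submission
  imports Defs "HOL-Computational_Algebra.Euclidean_Algorithm"
begin

text \<open>
  Split the part of the plane near the \<open>x\<close>-axis into dyadic blocks \<open>[R, 2R) \<times> [1, R]\<close> with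
  \<open>R = L 2\<^sup>k\<close>, split each block into \<open>2\<^sup>k\<close> vertical strips of width \<open>L\<close>, and choose one random point in
  each strip. It suffices that the expected number of concyclic or collinear quadruples with last point
  in block \<open>k\<close> is a small fraction of \<open>2\<^sup>k\<close>, since then one point of each can be deleted. The method of
  conditional expectations, with a potential that sums the normalized expectations over all blocks,
  handles all blocks simultaneously.

  The expectation bound rests on a count of quadruples \<open>0, z\<^sub>1, z\<^sub>2, z\<^sub>3\<close> of Gaussian integers on a circle
  or line, of moduli at most \<open>a \<le> b \<le> c\<close>: there are \<open>O(b c\<^sup>2 (a/c)\<^sup>\<delta>)\<close> of them for some \<open>\<delta> > 0\<close>. The products
  \<open>z\<^sub>1 (z\<^sub>3 - z\<^sub>2)\<close>, \<open>z\<^sub>2 (z\<^sub>1 - z\<^sub>3)\<close>, \<open>z\<^sub>3 (z\<^sub>2 - z\<^sub>1)\<close> have sum zero and are integer multiples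
  \<open>l\<^sub>1 P, l\<^sub>2 P, l\<^sub>3 P\<close> of one \<open>P\<close>. If \<open>P\<close> is small, choose \<open>P\<close>, \<open>l\<^sub>1\<close> and the divisor \<open>z\<^sub>1\<close> of \<open>l\<^sub>1 P\<close>; then
  \<open>z\<^sub>2 + z\<^sub>3 - z\<^sub>1\<close> lies on a fixed hyperbola, which has few integer points unless it degenerates, the
  exception being isosceles trapezoids and lines. If \<open>P\<close> is large, then the \<open>l\<^sub>i\<close> are small, and the
  relation \<open>l\<^sub>1 / z\<^sub>1 + l\<^sub>2 / z\<^sub>2 + l\<^sub>3 / z\<^sub>3 = 0\<close> forces large common divisors among the \<open>z\<^sub>i\<close>.
\<close>

section \<open>Gaussian integers\<close>

text \<open>A logarithm is the obstacle. A quadruple in blocks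
  \<open>j \<le> k \<le> l \<le> m\<close> is selected with probability of order
  \<open>1 / (R j * R k * R l * R m)\<close>. With the bound \<open>b * c\<^sup>2\<close> alone, the
  expected number ending in block \<open>m\<close> would only be bounded by \<open>R m\<close> times
  the sum of \<open>R j / R k\<close> over all such \<open>j\<close>, \<open>k\<close>,
  \<open>l\<close>, which grows with \<open>m\<close>. The factor
  \<open>(a / c) powr \<delta>\<close> turns the ratio into a power of \<open>R j / R m\<close>,
  whose sum stays bounded; any positive \<delta> will do. Decay in \<open>m - j\<close> serves a
  second purpose: a choice in block \<open>j\<close> affects infinitely many later blocks, and the
  decay lets one convergent potential control them all. The bound then becomes small through
  \<open>L\<close>, which enters the probabilities as \<open>1 / L ^ 4\<close> but
  \<open>R m\<close> only once. Gaussian integers enter because the circle condition is a real cross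
  ratio, that is, a multiplicative relation: unique factorization and the scarcity of divisors
  replace geometry. The degenerate configurations escape this argument, but they are rare enough to
  be counted directly.\<close>

datatype gauss = Gauss (gre: int) (gim: int)

lemma gauss_eq_iff: "z = w \<longleftrightarrow> gre z = gre w \<and> gim z = gim w"
  by (cases z; cases w) auto

instantiation gauss :: comm_ring_1
begin
definition "0 = Gauss 0 0"
definition "1 = Gauss 1 0"
definition "z + w = Gauss (gre z + gre w) (gim z + gim w)"
definition "z - w = Gauss (gre z - gre w) (gim z - gim w)"
definition "- z = Gauss (- gre z) (- gim z)"
definition "z * w = Gauss (gre z * gre w - gim z * gim w) (gre z * gim w + gim z * gre w)"
instance
  by standard
    (auto simp: gauss_eq_iff zero_gauss_def one_gauss_def plus_gauss_def minus_gauss_def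
      uminus_gauss_def times_gauss_def algebra_simps)
end

lemma gauss_sel [simp]:
  "gre 0 = 0" "gim 0 = 0" "gre 1 = 1" "gim 1 = 0"
  "gre (z + w) = gre z + gre w" "gim (z + w) = gim z + gim w"
  "gre (z - w) = gre z - gre w" "gim (z - w) = gim z - gim w"
  "gre (- z) = - gre z" "gim (- z) = - gim z"
  "gre (z * w) = gre z * gre w - gim z * gim w" "gim (z * w) = gre z * gim w + gim z * gre w"
  by (auto simp: zero_gauss_def one_gauss_def plus_gauss_def minus_gauss_def
      uminus_gauss_def times_gauss_def)

lemma gauss_of_nat [simp]: "gre (of_nat n) = int n" "gim (of_nat n) = 0"
  by (induction n) auto

lemma gauss_of_int [simp]: "gre (of_int n) = n" "gim (of_int n) = 0"
  by (cases n; simp)+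

lemma gauss_numeral [simp]: "gre (numeral n) = numeral n" "gim (numeral n) = 0"
  using gauss_of_int[of "numeral n"] by (simp_all only: of_int_numeral)

definition gcnj :: "gauss \<Rightarrow> gauss" where "gcnj z = Gauss (gre z) (- gim z)"

lemma gcnj_sel [simp]: "gre (gcnj z) = gre z" "gim (gcnj z) = - gim z"
  by (simp_all add: gcnj_def)

lemma gcnj_simps [simp]:
  "gcnj (z + w) = gcnj z + gcnj w" "gcnj (z - w) = gcnj z - gcnj w" "gcnj (- z) = - gcnj z"
  "gcnj (z * w) = gcnj z * gcnj w" "gcnj (gcnj z) = z" "gcnj 0 = 0" "gcnj 1 = 1"
  "gcnj (of_int n) = of_int n" "gcnj (numeral k) = numeral k"
  by (auto simp: gauss_eq_iff algebra_simps)

lemma gcnj_power [simp]: "gcnj (z ^ m) = gcnj z ^ m"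
  by (induction m) auto

lemma gcnj_eq_0_iff [simp]: "gcnj z = 0 \<longleftrightarrow> z = 0"
  by (auto simp: gauss_eq_iff)

definition gnorm :: "gauss \<Rightarrow> int" where "gnorm z = (gre z)\<^sup>2 + (gim z)\<^sup>2"

lemma gnorm_mult: "gnorm (z * w) = gnorm z * gnorm w"
  by (simp add: gnorm_def power2_eq_square algebra_simps)

lemma gnorm_eq_0_iff [simp]: "gnorm z = 0 \<longleftrightarrow> z = 0"
  by (auto simp: gnorm_def gauss_eq_iff sum_power2_eq_zero_iff)

lemma gnorm_nonneg [simp]: "gnorm z \<ge> 0"
  by (simp add: gnorm_def)

lemma gnorm_pos_iff [simp]: "gnorm z > 0 \<longleftrightarrow> z \<noteq> 0"
  using gnorm_eq_0_iff[of z] gnorm_nonneg[of z] by linarith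

lemma mult_gcnj: "z * gcnj z = of_int (gnorm z)"
  by (simp add: gauss_eq_iff gnorm_def power2_eq_square)

instance gauss :: idom
proof
  fix a b :: gauss assume "a \<noteq> 0" "b \<noteq> 0"
  then show "a * b \<noteq> 0"
    using gnorm_mult[of a b] gnorm_eq_0_iff by (metis mult_eq_0_iff)
qed

instance gauss :: ring_char_0
proof
  show "inj (of_nat :: nat \<Rightarrow> gauss)"
    by (rule injI) (metis gauss_of_nat(1) of_nat_eq_iff)
qed

text \<open>The quotient \<open>(2 * a + b) div (2 * b)\<close> is the floor of
  \<open>a / b + 1 / 2\<close>, that is, \<open>a / b\<close> rounded to a nearest integer. Rounding
  instead of truncating is what makes Gaussian division with remainder decrease the norm.\<close>

lemma rounded_division:
  fixes a b :: int assumes "b > 0"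
  shows "\<bar>2 * (a - (2 * a + b) div (2 * b) * b)\<bar> \<le> b"
proof -
  have "(2 * a + b) div (2 * b) * (2 * b) + (2 * a + b) mod (2 * b) = 2 * a + b"
    by (rule div_mult_mod_eq)
  moreover have "0 \<le> (2 * a + b) mod (2 * b)" "(2 * a + b) mod (2 * b) < 2 * b"
    using assms by auto
  ultimately show ?thesis by (simp add: algebra_simps abs_le_iff)
qed

instantiation gauss :: idom_modulo
begin
definition "z div w = (if w = 0 then 0 else
  Gauss ((2 * gre (z * gcnj w) + gnorm w) div (2 * gnorm w))
        ((2 * gim (z * gcnj w) + gnorm w) div (2 * gnorm w)))" for z w :: gauss
definition "z mod w = z - z div w * w" for z w :: gauss
instance
proof
  fix a b :: gauss
  show "a div 0 = 0" by (simp add: divide_gauss_def)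
  show "a * b div b = a" if "b \<noteq> 0"
  proof -
    have *: "(2 * (x * gnorm b) + gnorm b) div (2 * gnorm b) = x" for x
      using that gnorm_pos_iff[of b] by (simp add: div_pos_pos_trivial mult.left_commute flip: distrib_right)
    have "a * b * gcnj b = a * of_int (gnorm b)"
      by (simp add: mult.assoc mult_gcnj)
    then show ?thesis
      using that * by (auto simp: divide_gauss_def gauss_eq_iff)
  qed
  show "a div b * b + a mod b = a"
    by (simp add: modulo_gauss_def)
qed
end

text \<open>Both coordinates of the exact quotient are rounded by at most \<open>1 / 2\<close>, so
  the remainder has at most half the norm of \<open>w\<close>. Multiplying by \<open>gcnj w\<close>
  keeps the argument in the integers.\<close>

lemma gnorm_mod_less:
  assumes "w \<noteq> 0" shows "gnorm (z mod w) < gnorm w"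
proof -
  let ?q = "z div w" and ?n = "gnorm w"
  have n: "?n > 0" using assms by simp
  have "z mod w * gcnj w = z * gcnj w - ?q * of_int ?n"
    by (simp add: modulo_gauss_def algebra_simps flip: mult_gcnj)
  then have e: "gre (z mod w * gcnj w) = gre (z * gcnj w) - gre ?q * ?n"
     "gim (z mod w * gcnj w) = gim (z * gcnj w) - gim ?q * ?n"
    by simp_all
  have "\<bar>2 * gre (z mod w * gcnj w)\<bar> \<le> ?n"
    unfolding e(1) using rounded_division[OF n, of "gre (z * gcnj w)"] assms
    by (simp add: divide_gauss_def)
  moreover have "\<bar>2 * gim (z mod w * gcnj w)\<bar> \<le> ?n"
    unfolding e(2) using rounded_division[OF n, of "gim (z * gcnj w)"] assms
    by (simp add: divide_gauss_def)
  ultimately have "(2 * gre (z mod w * gcnj w))\<^sup>2 \<le> ?n\<^sup>2" "(2 * gim (z mod w * gcnj w))\<^sup>2 \<le> ?n\<^sup>2"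
    using n by (simp_all only: abs_le_square_iff[symmetric])
  then have "4 * gnorm (z mod w * gcnj w) \<le> 2 * ?n\<^sup>2"
    by (simp add: gnorm_def power_mult_distrib del: gauss_sel)
  moreover have "gnorm (z mod w * gcnj w) = gnorm (z mod w) * ?n"
    by (simp add: gnorm_mult) (simp add: gnorm_def)
  ultimately have "2 * gnorm (z mod w) * ?n \<le> ?n * ?n"
    by (simp add: power2_eq_square mult_ac)
  then have "2 * gnorm (z mod w) \<le> ?n" using n by simp
  with n show ?thesis by linarith
qed

lemma gauss_unit_iff: "u dvd 1 \<longleftrightarrow> gnorm u = 1" for u :: gauss
proof
  assume "u dvd 1"
  then obtain v where "1 = u * v" by (elim dvdE)
  then have "gnorm u * gnorm v = 1" using gnorm_mult[of u v] by (simp add: gnorm_def)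
  then show "gnorm u = 1" using gnorm_nonneg[of u] by (metis dvd_triv_left zdvd1_eq abs_of_nonneg)
next
  assume "gnorm u = 1"
  then show "u dvd 1" using mult_gcnj[of u] by (metis dvd_triv_left of_int_1)
qed

lemma gauss_unit_cases:
  assumes "u dvd (1 :: gauss)"
  shows "u = Gauss 1 0 \<or> u = Gauss (-1) 0 \<or> u = Gauss 0 1 \<or> u = Gauss 0 (-1)"
proof -
  have *: "(gre u)\<^sup>2 + (gim u)\<^sup>2 = 1" using assms by (simp add: gauss_unit_iff gnorm_def)
  have "(gre u)\<^sup>2 \<le> 1\<^sup>2" "(gim u)\<^sup>2 \<le> 1\<^sup>2"
    using * zero_le_power2[of "gre u"] zero_le_power2[of "gim u"] unfolding one_power2 by linarith+
  then have "\<bar>gre u\<bar> \<le> 1" "\<bar>gim u\<bar> \<le> 1"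
    by (simp_all add: abs_square_le_1)
  then have "gre u \<in> {-1, 0, 1}" "gim u \<in> {-1, 0, 1}" by auto
  with * show ?thesis by (auto simp: gauss_eq_iff)
qed

text \<open>The unit \<open>u\<close> for which \<open>z / u\<close> lies in the half-open first quadrant.\<close>

instantiation gauss :: normalization_euclidean_semiring
begin
definition "euclidean_size z = nat (gnorm z)"
definition "unit_factor z =
  (if z = 0 then 0 else if gre z > 0 \<and> gim z \<ge> 0 then Gauss 1 0
   else if gre z \<le> 0 \<and> gim z > 0 then Gauss 0 1
   else if gre z < 0 \<and> gim z \<le> 0 then Gauss (-1) 0 else Gauss 0 (-1))"
definition "normalize z = z * gcnj (unit_factor z)"
instance
proof
  fix a b :: gauss
  show "euclidean_size (0 :: gauss) = 0" by (simp add: euclidean_size_gauss_def gnorm_def)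
  show "euclidean_size (a mod b) < euclidean_size b" if "b \<noteq> 0"
    using gnorm_mod_less[OF that] that by (simp add: euclidean_size_gauss_def)
  show "euclidean_size a \<le> euclidean_size (a * b)" if "b \<noteq> 0"
  proof -
    have "gnorm b \<ge> 1" using that gnorm_pos_iff[of b] by linarith
    then have "gnorm a * 1 \<le> gnorm a * gnorm b" by (intro mult_left_mono) auto
    then show ?thesis by (simp add: euclidean_size_gauss_def gnorm_mult)
  qed
  show "unit_factor (0 :: gauss) = 0" by (simp add: unit_factor_gauss_def)
  show "unit_factor a = a" if "is_unit a"
    using gauss_unit_cases[OF that] by (auto simp: unit_factor_gauss_def gauss_eq_iff)
  show "is_unit (unit_factor a)" if "a \<noteq> 0"
    using that by (auto simp: unit_factor_gauss_def gauss_unit_iff gnorm_def)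
  show "unit_factor (a * b) = a * unit_factor b" if "is_unit a"
  proof -
    have b: "b = 0 \<or> gre b > 0 \<and> gim b \<ge> 0 \<or> gre b \<le> 0 \<and> gim b > 0 \<or> gre b < 0 \<and> gim b \<le> 0
      \<or> gre b \<ge> 0 \<and> gim b < 0"
      unfolding gauss_eq_iff by simp linarith
    show ?thesis
      using gauss_unit_cases[OF that]
    proof (elim disjE)
      assume "a = Gauss 1 0"
      with b show ?thesis by (elim disjE) (simp_all add: unit_factor_gauss_def gauss_eq_iff)
    next
      assume "a = Gauss (-1) 0"
      with b show ?thesis by (elim disjE) (simp_all add: unit_factor_gauss_def gauss_eq_iff)
    next
      assume "a = Gauss 0 1"
      with b show ?thesis by (elim disjE) (simp_all add: unit_factor_gauss_def gauss_eq_iff)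
    next
      assume "a = Gauss 0 (-1)"
      with b show ?thesis by (elim disjE) (simp_all add: unit_factor_gauss_def gauss_eq_iff)
    qed
  qed
  show "unit_factor a * normalize a = a"
    by (simp add: unit_factor_gauss_def normalize_gauss_def gauss_eq_iff)
  show "normalize (0 :: gauss) = 0" by (simp add: normalize_gauss_def)
qed
end

instantiation gauss :: euclidean_ring_gcd
begin
definition "gcd_gauss = (Euclidean_Algorithm.gcd :: gauss \<Rightarrow> _)"
definition "lcm_gauss = (Euclidean_Algorithm.lcm :: gauss \<Rightarrow> _)"
definition "Gcd_gauss = (Euclidean_Algorithm.Gcd :: gauss set \<Rightarrow> _)"
definition "Lcm_gauss = (Euclidean_Algorithm.Lcm :: gauss set \<Rightarrow> _)"
instance
  by standard (simp_all add: gcd_gauss_def lcm_gauss_def Gcd_gauss_def Lcm_gauss_def)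
end

text \<open>Defined through \<open>cmod\<close>, so that the triangle inequality and the coordinate
  bounds are inherited from the complex numbers; \<open>gmod_altdef\<close> is the link to the
  multiplicative \<open>gnorm\<close>.\<close>

definition gmod :: "gauss \<Rightarrow> real" where
  "gmod z = cmod (Complex (of_int (gre z)) (of_int (gim z)))"

lemma gmod_altdef: "gmod z = sqrt (of_int (gnorm z))"
  by (simp add: gmod_def complex_norm gnorm_def)

lemma gmod_power2: "gmod z ^ 2 = of_int (gnorm z)"
  by (simp add: gmod_altdef)

lemma gmod_mult: "gmod (z * w) = gmod z * gmod w"
  by (simp add: gmod_altdef gnorm_mult real_sqrt_mult)

lemma gmod_nonneg [simp]: "gmod z \<ge> 0"
  by (simp add: gmod_def)

lemma gmod_eq_0_iff [simp]: "gmod z = 0 \<longleftrightarrow> z = 0"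
  by (simp add: gmod_altdef)

lemma gmod_pos_iff [simp]: "gmod z > 0 \<longleftrightarrow> z \<noteq> 0"
  using gmod_nonneg[of z] gmod_eq_0_iff[of z] by linarith

lemma gmod_ge_1: "z \<noteq> 0 \<Longrightarrow> gmod z \<ge> 1"
  using gnorm_pos_iff[of z] by (simp add: gmod_altdef del: gnorm_pos_iff)

lemma gmod_add_le: "gmod (z + w) \<le> gmod z + gmod w"
  unfolding gmod_def by (rule order.trans[OF _ norm_triangle_ineq]) (simp add: complex_add)

lemma gmod_minus [simp]: "gmod (- z) = gmod z"
  by (simp add: gmod_altdef gnorm_def)

lemma gmod_diff_le: "gmod (z - w) \<le> gmod z + gmod w"
  using gmod_add_le[of z "- w"] by simp

lemma gmod_gcnj [simp]: "gmod (gcnj z) = gmod z"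
  by (simp add: gmod_altdef gnorm_def)

lemma gmod_of_int [simp]: "gmod (of_int n) = \<bar>of_int n\<bar>"
  by (simp add: gmod_altdef gnorm_def)

lemma gmod_numeral [simp]: "gmod (numeral n) = numeral n"
  using gmod_of_int[of "numeral n"] by simp

lemma gmod_0 [simp]: "gmod 0 = 0" and gmod_1 [simp]: "gmod 1 = 1"
  using gmod_of_int[of 0] gmod_of_int[of 1] by simp_all

lemma gmod_power: "gmod (z ^ n) = gmod z ^ n"
  by (induction n) (simp_all add: gmod_mult)

lemma abs_gre_le: "\<bar>of_int (gre z)\<bar> \<le> gmod z" and abs_gim_le: "\<bar>of_int (gim z)\<bar> \<le> gmod z"
  using abs_Re_le_cmod abs_Im_le_cmod unfolding gmod_def by (metis complex.sel)+

lemma gmod_le: "gmod z \<le> \<bar>of_int (gre z)\<bar> + \<bar>of_int (gim z)\<bar>"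
  using cmod_le[of "Complex (of_int (gre z)) (of_int (gim z))"] by (simp add: gmod_def)

lemma gmod_dvd_le: "d dvd z \<Longrightarrow> z \<noteq> 0 \<Longrightarrow> gmod d \<le> gmod z"
proof (elim dvdE)
  fix k assume *: "z \<noteq> 0" "z = d * k"
  then have "gmod d * 1 \<le> gmod d * gmod k" by (intro mult_left_mono gmod_ge_1) auto
  with * show ?thesis by (simp add: gmod_mult)
qed

section \<open>Lattice points in discs and sums over them\<close>

definition disc :: "real \<Rightarrow> gauss set" where "disc R = {z. gmod z \<le> R}"

lemma card_int_abs_le:
  assumes "R \<ge> 0" shows "finite {n::int. \<bar>of_int n\<bar> \<le> (R::real)}"
    and "real (card {n::int. \<bar>of_int n\<bar> \<le> R}) \<le> 2 * R + 1"
proof -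
  have e: "{n::int. \<bar>of_int n\<bar> \<le> R} = {- \<lfloor>R\<rfloor>..\<lfloor>R\<rfloor>}"
    by (auto simp: abs_le_iff le_floor_iff) linarith+
  show "finite {n::int. \<bar>of_int n\<bar> \<le> R}" unfolding e by simp
  show "real (card {n::int. \<bar>of_int n\<bar> \<le> R}) \<le> 2 * R + 1"
    unfolding e using assms by (simp add: of_nat_nat)
qed

lemma disc_neg: "R < 0 \<Longrightarrow> disc R = {}"
proof -
  assume "R < 0"
  then have "\<not> gmod z \<le> R" for z using gmod_nonneg[of z] by linarith
  then show ?thesis by (simp add: disc_def)
qed

lemma disc_subset: "disc R \<subseteq> (\<lambda>(x,y). Gauss x y) ` ({n. \<bar>of_int n\<bar> \<le> R} \<times> {n. \<bar>of_int n\<bar> \<le> R})"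
proof
  fix z assume "z \<in> disc R"
  then have "\<bar>of_int (gre z)\<bar> \<le> R" "\<bar>of_int (gim z)\<bar> \<le> R"
    using abs_gre_le[of z] abs_gim_le[of z] by (auto simp: disc_def)
  then show "z \<in> (\<lambda>(x,y). Gauss x y) ` ({n. \<bar>of_int n\<bar> \<le> R} \<times> {n. \<bar>of_int n\<bar> \<le> R})"
    by (intro image_eqI[of _ _ "(gre z, gim z)"]) auto
qed

lemma finite_disc [simp]: "finite (disc R)"
proof (cases "R \<ge> 0")
  case True
  show ?thesis
    by (rule finite_subset[OF disc_subset]) (use card_int_abs_le(1)[OF True] in auto)
qed (auto simp: disc_neg)

lemma card_disc:
  assumes "R \<ge> 0" shows "real (card (disc R)) \<le> (2 * R + 1)\<^sup>2"
proof -
  let ?A = "{n::int. \<bar>of_int n\<bar> \<le> R}"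
  have "card (disc R) \<le> card ((\<lambda>(x,y). Gauss x y) ` (?A \<times> ?A))"
    using card_int_abs_le(1)[OF assms] by (intro card_mono disc_subset) auto
  also have "\<dots> \<le> card (?A \<times> ?A)"
    using card_int_abs_le(1)[OF assms] by (intro card_image_le) auto
  also have "\<dots> = card ?A * card ?A" by (rule card_cartesian_product)
  finally have "real (card (disc R)) \<le> real (card ?A) * real (card ?A)"
    by (metis of_nat_le_iff of_nat_mult)
  also have "\<dots> \<le> (2 * R + 1) * (2 * R + 1)"
    using card_int_abs_le(2)[OF assms] assms by (intro mult_mono) auto
  finally show ?thesis by (simp add: power2_eq_square)
qed

lemma card_disc': "R \<ge> 1 \<Longrightarrow> real (card (disc R)) \<le> 9 * R\<^sup>2"
proof -
  assume R: "R \<ge> 1"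
  have "real (card (disc R)) \<le> (2 * R + 1)\<^sup>2" using R by (intro card_disc) auto
  also have "\<dots> \<le> (3 * R)\<^sup>2" using R by (intro power_mono) auto
  finally show ?thesis by (simp add: power_mult_distrib)
qed

text \<open>One member \<open>z0\<close> of the residue class serves as base point; the others are
  \<open>z0 + y * w\<close>, and since \<open>z0\<close> lies in the disc too, \<open>w\<close>
  ranges over a disc of radius \<open>2 * R / gmod y\<close>.\<close>

lemma card_disc_residue:
  assumes "y \<noteq> 0" "R \<ge> 0"
  shows "real (card {z \<in> disc R. y dvd z - a}) \<le> (4 * (R / gmod y) + 1)\<^sup>2"
proof (cases "{z \<in> disc R. y dvd z - a} = {}")
  case False
  then obtain z0 where z0: "z0 \<in> disc R" "y dvd z0 - a" by auto
  have "{z \<in> disc R. y dvd z - a} \<subseteq> (\<lambda>w. z0 + y * w) ` disc (2 * R / gmod y)"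
  proof
    fix z assume z: "z \<in> {z \<in> disc R. y dvd z - a}"
    then have "y dvd z - z0" using z0 dvd_diff[of y "z - a" "z0 - a"] by auto
    then obtain w where w: "z - z0 = y * w" by (elim dvdE)
    have "gmod y * gmod w \<le> gmod z + gmod z0"
      using gmod_diff_le[of z z0] by (simp add: w gmod_mult)
    also have "\<dots> \<le> 2 * R" using z z0 by (auto simp: disc_def)
    finally have "gmod w \<le> 2 * R / gmod y" using assms by (simp add: field_simps)
    with w show "z \<in> (\<lambda>w. z0 + y * w) ` disc (2 * R / gmod y)"
      by (intro image_eqI[of _ _ w]) (auto simp: disc_def algebra_simps)
  qed
  then have "card {z \<in> disc R. y dvd z - a} \<le> card (disc (2 * R / gmod y))"
    by (meson finite_disc surj_card_le)
  also have "real \<dots> \<le> (2 * (2 * R / gmod y) + 1)\<^sup>2"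
    using assms by (intro card_disc) auto
  finally show ?thesis by simp
qed (auto simp del: Collect_empty_eq)

lemma card_disc_line:
  assumes "(a, b) \<noteq> (0, 0)" "R \<ge> 0"
  shows "real (card {z \<in> disc R. a * gre z + b * gim z = c}) \<le> 2 * R + 1"
proof -
  let ?A = "{n::int. \<bar>of_int n\<bar> \<le> R}" and ?S = "{z \<in> disc R. a * gre z + b * gim z = c}"
  define f where "f = (if b \<noteq> 0 then gre else gim)"
  have "inj_on f ?S"
    using assms by (intro inj_onI) (auto simp: f_def gauss_eq_iff split: if_splits)
  moreover have "f ` ?S \<subseteq> ?A"
  proof safe
    fix z assume "z \<in> disc R"
    then show "\<bar>of_int (f z)\<bar> \<le> R"
      using abs_gre_le[of z] abs_gim_le[of z] by (auto simp: f_def disc_def)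
  qed
  ultimately have "card ?S \<le> card ?A"
    using card_int_abs_le(1)[OF assms(2)] by (rule card_inj_on_le)
  then show ?thesis using card_int_abs_le(2)[OF assms(2)] by linarith
qed

text \<open>The sum is grouped by the maximum norm \<open>s e\<close>: at most \<open>12 * m\<close>
  lattice points lie on the square of size \<open>m\<close>, and \<open>gmod e\<close> is at least
  \<open>s e\<close>, so a decreasing \<open>f\<close> can only grow when \<open>gmod e\<close> is
  replaced by \<open>s e\<close>.\<close>

lemma sum_disc_le:
  fixes f :: "real \<Rightarrow> real"
  assumes nonneg: "\<And>x. x \<ge> 1 \<Longrightarrow> f x \<ge> 0" and anti: "\<And>x y. 1 \<le> x \<Longrightarrow> x \<le> y \<Longrightarrow> f y \<le> f x"
  shows "(\<Sum>e\<in>disc A - {0}. f (gmod e)) \<le> (\<Sum>m=1..nat \<lfloor>A\<rfloor>. 12 * real m * f (real m))"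
proof -
  define s where "s e = nat (max \<bar>gre e\<bar> \<bar>gim e\<bar>)" for e
  have s1: "s e \<ge> 1" if "e \<noteq> 0" for e using that by (auto simp: s_def gauss_eq_iff)
  have s2: "real (s e) \<le> gmod e" for e
    using abs_gre_le[of e] abs_gim_le[of e] by (simp add: s_def max_def)
  have sA: "s e \<in> {1..nat \<lfloor>A\<rfloor>}" if "e \<in> disc A - {0}" for e
    using that s1[of e] s2[of e] by (auto simp: disc_def) linarith
  have "(\<Sum>e\<in>disc A - {0}. f (gmod e)) \<le> (\<Sum>e\<in>disc A - {0}. f (real (s e)))"
    using s1 s2 by (intro sum_mono anti) auto
  also have "\<dots> = (\<Sum>m=1..nat \<lfloor>A\<rfloor>. \<Sum>e\<in>{e \<in> disc A - {0}. s e = m}. f (real (s e)))"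
    by (rule sum.group[symmetric]) (simp, simp, use sA in blast)
  also have "\<dots> \<le> (\<Sum>m=1..nat \<lfloor>A\<rfloor>. 12 * real m * f (real m))"
  proof (intro sum_mono)
    fix m assume m: "m \<in> {1..nat \<lfloor>A\<rfloor>}"
    let ?I = "{- int m..int m}" and ?J = "{int m, - int m}"
    let ?T = "(\<lambda>(x,y). Gauss x y) ` (?I \<times> ?J \<union> ?J \<times> ?I)"
    have "{e \<in> disc A - {0}. s e = m} \<subseteq> ?T"
    proof
      fix e assume "e \<in> {e \<in> disc A - {0}. s e = m}"
      then have "max \<bar>gre e\<bar> \<bar>gim e\<bar> = int m" by (auto simp: s_def)
      then have "(gre e, gim e) \<in> ?I \<times> ?J \<union> ?J \<times> ?I" by (auto simp: max_def split: if_splits)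
      then show "e \<in> ?T" by (intro image_eqI[of _ _ "(gre e, gim e)"]) auto
    qed
    then have "card {e \<in> disc A - {0}. s e = m} \<le> card ?T" by (intro card_mono) auto
    also have "\<dots> \<le> card (?I \<times> ?J \<union> ?J \<times> ?I)" by (intro card_image_le) auto
    also have "\<dots> \<le> card (?I \<times> ?J) + card (?J \<times> ?I)" by (rule card_Un_le)
    also have "\<dots> \<le> (2 * m + 1) * 2 + 2 * (2 * m + 1)"
      using m by (simp add: card_cartesian_product card_insert_if)
    also have "\<dots> \<le> 12 * m" using m by simp
    finally have "real (card {e \<in> disc A - {0}. s e = m}) \<le> 12 * real m" by linarith
    then show "(\<Sum>e\<in>{e \<in> disc A - {0}. s e = m}. f (real (s e))) \<le> 12 * real m * f (real m)"
      using m by (simp add: mult_right_mono nonneg)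
  qed
  finally show ?thesis .
qed

lemma sum_powr_bounded:
  assumes "s > 1"
  shows "\<exists>C>0. \<forall>n. (\<Sum>m=1..n. real m powr - s) \<le> C"
proof -
  have *: "summable (\<lambda>m. real m powr - s)" using assms by (simp add: summable_real_powr_iff)
  let ?C = "\<Sum>m. real m powr - s"
  have "(\<Sum>m=1..n. real m powr - s) \<le> ?C + 1" for n
    using sum_le_suminf[OF *, of "{1..n}"] by simp
  moreover have "?C \<ge> 0" by (intro suminf_nonneg * ) auto
  ultimately show ?thesis by (intro exI[of _ "?C + 1"]) auto
qed

lemma sum_disc_powr_bounded:
  assumes "s > 2"
  shows "\<exists>C>0. \<forall>A. (\<Sum>e\<in>disc A - {0}. gmod e powr - s) \<le> C"
proof -
  obtain C where C: "C > 0" "\<And>n. (\<Sum>m=1..n. real m powr - (s - 1)) \<le> C"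
    using sum_powr_bounded[of "s - 1"] assms by auto
  have "(\<Sum>e\<in>disc A - {0}. gmod e powr - s) \<le> 12 * C" for A
  proof -
    have "(\<Sum>e\<in>disc A - {0}. gmod e powr - s) \<le> (\<Sum>m=1..nat \<lfloor>A\<rfloor>. 12 * real m * real m powr - s)"
      using assms by (intro sum_disc_le) (auto intro!: powr_mono2')
    also have "\<dots> = (\<Sum>m=1..nat \<lfloor>A\<rfloor>. 12 * real m powr - (s - 1))"
      by (intro sum.cong) (auto simp: powr_mult_base)
    also have "\<dots> \<le> 12 * C" using C(2) by (simp flip: sum_distrib_left)
    finally show ?thesis .
  qed
  with C show ?thesis by (intro exI[of _ "12 * C"]) auto
qed

lemma sum_disc_inverse:
  assumes "A \<ge> 0"
  shows "(\<Sum>e\<in>disc A - {0}. 1 / gmod e) \<le> 12 * A"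
proof -
  have "(\<Sum>e\<in>disc A - {0}. 1 / gmod e) \<le> (\<Sum>m=1..nat \<lfloor>A\<rfloor>. 12 * real m * (1 / real m))"
    by (intro sum_disc_le) (auto intro!: divide_left_mono)
  also have "\<dots> = (\<Sum>m=1..nat \<lfloor>A\<rfloor>. 12)" by (intro sum.cong) auto
  also have "\<dots> \<le> 12 * A" using assms by simp
  finally show ?thesis .
qed

text \<open>A small power is a convenient substitute for the logarithm: \<open>1 / m\<close> is at
  most \<open>m powr - (1 + \<eta>) * A powr \<eta>\<close> for \<open>m\<close> up to
  \<open>A\<close>, and the first factor is summable.\<close>

lemma sum_inverse_le_powr:
  assumes "\<eta> > 0"
  shows "\<exists>C>0. \<forall>A\<ge>1. (\<Sum>m=1..nat \<lfloor>A\<rfloor>. 1 / real m) \<le> C * A powr \<eta>"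
proof -
  obtain C where C: "C > 0" "\<And>n. (\<Sum>m=1..n. real m powr - (1 + \<eta>)) \<le> C"
    using sum_powr_bounded[of "1 + \<eta>"] assms by auto
  have "(\<Sum>m=1..nat \<lfloor>A\<rfloor>. 1 / real m) \<le> C * A powr \<eta>" if "A \<ge> 1" for A
  proof -
    have "(\<Sum>m=1..nat \<lfloor>A\<rfloor>. 1 / real m) \<le> (\<Sum>m=1..nat \<lfloor>A\<rfloor>. real m powr - (1 + \<eta>) * A powr \<eta>)"
    proof (intro sum_mono)
      fix m assume m: "m \<in> {1..nat \<lfloor>A\<rfloor>}"
      then have mA: "real m \<le> A" by simp linarith
      have "1 / real m = real m powr - (1 + \<eta>) * real m powr \<eta>"
        using m by (simp add: powr_minus_divide flip: powr_add)
      also have "\<dots> \<le> real m powr - (1 + \<eta>) * A powr \<eta>"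
        using mA assms by (intro mult_left_mono powr_mono2) auto
      finally show "1 / real m \<le> real m powr - (1 + \<eta>) * A powr \<eta>" .
    qed
    also have "\<dots> \<le> C * A powr \<eta>"
      using C(2) by (simp flip: sum_distrib_right add: mult_right_mono)
    finally show ?thesis .
  qed
  with C show ?thesis by blast
qed

lemma sum_disc_inverse_square:
  assumes "\<eta> > 0"
  shows "\<exists>C>0. \<forall>A\<ge>1. (\<Sum>e\<in>disc A - {0}. 1 / (gmod e)\<^sup>2) \<le> C * A powr \<eta>"
proof -
  obtain C where C: "C > 0" "\<And>A. A \<ge> 1 \<Longrightarrow> (\<Sum>m=1..nat \<lfloor>A\<rfloor>. 1 / real m) \<le> C * A powr \<eta>"
    using sum_inverse_le_powr[OF assms] by auto
  have "(\<Sum>e\<in>disc A - {0}. 1 / (gmod e)\<^sup>2) \<le> 12 * C * A powr \<eta>" if "A \<ge> 1" for A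
  proof -
    have "(\<Sum>e\<in>disc A - {0}. 1 / (gmod e)\<^sup>2) \<le> (\<Sum>m=1..nat \<lfloor>A\<rfloor>. 12 * real m * (1 / (real m)\<^sup>2))"
      by (intro sum_disc_le[where f = "\<lambda>x. 1 / x\<^sup>2"]) (auto intro!: divide_left_mono power_mono mult_pos_pos)
    also have "\<dots> = (\<Sum>m=1..nat \<lfloor>A\<rfloor>. 12 * (1 / real m))"
      by (intro sum.cong) (auto simp: power2_eq_square)
    also have "\<dots> \<le> 12 * (C * A powr \<eta>)"
      unfolding sum_distrib_left[symmetric] using C(2)[OF that] by (intro mult_left_mono) auto
    finally show ?thesis by simp
  qed
  with C show ?thesis by (intro exI[of _ "12 * C"]) auto
qed

lemma sum_nonzero_ints:
  fixes f :: "real \<Rightarrow> real" and A :: real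
  assumes "A \<ge> 0"
  shows "(\<Sum>l\<in>{l::int. l \<noteq> 0 \<and> \<bar>of_int l\<bar> \<le> A}. f \<bar>of_int l\<bar>) = 2 * (\<Sum>m=1..nat \<lfloor>A\<rfloor>. f (real m))"
proof -
  let ?I = "{1..nat \<lfloor>A\<rfloor>}"
  have *: "{l::int. l \<noteq> 0 \<and> \<bar>of_int l\<bar> \<le> A} = int ` ?I \<union> (\<lambda>m. - int m) ` ?I" (is "?L = ?R")
  proof (intro equalityI subsetI)
    fix l assume l: "l \<in> ?L"
    then have "\<bar>l\<bar> \<le> \<lfloor>A\<rfloor>" by (simp add: le_floor_iff)
    then have "nat \<bar>l\<bar> \<in> ?I" using l by auto
    moreover have "l = int (nat \<bar>l\<bar>) \<or> l = - int (nat \<bar>l\<bar>)" by auto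
    ultimately show "l \<in> ?R" by blast
  next
    fix l assume "l \<in> ?R"
    then obtain m where m: "m \<in> ?I" "l = int m \<or> l = - int m" by auto
    then have "real m \<le> of_int \<lfloor>A\<rfloor>" by auto
    then have "real m \<le> A" by linarith
    with m show "l \<in> ?L" by auto
  qed
  show ?thesis
    unfolding * by (subst sum.union_disjoint) (auto simp: sum.reindex inj_on_def)
qed

section \<open>Divisors and points on hyperbolas\<close>

definition divisors :: "gauss \<Rightarrow> gauss set" where "divisors z = {d. d dvd z}"

lemma divisors_subset: "z \<noteq> 0 \<Longrightarrow> divisors z \<subseteq> disc (gmod z) - {0}"
  by (auto simp: divisors_def disc_def gmod_dvd_le)

lemma finite_divisors [simp]: "z \<noteq> 0 \<Longrightarrow> finite (divisors z)"
  using divisors_subset by (rule finite_subset) auto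

text \<open>The products \<open>p ^ i * d\<close> cover all divisors: splitting off the exact power
  of \<open>p\<close> leaves a part coprime to \<open>p\<close>, which must divide
  \<open>y\<close>.\<close>

lemma card_divisors_prime_power_mult:
  fixes p y :: gauss
  assumes "prime p" "\<not> p dvd y" "y \<noteq> 0"
  shows "card (divisors (p ^ e * y)) \<le> (e + 1) * card (divisors y)"
proof -
  have "divisors (p ^ e * y) \<subseteq> (\<lambda>(i, d). p ^ i * d) ` ({..e} \<times> divisors y)"
  proof
    fix d assume d: "d \<in> divisors (p ^ e * y)"
    then have d0: "d \<noteq> 0" "d dvd p ^ e * y"
      using assms by (auto simp: divisors_def)
    have pu: "\<not> is_unit p" using assms(1) by auto
    obtain d' where d': "d = p ^ multiplicity p d * d'" "\<not> p dvd d'"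
      using multiplicity_decompose'[OF d0(1) pu] by blast
    have "multiplicity p d \<le> multiplicity p (p ^ e * y)"
      using d0 assms by (intro dvd_imp_multiplicity_le) auto
    also have "\<dots> = e"
      using assms by (subst prime_elem_multiplicity_mult_distrib)
        (auto simp: not_dvd_imp_multiplicity_0)
    finally have "multiplicity p d \<le> e" .
    moreover have "coprime d' (p ^ e)"
      using prime_imp_coprime[OF assms(1) d'(2)] by (simp add: coprime_commute)
    then have "d' dvd y"
      using d0(2) d'(1) by (metis coprime_dvd_mult_right_iff dvd_mult_right)
    ultimately show "d \<in> (\<lambda>(i, d). p ^ i * d) ` ({..e} \<times> divisors y)"
      using d'(1) by (intro image_eqI[of _ _ "(multiplicity p d, d')"]) (auto simp: divisors_def)
  qed
  then have "card (divisors (p ^ e * y)) \<le> card ((\<lambda>(i, d). p ^ i * d) ` ({..e} \<times> divisors y))"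
    using assms by (intro card_mono) auto
  also have "\<dots> \<le> card ({..e} \<times> divisors y)" using assms by (intro card_image_le) auto
  finally show ?thesis by (simp add: card_cartesian_product)
qed

lemma card_divisors_unit: "is_unit z \<Longrightarrow> card (divisors z) \<le> 4"
proof -
  assume "is_unit z"
  then have "divisors z \<subseteq> {Gauss 1 0, Gauss (-1) 0, Gauss 0 1, Gauss 0 (-1)}"
    using gauss_unit_cases by (auto simp: divisors_def) (meson dvd_trans)+
  then have "card (divisors z) \<le> card {Gauss 1 0, Gauss (-1) 0, Gauss 0 1, Gauss 0 (-1)}"
    by (intro card_mono) auto
  then show ?thesis by simp
qed

text \<open>Each prime contributes a factor \<open>e + 1\<close>, which is at most the \<open>\<eta>\<close>-th power of its
  contribution to the modulus, except for boundedly many small primes.\<close>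

theorem divisor_bound:
  assumes "\<eta> > 0"
  shows "\<exists>C>0. \<forall>z. z \<noteq> 0 \<longrightarrow> real (card (divisors z)) \<le> C * gmod z powr \<eta>"
proof -
  \<comment> \<open>\<open>B\<close> solves \<open>B powr \<eta> = 2\<close>, so for primes of
    modulus at least \<open>B\<close> the bound \<open>e + 1 \<le> 2 ^ e\<close> already suffices.
    For the others a constant \<open>K \<ge> 1 / c\<close> is paid, where
    \<open>exp (c * e) = (sqrt 2 ^ e) powr \<eta>\<close> and \<open>sqrt 2\<close> bounds the
    modulus of every prime from below.\<close>
  define B where "B = 2 powr (1 / \<eta>)"
  define c where "c = ln 2 / 2 * \<eta>"
  define K where "K = max 1 (1 / c)"
  have c: "c > 0" using assms by (simp add: c_def)
  have K: "K \<ge> 1" "K * c \<ge> 1" using c by (auto simp: K_def max_def field_simps)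
  have prime_mod: "gmod p \<ge> sqrt 2" if "prime p" for p
  proof -
    have "p \<noteq> 0" "\<not> is_unit p" using that by auto
    then have "gnorm p \<ge> 2"
      using gnorm_pos_iff[of p] by (simp add: gauss_unit_iff del: gnorm_pos_iff)
    then show ?thesis by (simp add: gmod_altdef)
  qed
  have big: "real (e + 1) \<le> (gmod p ^ e) powr \<eta>" if "prime p" "gmod p \<ge> B" for p e
  proof -
    have "real (e + 1) \<le> 2 ^ e" by (induction e) auto
    also have "\<dots> = (B ^ e) powr \<eta>"
      using assms by (simp add: B_def powr_powr flip: powr_realpow powr_mult)
    also have "\<dots> \<le> (gmod p ^ e) powr \<eta>"
      using that assms by (intro powr_mono2 power_mono) (auto simp: B_def)
    finally show ?thesis .
  qed
  have small: "real (e + 1) \<le> K * (gmod p ^ e) powr \<eta>" if "prime p" for p e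
  proof -
    have "real (e + 1) \<le> K * (1 + c * real e)"
      using K mult_right_mono[OF K(2), of "real e"] by (simp add: algebra_simps)
    also have "\<dots> \<le> K * exp (c * real e)" using K by (intro mult_left_mono exp_ge_add_one_self) auto
    also have "exp (c * real e) = (sqrt 2 ^ e) powr \<eta>"
      by (simp add: c_def powr_def ln_realpow ln_sqrt)
    also have "K * (sqrt 2 ^ e) powr \<eta> \<le> K * (gmod p ^ e) powr \<eta>"
      using prime_mod[OF that] K assms by (intro mult_left_mono powr_mono2 power_mono) auto
    finally show ?thesis .
  qed
  define S where "S = disc B"
  \<comment> \<open>Induction over the number of prime factors: one prime is split off, and the
    factor \<open>K\<close> is paid only for primes in \<open>S\<close>, a finite set independent of
    \<open>z\<close>. The initial \<open>4\<close> counts the units.\<close>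
  have main: "real (card (divisors z)) \<le> 4 * K ^ card (prime_factors z \<inter> S) * gmod z powr \<eta>"
    if "z \<noteq> 0" for z
    using that
  proof (induction "card (prime_factors z)" arbitrary: z rule: less_induct)
    case less
    show ?case
    proof (cases "prime_factors z = {}")
      case True
      then have u: "is_unit z" using less.prems by (simp add: prime_factorization_empty_iff)
      then have "gmod z = 1" by (simp add: gauss_unit_iff gmod_altdef)
      then show ?thesis using card_divisors_unit[OF u] True by simp
    next
      case False
      then obtain p where p: "p \<in> prime_factors z" by auto
      then have pp: "prime p" and pz: "p dvd z" by (auto simp: in_prime_factors_imp_dvd)
      define e where "e = multiplicity p z"
      obtain y where y: "z = p ^ e * y" "\<not> p dvd y"
        using multiplicity_decompose'[OF less.prems, of p] pp unfolding e_def by auto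
      have y0: "y \<noteq> 0" using y less.prems by auto
      have e: "e > 0" using pz pp less.prems by (simp add: e_def prime_multiplicity_gt_zero_iff)
      have pf: "prime_factors z = insert p (prime_factors y)"
        using y0 pp e y(1) less.prems
        by (auto simp: prime_factors_dvd prime_dvd_mult_iff prime_dvd_power_iff
            dest: primes_dvd_imp_eq)
      have pny: "p \<notin> prime_factors y" using y(2) by (auto dest: in_prime_factors_imp_dvd)
      have IH: "real (card (divisors y)) \<le> 4 * K ^ card (prime_factors y \<inter> S) * gmod y powr \<eta>"
        using less.hyps[of y] y0 pf pny by simp
      have step: "real (e + 1) \<le> (if p \<in> S then K else 1) * (gmod p ^ e) powr \<eta>"
        using big[OF pp] small[OF pp] by (auto simp: S_def disc_def)
      have "real (card (divisors z)) \<le> real ((e + 1) * card (divisors y))"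
        unfolding y(1) using card_divisors_prime_power_mult[OF pp y(2) y0] by (simp only: of_nat_le_iff)
      also have "\<dots> = real (e + 1) * real (card (divisors y))" by (rule of_nat_mult)
      also have "\<dots> \<le> ((if p \<in> S then K else 1) * (gmod p ^ e) powr \<eta>) *
          (4 * K ^ card (prime_factors y \<inter> S) * gmod y powr \<eta>)"
        using K by (intro mult_mono IH step) auto
      also have "\<dots> = 4 * ((if p \<in> S then K else 1) * K ^ card (prime_factors y \<inter> S)) *
          ((gmod p ^ e) powr \<eta> * gmod y powr \<eta>)" by simp
      also have "(gmod p ^ e) powr \<eta> * gmod y powr \<eta> = gmod z powr \<eta>"
        by (simp add: y(1) gmod_mult gmod_power powr_mult)
      also have "(if p \<in> S then K else 1) * K ^ card (prime_factors y \<inter> S) = K ^ card (prime_factors z \<inter> S)"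
        using pny by (auto simp: pf Int_insert_left)
      finally show ?thesis .
    qed
  qed
  have "real (card (divisors z)) \<le> 4 * K ^ card S * gmod z powr \<eta>" if "z \<noteq> 0" for z
  proof -
    have "K ^ card (prime_factors z \<inter> S) \<le> K ^ card S"
      using K by (intro power_increasing card_mono) (auto simp: S_def)
    then have "4 * K ^ card (prime_factors z \<inter> S) * gmod z powr \<eta> \<le> 4 * K ^ card S * gmod z powr \<eta>"
      by (intro mult_right_mono) auto
    with main[OF that] show ?thesis by linarith
  qed
  moreover have "4 * K ^ card S > 0" using K by simp
  ultimately show ?thesis by blast
qed

section \<open>Primitive vectors and integer points on hyperbolas\<close>

definition primitive :: "gauss \<Rightarrow> bool" where "primitive z \<longleftrightarrow> coprime (gre z) (gim z)"

lemma primitive_decompose: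
  assumes "z \<noteq> 0"
  obtains g w where "g > 0" "z = of_int g * w" "primitive w" "w \<noteq> 0"
proof -
  define g where "g = gcd (gre z) (gim z)"
  have g: "g > 0" using assms by (auto simp: g_def gauss_eq_iff)
  obtain a b where ab: "gre z = a * g" "gim z = b * g" "coprime a b"
    using gcd_coprime_exists[of "gre z" "gim z"] g unfolding g_def by auto
  have z: "z = of_int g * Gauss a b" using ab by (simp add: gauss_eq_iff mult.commute)
  have "Gauss a b \<noteq> 0" using z assms by auto
  with z show ?thesis using ab(3) by (intro that[OF g]) (auto simp: primitive_def)
qed

lemma primitive_gcnj [simp]: "primitive (gcnj z) \<longleftrightarrow> primitive z"
  by (simp add: primitive_def)

text \<open>Up to sign, \<open>gim (z * gcnj w)\<close> is the determinant of the two vectors, and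
  \<open>gre (z * gcnj w)\<close> is their scalar product; this dictionary is used throughout. The
  integer multiplier is read off from Bezout coefficients of the coordinates of
  \<open>w\<close>.\<close>

lemma parallel_primitive:
  assumes "primitive w" "gim (z * gcnj w) = 0"
  obtains l where "z = of_int l * w"
proof -
  obtain r s where rs: "r * gre w + s * gim w = 1"
    using assms(1) bezout_int[of "gre w" "gim w"] by (auto simp: primitive_def)
  have *: "gre z * gim w = gim z * gre w" using assms(2) by simp
  have "(r * gre z + s * gim z) * gre w = gre z * (r * gre w + s * gim w)"
    "(r * gre z + s * gim z) * gim w = gim z * (r * gre w + s * gim w)"
    using * by (simp_all add: algebra_simps)
  then have "z = of_int (r * gre z + s * gim z) * w" using rs by (simp add: gauss_eq_iff)
  then show ?thesis by (rule that)
qed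

text \<open>For nonzero \<open>P\<close> and \<open>c\<close> a rectangular hyperbola: the form
  \<open>gim (X\<^sup>2 * gcnj P)\<close> vanishes exactly on two perpendicular lines, spanned by
  the square roots of \<open>P\<close> and of \<open>- P\<close>, the asymptotes. For
  \<open>c = 0\<close> only these lines remain.\<close>

definition hyperbola :: "real \<Rightarrow> gauss \<Rightarrow> int \<Rightarrow> gauss set" where
  "hyperbola N P c = {X \<in> disc N. gim (X\<^sup>2 * gcnj P) = c}"

lemma finite_hyperbola [simp]: "finite (hyperbola N P c)"
  by (simp add: hyperbola_def)

text \<open>Each abscissa admits at most two ordinates, the roots of a quadratic. It is not the zero
  polynomial, since \<open>gim P = 0\<close> leaves the constant coefficient \<open>- c\<close>.
  This is the start of the induction on the exponent \<open>1 / n\<close>.\<close>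

lemma card_hyperbola_trivial:
  assumes "P \<noteq> 0" "c \<noteq> 0" "N \<ge> 1"
  shows "real (card (hyperbola N P c)) \<le> 6 * N"
proof -
  let ?X = "{n::int. \<bar>of_int n\<bar> \<le> N}" and ?H = "hyperbola N P c"
  have fin: "finite ?X" using card_int_abs_le(1)[of N] assms(3) by simp
  have "gre ` ?H \<subseteq> ?X"
    using abs_gre_le order.trans by (fastforce simp: hyperbola_def disc_def)
  then have "card ?H = (\<Sum>x\<in>?X. card {X \<in> ?H. gre X = x})"
    using sum.group[of ?H ?X gre "\<lambda>_. 1::nat"] fin by simp
  also have "\<dots> \<le> (\<Sum>x\<in>?X. 2)"
  proof (intro sum_mono)
    fix x
    define p where "p = [: - gim P * x\<^sup>2 - c, 2 * gre P * x, gim P :]"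
    have "p \<noteq> 0" using assms by (auto simp: p_def)
    have "inj_on gim {X \<in> ?H. gre X = x}" by (auto intro!: inj_onI simp: gauss_eq_iff)
    moreover have "gim ` {X \<in> ?H. gre X = x} \<subseteq> {y. poly p y = 0}"
      by (auto simp: hyperbola_def p_def power2_eq_square algebra_simps)
    ultimately have "card {X \<in> ?H. gre X = x} \<le> card {y. poly p y = 0}"
      using poly_roots_finite[OF \<open>p \<noteq> 0\<close>] by (rule card_inj_on_le)
    also have "\<dots> \<le> degree p" using \<open>p \<noteq> 0\<close> by (rule card_poly_roots_bound)
    also have "\<dots> \<le> 2" by (simp add: p_def)
    finally show "card {X \<in> ?H. gre X = x} \<le> 2" .
  qed
  finally have "real (card ?H) \<le> 2 * real (card ?X)" by simp
  also have "\<dots> \<le> 2 * (2 * N + 1)" using card_int_abs_le(2)[of N] assms(3) by simp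
  finally show ?thesis using assms(3) by simp
qed

lemma gnorm_gcnj [simp]: "gnorm (gcnj z) = gnorm z" and gnorm_of_int [simp]: "gnorm (of_int k) = k\<^sup>2"
  by (simp_all add: gnorm_def)

text \<open>Two points of the hyperbola satisfy \<open>(X - Y) (X + Y) = l P\<close> with an integer \<open>l\<close>; this factors
  through a divisor \<open>p\<close> of \<open>P\<close>.\<close>

lemma hyperbola_factorization:
  assumes P: "primitive P" "P \<noteq> 0" and c: "c \<noteq> 0"
    and X: "gim (X\<^sup>2 * gcnj P) = c" and Y: "gim (Y\<^sup>2 * gcnj P) = c" and ne: "X \<noteq> Y" "X \<noteq> - Y"
  obtains p q t s e where "P = p * q" "X - Y = p * (of_int t * e)" "X + Y = q * (of_int s * gcnj e)"
    "t > 0" "e \<noteq> 0" "4 * c = (t\<^sup>2 * gnorm p - s\<^sup>2 * gnorm q) * gim (p * gcnj q * e\<^sup>2)"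
proof -
  define A B where "A = X - Y" and "B = X + Y"
  have AB0: "A \<noteq> 0" "B \<noteq> 0" using ne by (auto simp: A_def B_def add_eq_0_iff2)
  have "A * B = X\<^sup>2 - Y\<^sup>2" by (simp add: A_def B_def power2_eq_square algebra_simps)
  then have "gim (A * B * gcnj P) = 0"
    using X Y by (simp only: left_diff_distrib) (simp only: gauss_sel(8))
  then obtain l where l: "A * B = of_int l * P" using parallel_primitive[OF P(1)] by blast
  have g0: "gcd A P \<noteq> 0" using AB0 by simp
  \<comment> \<open>The factor \<open>p\<close> is the gcd of \<open>X - Y\<close> and
    \<open>P\<close>; the cofactor \<open>q\<close> of \<open>P\<close> is coprime to the rest of
    \<open>X - Y\<close> and therefore divides \<open>X + Y\<close>.\<close>
  obtain A' q where Aq: "A = A' * gcd A P" "P = q * gcd A P" "coprime A' q"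
    using gcd_coprime_exists[OF g0] by blast
  define p where "p = gcd A P"
  have p0: "p \<noteq> 0" using g0 by (simp add: p_def)
  have A: "A = A' * p" and Pq: "P = q * p" using Aq by (simp_all add: p_def)
  have "A' * B * p = of_int l * q * p" using l by (simp add: A Pq mult_ac)
  then have A'B: "A' * B = of_int l * q" using p0 by simp
  then have "q dvd A' * B" by simp
  then have "q dvd B" using Aq(3) by (simp add: coprime_commute coprime_dvd_mult_right_iff)
  then obtain B' where B': "B = q * B'" by (elim dvdE)
  have q0: "q \<noteq> 0" using P(2) Pq by auto
  have "q * (A' * B') = q * of_int l" using A'B by (simp add: B' mult_ac)
  then have A'B': "A' * B' = of_int l" using q0 by simp
  have "A' \<noteq> 0" using A AB0 by auto
  \<comment> \<open>The quotients satisfy \<open>A' * B' = of_int l\<close>, a real product, so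
    \<open>B'\<close> is parallel to the conjugate of \<open>A'\<close>; writing \<open>A'\<close>
    as \<open>t\<close> times a primitive \<open>e\<close> makes \<open>B'\<close> an integer
    multiple of \<open>gcnj e\<close>.\<close>
  then obtain t e where te: "t > 0" "A' = of_int t * e" "primitive e" "e \<noteq> 0"
    by (rule primitive_decompose)
  have "of_int t * (B' * e) = of_int l" using A'B' te(2) by (simp add: mult_ac)
  then have "t * gim (B' * e) = 0" by (metis gauss_of_int(2) gauss_sel(12) gauss_of_int(1) add.right_neutral mult_zero_left)
  then have "gim (B' * gcnj (gcnj e)) = 0" using te(1) by simp
  then obtain s where s: "B' = of_int s * gcnj e"
    using parallel_primitive[of "gcnj e" B'] te(3) by auto
  have 1: "X - Y = p * (of_int t * e)" using A te(2) by (simp add: A_def mult_ac)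
  have 2: "X + Y = q * (of_int s * gcnj e)" using B' s by (simp add: B_def)
  \<comment> \<open>With \<open>u = X + Y\<close> and \<open>w = X - Y\<close>,
    \<open>4 * Y\<^sup>2 = (u - w)\<^sup>2\<close>. After multiplication by \<open>gcnj P\<close>
    the cross term becomes an integer, so only the two squares contribute to the imaginary
    part.\<close>
  define u w where "u = q * (of_int s * gcnj e)" and "w = p * (of_int t * e)"
  have uw: "u - w = 2 * Y" using 1 2 by (simp add: u_def w_def algebra_simps flip: 1 2)
  have "4 * (Y\<^sup>2 * gcnj P) = (u - w)\<^sup>2 * gcnj P"
    by (simp add: uw power_mult_distrib mult.assoc)
  moreover have "gim (4 * z) = 4 * gim z" for z by simp
  ultimately have "4 * gim (Y\<^sup>2 * gcnj P) = gim ((u - w)\<^sup>2 * gcnj P)" by metis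
  also have "(u - w)\<^sup>2 * gcnj P = u\<^sup>2 * gcnj P + w\<^sup>2 * gcnj P - 2 * (u * w * gcnj P)"
    by (simp add: power2_eq_square algebra_simps)
  also have "u * w * gcnj P = of_int (s * t * gnorm e * gnorm P)"
  proof -
    have "u * w * gcnj P = of_int s * of_int t * (e * gcnj e) * (P * gcnj P)"
      by (simp add: u_def w_def Pq mult_ac)
    then show ?thesis by (simp add: mult_gcnj)
  qed
  also have "u\<^sup>2 * gcnj P = of_int (s\<^sup>2 * gnorm q) * gcnj (p * gcnj q * e\<^sup>2)"
  proof -
    have "u\<^sup>2 * gcnj P = of_int (s\<^sup>2) * (q * gcnj q) * gcnj (p * gcnj q * e\<^sup>2)"
      by (simp add: u_def Pq power2_eq_square mult_ac)
    then show ?thesis by (simp add: mult_gcnj)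
  qed
  also have "w\<^sup>2 * gcnj P = of_int (t\<^sup>2 * gnorm p) * (p * gcnj q * e\<^sup>2)"
  proof -
    have "w\<^sup>2 * gcnj P = of_int (t\<^sup>2) * (p * gcnj p) * (p * gcnj q * e\<^sup>2)"
      by (simp add: w_def Pq power2_eq_square mult_ac)
    then show ?thesis by (simp add: mult_gcnj)
  qed
  also have "gim (of_int (s\<^sup>2 * gnorm q) * gcnj (p * gcnj q * e\<^sup>2) + of_int (t\<^sup>2 * gnorm p) * (p * gcnj q * e\<^sup>2)
     - 2 * of_int (s * t * gnorm e * gnorm P))
    = (t\<^sup>2 * gnorm p - s\<^sup>2 * gnorm q) * gim (p * gcnj q * e\<^sup>2)"
  proof -
    have "gim (of_int k * gcnj z + of_int m * z - 2 * of_int n) = (m - k) * gim z" for k m n z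
      by (simp add: algebra_simps)
    then show ?thesis .
  qed
  finally have "4 * c = (t\<^sup>2 * gnorm p - s\<^sup>2 * gnorm q) * gim (p * gcnj q * e\<^sup>2)" using Y by simp
  with that[of p q t e s] 1 2 te Pq show ?thesis by (simp add: mult.commute)
qed

text \<open>A point \<open>Y\<close> is fixed; the \<open>2\<close> counts \<open>Y\<close> and
  \<open>- Y\<close>. Every other \<open>X\<close> determines a divisor \<open>p\<close> of
  \<open>P\<close> and a divisor \<open>d = gim (p * gcnj q * e\<^sup>2)\<close> of
  \<open>4 * c\<close>. Within such a class, if \<open>t \<le> T\<close>, then \<open>t\<close>
  fixes \<open>s\<^sup>2\<close>, and \<open>t\<close> with the sign of \<open>s\<close> fixes
  \<open>X\<close>: at most \<open>2 * T\<close> points. If \<open>t > T\<close>, then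
  \<open>gmod e \<le> 2 * N / T\<close>, the vector \<open>e\<close> lies on the hyperbola of
  \<open>q * gcnj p\<close> with constant \<open>d\<close>, and \<open>e\<close> alone fixes
  \<open>X\<close>: at most \<open>K\<close> points.\<close>

lemma hyperbola_step:
  fixes N M E T K D :: real
  assumes P: "primitive P" "P \<noteq> 0" and c: "c \<noteq> 0" and T: "T \<ge> 1" and E: "E = 2 * N / T"
    and D: "real (card {d::int. d dvd 4 * c}) \<le> D"
    and K: "\<And>Q d. gmod Q = gmod P \<Longrightarrow> d \<noteq> 0 \<Longrightarrow> real (card (hyperbola E Q d)) \<le> K"
  shows "real (card (hyperbola N P c)) \<le> 2 + real (card (divisors P)) * D * (2 * T + K)"
proof (cases "hyperbola N P c = {}")
  case True
  have "gmod P = gmod P" "(1::int) \<noteq> 0" by simp_all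
  from K[OF this] have "K \<ge> 0" by (meson of_nat_0_le_iff order.trans)
  moreover have "D \<ge> 0" using D by (meson of_nat_0_le_iff order.trans)
  ultimately show ?thesis using True T by simp
next
  case False
  then obtain Y where Y: "Y \<in> hyperbola N P c" by auto
  then have Yc: "gim (Y\<^sup>2 * gcnj P) = c" and YN: "gmod Y \<le> N" by (auto simp: hyperbola_def disc_def)
  let ?H = "hyperbola N P c"
  define S where "S = ?H - {Y, - Y}"
  define R where "R X p q t s e \<longleftrightarrow> P = p * q \<and> X - Y = p * (of_int t * e) \<and>
    X + Y = q * (of_int s * gcnj e) \<and> t > 0 \<and> e \<noteq> 0 \<and>
    4 * c = (t\<^sup>2 * gnorm p - s\<^sup>2 * gnorm q) * gim (p * gcnj q * e\<^sup>2)" for X p q t s e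
  have "\<exists>p q t s e. R X p q t s e" if "X \<in> S" for X
  proof -
    have "gim (X\<^sup>2 * gcnj P) = c" "X \<noteq> Y" "X \<noteq> - Y" using that by (auto simp: S_def hyperbola_def)
    then show ?thesis using hyperbola_factorization[OF P c _ Yc, of X] unfolding R_def by metis
  qed
  then obtain p q t s e where R: "\<And>X. X \<in> S \<Longrightarrow> R X (p X) (q X) (t X) (s X) (e X)" by metis
  define d where "d X = gim (p X * gcnj (q X) * (e X)\<^sup>2)" for X
  define Dv where "Dv = {d::int. d dvd 4 * c}"
  have fDv: "finite Dv" using c unfolding Dv_def by (intro finite_divisors_int) auto
  define I where "I = (Inl ` ({0<..\<lfloor>T\<rfloor>} \<times> UNIV) :: (int \<times> bool + gauss) set)"
  define J where "J x = I \<union> Inr ` hyperbola E (P div fst x * gcnj (fst x)) (snd x)" for x :: "gauss \<times> int"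
  define F where "F X = ((p X, d X), if of_int (t X) \<le> T then Inl (t X, s X > 0) else Inr (e X))" for X
  have d0: "d X \<noteq> 0" if "X \<in> S" for X using R[OF that] c by (auto simp: R_def d_def)
  have p0: "p X \<noteq> 0" "q X \<noteq> 0" if "X \<in> S" for X using R[OF that] P by (auto simp: R_def)
  have eE: "gmod (e X) \<le> E" if X: "X \<in> S" "\<not> of_int (t X) \<le> T" for X
  proof -
    have "gmod (X - Y) \<le> 2 * N"
      using gmod_diff_le[of X Y] YN X by (auto simp: S_def hyperbola_def disc_def)
    moreover have "gmod (X - Y) = gmod (p X) * (of_int (t X) * gmod (e X))"
      using R[OF X(1)] by (simp add: R_def gmod_mult)
    moreover have "1 * (T * gmod (e X)) \<le> gmod (p X) * (of_int (t X) * gmod (e X))"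
      using X T gmod_ge_1[OF p0(1)[OF X(1)]] by (intro mult_mono) auto
    ultimately have "T * gmod (e X) \<le> 2 * N" by simp
    then show ?thesis using T by (simp add: E field_simps)
  qed
  have maps: "F ` S \<subseteq> (SIGMA x : divisors P \<times> (Dv - {0}). J x)"
  proof
    fix y assume "y \<in> F ` S"
    then obtain X where X: "X \<in> S" "y = F X" by auto
    have RX: "R X (p X) (q X) (t X) (s X) (e X)" by (rule R[OF X(1)])
    have "p X \<in> divisors P" "d X \<in> Dv" using RX by (auto simp: R_def d_def Dv_def divisors_def)
    moreover have "P div p X = q X" using RX p0[OF X(1)] by (simp add: R_def)
    then have "e X \<in> hyperbola E (P div p X * gcnj (p X)) (d X)" if "\<not> of_int (t X) \<le> T"
      using eE[OF X(1) that] by (simp add: hyperbola_def disc_def d_def mult_ac del: gauss_sel)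
    moreover have "of_int (t X) \<le> T \<Longrightarrow> Inl (t X, s X > 0) \<in> I"
      using RX by (auto simp: I_def R_def le_floor_iff)
    ultimately show "y \<in> (SIGMA x : divisors P \<times> (Dv - {0}). J x)"
      using d0[OF X(1)] by (auto simp: X(2) F_def J_def)
  qed
  have inj: "inj_on F S"
  proof (rule inj_onI)
    fix X Z assume XZ: "X \<in> S" "Z \<in> S" "F X = F Z"
    have RX: "R X (p X) (q X) (t X) (s X) (e X)" and RZ: "R Z (p Z) (q Z) (t Z) (s Z) (e Z)"
      using R XZ by auto
    have pp: "p X = p Z" and dd: "d X = d Z" using XZ(3) by (auto simp: F_def)
    then have qq: "q X = q Z" using RX RZ p0[OF XZ(1)] by (auto simp: R_def)
    have 1: "q X * (of_int (s X) * gcnj (e X)) - p X * (of_int (t X) * e X) = 2 * Y"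
    proof -
      have "q X * (of_int (s X) * gcnj (e X)) - p X * (of_int (t X) * e X) = (X + Y) - (X - Y)"
        using RX unfolding R_def by metis
      then show ?thesis by simp
    qed
    have 2: "q X * (of_int (s Z) * gcnj (e Z)) - p X * (of_int (t Z) * e Z) = 2 * Y"
    proof -
      have "q X * (of_int (s Z) * gcnj (e Z)) - p X * (of_int (t Z) * e Z) = (Z + Y) - (Z - Y)"
        using RZ unfolding R_def pp qq by metis
      then show ?thesis by simp
    qed
    have "t X = t Z \<and> e X = e Z"
    proof (cases "of_int (t X) \<le> T")
      case True
      then have tt: "t X = t Z" and ss: "(s X > 0) = (s Z > 0)" using XZ(3) by (auto simp: F_def split: if_splits)
      have "(t X)\<^sup>2 * gnorm (p X) - (s X)\<^sup>2 * gnorm (q X) = (t X)\<^sup>2 * gnorm (p X) - (s Z)\<^sup>2 * gnorm (q X)"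
        using RX RZ d0[OF XZ(1)] pp qq tt dd unfolding R_def d_def by (metis mult_right_cancel)
      then have "(s X)\<^sup>2 = (s Z)\<^sup>2" using p0[OF XZ(1)] by simp
      then have ss': "s X = s Z" using ss by (auto simp: power2_eq_iff)
      \<comment> \<open>For given \<open>s\<close> and \<open>t\<close>, the vector \<open>e\<close>
        solves a real-linear equation with right side \<open>2 * Y\<close>. Comparing norms shows
        that its kernel is trivial, because \<open>t\<^sup>2 * gnorm p - s\<^sup>2 * gnorm q\<close>
        is a factor of \<open>4 * c\<close> and hence nonzero.\<close>
      define \<delta> where "\<delta> = e X - e Z"
      have "q X * (of_int (s X) * gcnj \<delta>) = p X * (of_int (t X) * \<delta>)"
        using 1 2 tt ss' by (simp add: \<delta>_def algebra_simps)
      then have "gnorm (q X * (of_int (s X) * gcnj \<delta>)) = gnorm (p X * (of_int (t X) * \<delta>))" by simp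
      moreover have "gnorm \<delta> * ((t X)\<^sup>2 * gnorm (p X) - (s X)\<^sup>2 * gnorm (q X))
        = gnorm (p X * (of_int (t X) * \<delta>)) - gnorm (q X * (of_int (s X) * gcnj \<delta>))"
        by (simp add: gnorm_mult algebra_simps)
      ultimately have "gnorm \<delta> * ((t X)\<^sup>2 * gnorm (p X) - (s X)\<^sup>2 * gnorm (q X)) = 0"
        by simp
      moreover have "(t X)\<^sup>2 * gnorm (p X) - (s X)\<^sup>2 * gnorm (q X) \<noteq> 0" using RX c by (auto simp: R_def)
      ultimately have "\<delta> = 0" by simp
      then show ?thesis using tt by (simp add: \<delta>_def)
    next
      case False
      then have ee: "e X = e Z" using XZ(3) by (auto simp: F_def split: if_splits)
      have "q X * of_int (s X - s Z) * gcnj (e X) = p X * of_int (t X - t Z) * e X"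
        using 1 2 ee by (simp add: algebra_simps)
      \<comment> \<open>Multiplication by the conjugate of \<open>q * gcnj e\<close> makes the left
        side an integer; the imaginary part of the right side is \<open>(t X - t Z) * d X\<close>
        with \<open>d X\<close> nonzero, so the values of \<open>t\<close> agree.\<close>
      then have "q X * of_int (s X - s Z) * gcnj (e X) * gcnj (q X * gcnj (e X))
        = p X * of_int (t X - t Z) * e X * gcnj (q X * gcnj (e X))" by simp
      also have "\<dots> = of_int (t X - t Z) * (p X * gcnj (q X) * (e X)\<^sup>2)"
        by (simp add: power2_eq_square mult_ac)
      also have "q X * of_int (s X - s Z) * gcnj (e X) * gcnj (q X * gcnj (e X))
        = of_int (s X - s Z) * (q X * gcnj (q X)) * (e X * gcnj (e X))"
        by (simp add: mult_ac)
      also have "\<dots> = of_int ((s X - s Z) * gnorm (q X) * gnorm (e X))" by (simp add: mult_gcnj)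
      finally have "gim (of_int (t X - t Z) * (p X * gcnj (q X) * (e X)\<^sup>2)) = 0"
        by (metis gauss_of_int(2))
      moreover have "gim (of_int k * z) = k * gim z" for k z by simp
      ultimately have "(t X - t Z) * d X = 0" unfolding d_def by metis
      then show ?thesis using ee d0[OF XZ(1)] by simp
    qed
    then have "X - Y = Z - Y" using RX RZ pp by (simp add: R_def)
    then show "X = Z" by simp
  qed
  have cardI: "finite I" "real (card I) \<le> 2 * T"
    using T by (auto simp: I_def card_image card_cartesian_product of_nat_nat)
  have cardJ: "real (card (J x)) \<le> 2 * T + K" "finite (J x)" if "x \<in> divisors P \<times> (Dv - {0})" for x
  proof -
    let ?hyp = "hyperbola E (P div fst x * gcnj (fst x)) (snd x)"
    have "fst x dvd P" "snd x \<noteq> 0" using that by (auto simp: divisors_def)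
    then have "gmod (P div fst x * gcnj (fst x)) = gmod P"
      by (metis dvd_div_mult_self gmod_gcnj gmod_mult)
    then have k: "real (card ?hyp) \<le> K" using K \<open>snd x \<noteq> 0\<close> by blast
    have "card (J x) \<le> card I + card (Inr ` ?hyp :: (int \<times> bool + gauss) set)"
      unfolding J_def by (rule card_Un_le)
    also have "\<dots> \<le> card I + card ?hyp" by (simp add: card_image)
    finally show "real (card (J x)) \<le> 2 * T + K" using cardI(2) k by linarith
    show "finite (J x)" using cardI by (simp add: J_def)
  qed
  have fin: "finite (divisors P \<times> (Dv - {0}))" using P(2) fDv by simp
  have "card S \<le> card (SIGMA x : divisors P \<times> (Dv - {0}). J x)"
    using inj maps by (rule card_inj_on_le) (use fin cardJ in auto)
  also have "\<dots> = (\<Sum>x\<in>divisors P \<times> (Dv - {0}). card (J x))"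
    using fin cardJ by (intro card_SigmaI) auto
  finally have "real (card S) \<le> (\<Sum>x\<in>divisors P \<times> (Dv - {0}). real (card (J x)))"
    by (metis of_nat_le_iff of_nat_sum)
  also have "\<dots> \<le> (\<Sum>x\<in>divisors P \<times> (Dv - {0}). 2 * T + K)" by (intro sum_mono cardJ)
  also have "\<dots> = real (card (divisors P)) * real (card (Dv - {0})) * (2 * T + K)"
    by (simp add: card_cartesian_product)
  also have "\<dots> \<le> real (card (divisors P)) * D * (2 * T + K)"
  proof -
    have "card (Dv - {0}) \<le> card Dv" using fDv by (intro card_mono) auto
    then have "real (card (Dv - {0})) \<le> D" using D by (simp add: Dv_def)
    moreover have "0 \<le> K"
      by (rule order.trans[OF of_nat_0_le_iff K[of P 1]]) auto
    ultimately show ?thesis using T by (intro mult_right_mono mult_left_mono) auto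
  qed
  finally have "real (card S) \<le> real (card (divisors P)) * D * (2 * T + K)" .
  moreover have "card ?H \<le> card S + card {Y, - Y}"
    unfolding S_def by (metis card_Un_le card_mono Un_Diff_cancel2 Un_upper1 finite.emptyI finite_insert finite_Un finite_Diff finite_hyperbola order.trans)
  moreover have "card {Y, - Y} \<le> 2" by (simp add: card_insert_if)
  ultimately show ?thesis by linarith
qed

text \<open>Distinct integer divisors stay distinct Gaussian divisors, so the one divisor bound also
  serves the integer \<open>4 * c\<close>.\<close>

lemma card_int_divisors_le:
  assumes "n \<noteq> 0"
  shows "card {d::int. d dvd n} \<le> card (divisors (of_int n))"
proof (rule card_inj_on_le[where f = of_int])
  show "inj_on (of_int :: int \<Rightarrow> gauss) {d. d dvd n}" by (auto intro!: inj_onI)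
  show "of_int ` {d. d dvd n} \<subseteq> divisors (of_int n)"
    by (auto simp: divisors_def elim!: dvdE)
qed (use assms in auto)

text \<open>The exponent \<open>1 / n\<close> improves to \<open>1 / (n + 1)\<close>: the points fall into few classes, and in
  each of them either the integer \<open>t\<close> of the factorization is at most \<open>T = N powr (1 / (n + 1))\<close>,
  or the vector \<open>e\<close> lies on a hyperbola of the same kind in a disc of radius \<open>2 N / T\<close>.\<close>

lemma card_hyperbola_root:
  assumes "n \<ge> 1" "\<eta> > 0"
  shows "\<exists>C>0. \<forall>N M P c. 1 \<le> N \<longrightarrow> N \<le> M \<longrightarrow> P \<noteq> 0 \<longrightarrow> gmod P \<le> M \<longrightarrow> c \<noteq> 0 \<longrightarrow>
    real (card (hyperbola N P c)) \<le> C * M powr \<eta> * N powr (1 / real n)"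
  using assms
proof (induction n arbitrary: \<eta> rule: dec_induct)
  case base
  show ?case
  proof (intro exI[of _ 6] conjI allI impI)
    fix N M P c assume *: "1 \<le> N" "N \<le> M" "P \<noteq> 0" "gmod P \<le> M" "c \<noteq> (0::int)"
    have "real (card (hyperbola N P c)) \<le> 6 * N" using * by (intro card_hyperbola_trivial)
    also have "\<dots> \<le> (6 * M powr \<eta>) * N" using * base by (intro mult_right_mono) (auto intro: ge_one_powr_ge_zero)
    finally show "real (card (hyperbola N P c)) \<le> 6 * M powr \<eta> * N powr (1 / real 1)" using * by simp
  qed simp
next
  case (step n)
  \<comment> \<open>The exponent budget: divisors of \<open>P\<close> cost
    \<open>M powr (\<eta> / 8)\<close>, divisors of \<open>4 * c\<close> cost
    \<open>M powr (3 * \<eta> / 8)\<close> as \<open>c\<close> is at most \<open>M ^ 3\<close>, and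
    the induction hypothesis is used with \<open>\<eta> / 2\<close>.\<close>
  obtain C1 where C1: "C1 > 0" "\<And>z. z \<noteq> 0 \<Longrightarrow> real (card (divisors z)) \<le> C1 * gmod z powr (\<eta> / 8)"
    using divisor_bound[of "\<eta> / 8"] step.prems by auto
  obtain C2 where C2: "C2 > 0" "\<And>N M P c. 1 \<le> N \<Longrightarrow> N \<le> M \<Longrightarrow> P \<noteq> 0 \<Longrightarrow> gmod P \<le> M \<Longrightarrow> c \<noteq> 0 \<Longrightarrow>
    real (card (hyperbola N P c)) \<le> C2 * M powr (\<eta> / 2) * N powr (1 / real n)"
    using step.IH[of "\<eta> / 2"] step.prems by auto
  have n: "n \<ge> 1" using step.hyps by simp
  define C3 where "C3 = 2 + 2 * C2 * 2 powr (\<eta> / 2)"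
  define C where "C = 2 + C1 * (C1 * 4 powr (\<eta> / 8)) * C3"
  have C3: "C3 > 0" using C2(1) by (simp add: C3_def add_pos_pos)
  have bound: "real (card (hyperbola N P c)) \<le> C * M powr \<eta> * N powr (1 / real (Suc n))"
    if *: "1 \<le> N" "N \<le> M" "P \<noteq> 0" "gmod P \<le> M" "c \<noteq> 0" "primitive P" for N M P c
  proof (cases "hyperbola N P c = {}")
    case True
    have "C \<ge> 0" using C1(1) C3 by (simp add: C_def)
    with True show ?thesis by simp
  next
    case False
    then obtain X where X: "gmod X \<le> N" "gim (X\<^sup>2 * gcnj P) = c" by (auto simp: hyperbola_def disc_def)
    have "\<bar>of_int c\<bar> \<le> gmod (X\<^sup>2 * gcnj P)" unfolding X(2)[symmetric] by (rule abs_gim_le)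
    also have "\<dots> = gmod X ^ 2 * gmod P" by (simp add: gmod_mult gmod_power)
    also have "\<dots> \<le> M ^ 2 * M" using X * by (intro mult_mono power_mono) auto
    finally have cM: "\<bar>of_int c\<bar> \<le> M ^ 3" by (simp add: power2_eq_square power3_eq_cube)
    \<comment> \<open>\<open>T\<close> balances the two kinds of points: up to a factor
      \<open>2\<close>, \<open>E powr (1 / n)\<close> is again \<open>T\<close>.\<close>
    define T where "T = N powr (1 / real (Suc n))"
    define E where "E = 2 * N / T"
    have T: "1 \<le> T" "T \<le> N"
      using * powr_mono[of "1 / real (Suc n)" 1 N] by (auto simp: T_def ge_one_powr_ge_zero)
    have E: "1 \<le> E" "E \<le> 2 * M"
      using T * by (auto simp: E_def field_simps intro: mult_mono order.trans)
    have "real (card {d. d dvd 4 * c}) \<le> real (card (divisors (of_int (4 * c))))"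
      using card_int_divisors_le[of "4 * c"] * by simp
    also have "\<dots> \<le> C1 * gmod (of_int (4 * c)) powr (\<eta> / 8)"
      using * by (intro C1) (simp del: of_int_mult)
    also have "\<dots> \<le> C1 * (4 * M ^ 3) powr (\<eta> / 8)"
      using C1(1) step.prems cM by (intro mult_left_mono powr_mono2) (auto simp: gmod_mult)
    also have "\<dots> = C1 * 4 powr (\<eta> / 8) * M powr (3 * \<eta> / 8)"
      using * by (simp add: powr_mult powr_powr flip: powr_numeral)
    finally have D: "real (card {d. d dvd 4 * c}) \<le> C1 * 4 powr (\<eta> / 8) * M powr (3 * \<eta> / 8)" .
    have EN: "E powr (1 / real n) \<le> 2 * T"
    proof -
      have "E = 2 * N powr (real n / real (Suc n))"
        using * n by (simp add: E_def T_def powr_diff[symmetric] field_simps)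
          (simp add: powr_add[symmetric] field_simps)
      then have "E powr (1 / real n) = 2 powr (1 / real n) * T"
        using * n by (simp add: powr_mult powr_powr T_def)
      also have "2 powr (1 / real n) \<le> 2 powr (1 :: real)" using n by (intro powr_mono) auto
      finally show ?thesis using T by (simp add: mult_right_mono)
    qed
    define K where "K = C2 * (2 * M) powr (\<eta> / 2) * (2 * T)"
    have K: "real (card (hyperbola E Q d)) \<le> K" if "gmod Q = gmod P" "d \<noteq> 0" for Q d
    proof -
      have "Q \<noteq> 0" using that * by (metis gmod_eq_0_iff)
      then have "real (card (hyperbola E Q d)) \<le> C2 * (2 * M) powr (\<eta> / 2) * E powr (1 / real n)"
        using E that * by (intro C2(2)) auto
      also have "\<dots> \<le> K" unfolding K_def using C2(1) EN by (intro mult_left_mono) auto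
      finally show ?thesis .
    qed
    have "real (card (hyperbola N P c)) \<le> 2 + real (card (divisors P)) * (C1 * 4 powr (\<eta> / 8) * M powr (3 * \<eta> / 8)) * (2 * T + K)"
      by (rule hyperbola_step[OF *(6,3,5) T(1) E_def D K])
    also have "\<dots> \<le> 2 + (C1 * M powr (\<eta> / 8)) * (C1 * 4 powr (\<eta> / 8) * M powr (3 * \<eta> / 8)) * (C3 * M powr (\<eta> / 2) * T)"
    proof (intro add_left_mono mult_mono mult_nonneg_nonneg)
      show "real (card (divisors P)) \<le> C1 * M powr (\<eta> / 8)"
        using C1(2)[OF *(3)] powr_mono2[of "\<eta> / 8" "gmod P" M] *(4) C1(1) step.prems
        by (meson gmod_nonneg less_eq_real_def mult_left_mono order.trans divide_nonneg_nonneg zero_le_numeral)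
      have "1 \<le> M powr (\<eta> / 2)" using * step.prems by (intro ge_one_powr_ge_zero) auto
      then have "2 * T \<le> 2 * (M powr (\<eta> / 2) * T)" using T by simp
      moreover have "K = 2 * C2 * 2 powr (\<eta> / 2) * (M powr (\<eta> / 2) * T)"
        using * by (simp add: K_def powr_mult)
      ultimately show "2 * T + K \<le> C3 * M powr (\<eta> / 2) * T" by (simp add: C3_def algebra_simps)
      show "0 \<le> 2 * T + K" using T C2(1) by (simp add: K_def)
    qed (use C1 in auto)
    also have "\<dots> = 2 + C1 * (C1 * 4 powr (\<eta> / 8)) * C3 * (M powr (\<eta> / 8) * M powr (3 * \<eta> / 8) * M powr (\<eta> / 2)) * T"
      by (simp add: mult_ac)
    also have "M powr (\<eta> / 8) * M powr (3 * \<eta> / 8) * M powr (\<eta> / 2) = M powr \<eta>"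
      by (simp add: field_simps flip: powr_add)
    also have "2 \<le> 2 * (M powr \<eta> * T)"
      using T ge_one_powr_ge_zero[of M \<eta>] * step.prems mult_mono[of 1 "M powr \<eta>" 1 T] by simp
    finally show ?thesis by (simp add: C_def T_def algebra_simps)
  qed
  have Cpos: "C > 0" using C1(1) C3 by (simp add: C_def add_pos_pos)
  show ?case
  proof (intro exI[of _ C] conjI allI impI Cpos)
    fix N M P c assume *: "1 \<le> N" "N \<le> M" "P \<noteq> 0" "gmod P \<le> M" "c \<noteq> (0::int)"
    \<comment> \<open>Reduction to primitive \<open>P\<close>: dividing out the content
      \<open>g\<close> either divides \<open>c\<close> by \<open>g\<close> as well or shows that
      there are no points.\<close>
    obtain g w where gw: "g > 0" "P = of_int g * w" "primitive w" "w \<noteq> 0"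
      using primitive_decompose[OF *(3)] .
    have scale: "gim (X\<^sup>2 * gcnj P) = g * gim (X\<^sup>2 * gcnj w)" for X
      by (simp add: gw(2) algebra_simps)
    show "real (card (hyperbola N P c)) \<le> C * M powr \<eta> * N powr (1 / real (Suc n))"
    proof (cases "g dvd c")
      case True
      then obtain c' where c': "c = g * c'" by auto
      have "hyperbola N P c = hyperbola N w c'"
        using gw(1) unfolding hyperbola_def scale c' by auto
      moreover have "gmod w \<le> M"
        using gmod_dvd_le[of w P] gw * by auto
      ultimately show ?thesis using bound[of N M w c'] * gw c' by auto
    next
      case False
      then have "hyperbola N P c = {}" unfolding hyperbola_def scale by auto
      then show ?thesis using Cpos by simp
    qed
  qed
qed

text \<open>The exponent \<open>1 / n\<close> can be pushed below \<open>\<eta> / 2\<close>, and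
  \<open>M = N\<close> is taken.\<close>

theorem hyperbola_bound:
  assumes "\<eta> > 0"
  shows "\<exists>C>0. \<forall>N P c. 1 \<le> N \<longrightarrow> P \<noteq> 0 \<longrightarrow> gmod P \<le> N \<longrightarrow> c \<noteq> 0 \<longrightarrow>
    real (card (hyperbola N P c)) \<le> C * N powr \<eta>"
proof -
  obtain n where n: "n \<ge> 1" "1 / real n \<le> \<eta> / 2"
  proof -
    obtain n where "real n > 2 / \<eta>" using reals_Archimedean2 by blast
    moreover from this have "n \<ge> 1" using assms by (cases n) (auto simp: not_less field_simps)
    ultimately show ?thesis using assms by (intro that[of n]) (auto simp: field_simps)
  qed
  obtain C where C: "C > 0" "\<And>N M P c. 1 \<le> N \<Longrightarrow> N \<le> M \<Longrightarrow> P \<noteq> 0 \<Longrightarrow> gmod P \<le> M \<Longrightarrow> c \<noteq> 0 \<Longrightarrow>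
    real (card (hyperbola N P c)) \<le> C * M powr (\<eta> / 2) * N powr (1 / real n)"
    using card_hyperbola_root[OF n(1), of "\<eta> / 2"] assms by auto
  have "real (card (hyperbola N P c)) \<le> C * N powr \<eta>"
    if *: "1 \<le> N" "P \<noteq> 0" "gmod P \<le> N" "c \<noteq> 0" for N P c
  proof -
    have "real (card (hyperbola N P c)) \<le> C * N powr (\<eta> / 2) * N powr (1 / real n)"
      using * by (intro C(2)) auto
    also have "\<dots> \<le> C * N powr (\<eta> / 2) * N powr (\<eta> / 2)"
      using C(1) n * by (intro mult_left_mono powr_mono) auto
    also have "\<dots> = C * N powr \<eta>" by (simp add: mult.assoc flip: powr_add)
    finally show ?thesis .
  qed
  with C(1) show ?thesis by blast
qed

section \<open>Nondegenerate concyclic quadruples\<close>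

lemma card_UN_bound:
  assumes "finite I" "\<And>i. i \<in> I \<Longrightarrow> real (card (A i)) \<le> b i"
  shows "real (card (\<Union>i\<in>I. A i)) \<le> (\<Sum>i\<in>I. b i)"
proof -
  have "card (\<Union>i\<in>I. A i) \<le> (\<Sum>i\<in>I. card (A i))" by (rule card_UN_le[OF assms(1)])
  then have "real (card (\<Union>i\<in>I. A i)) \<le> (\<Sum>i\<in>I. real (card (A i)))"
    by (metis of_nat_le_iff of_nat_sum)
  also have "\<dots> \<le> (\<Sum>i\<in>I. b i)" by (intro sum_mono assms)
  finally show ?thesis .
qed

text \<open>For distinct nonzero \<open>z\<^sub>1, z\<^sub>2, z\<^sub>3\<close> this says that \<open>0, z\<^sub>1, z\<^sub>2, z\<^sub>3\<close> lie on a circle or a line: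
  their cross ratio is real.\<close>

definition cocircular :: "gauss \<Rightarrow> gauss \<Rightarrow> gauss \<Rightarrow> bool" where
  "cocircular z1 z2 z3 \<longleftrightarrow> z1 \<noteq> 0 \<and> z2 \<noteq> 0 \<and> z3 \<noteq> 0 \<and> z1 \<noteq> z2 \<and> z1 \<noteq> z3 \<and> z2 \<noteq> z3 \<and>
     gim (z1 * (z3 - z2) * gcnj (z2 * (z1 - z3))) = 0"

text \<open>This excludes exactly the collinear quadruples and the isosceles trapezoids.\<close>

definition nondegenerate :: "gauss \<Rightarrow> gauss \<Rightarrow> gauss \<Rightarrow> bool" where
  "nondegenerate z1 z2 z3 \<longleftrightarrow> gim ((z1 + z2 - z3)\<^sup>2 * gcnj (z1 * (z3 - z2))) \<noteq> 0"

text \<open>The cross ratio being real, the first two products are integer multiples of one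
  primitive vector; \<open>P\<close> is that vector times the gcd of the multipliers, which makes
  \<open>l1\<close> and \<open>l2\<close> coprime. The third product follows because the three sum
  to zero.\<close>

lemma cocircular_ratio:
  assumes "cocircular z1 z2 z3"
  obtains P l1 l2 l3 where "P \<noteq> 0" "l1 \<noteq> 0" "l2 \<noteq> 0" "l3 \<noteq> 0" "coprime l1 l2" "l1 + l2 + l3 = 0"
    "z1 * (z3 - z2) = of_int l1 * P" "z2 * (z1 - z3) = of_int l2 * P" "z3 * (z2 - z1) = of_int l3 * P"
proof -
  have nz: "z1 * (z3 - z2) \<noteq> 0" "z2 * (z1 - z3) \<noteq> 0" "z3 * (z2 - z1) \<noteq> 0"
    using assms by (auto simp: cocircular_def)
  obtain g w where gw: "g > 0" "z1 * (z3 - z2) = of_int g * w" "primitive w" "w \<noteq> 0"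
    using primitive_decompose[OF nz(1)] .
  have "gim (z1 * (z3 - z2) * gcnj (z2 * (z1 - z3))) = 0" using assms by (simp add: cocircular_def)
  then have "gim (of_int g * (w * gcnj (z2 * (z1 - z3)))) = 0" by (simp only: gw(2) mult.assoc)
  then have "g * gim (w * gcnj (z2 * (z1 - z3))) = 0" by simp
  then have "gim (w * gcnj (z2 * (z1 - z3))) = 0" using gw(1) by simp
  then have "gim (gcnj (w * gcnj (z2 * (z1 - z3)))) = 0" by (simp only: gcnj_sel)
  then have "gim (z2 * (z1 - z3) * gcnj w) = 0" by (simp only: gcnj_simps mult.commute)
  then obtain k where k: "z2 * (z1 - z3) = of_int k * w" using parallel_primitive[OF gw(3)] by blast
  have k0: "k \<noteq> 0" using k nz by auto
  define d where "d = gcd g k"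
  have d: "d \<noteq> 0" using k0 by (simp add: d_def)
  obtain l1 l2 where l: "g = l1 * d" "k = l2 * d" "coprime l1 l2"
    using gcd_coprime_exists[of g k] d unfolding d_def by auto
  define P where "P = of_int d * w"
  have 1: "z1 * (z3 - z2) = of_int l1 * P" and 2: "z2 * (z1 - z3) = of_int l2 * P"
    using gw(2) k l by (simp_all add: P_def mult_ac)
  have "z3 * (z2 - z1) = - (z1 * (z3 - z2)) - z2 * (z1 - z3)" by (simp add: algebra_simps)
  also have "\<dots> = of_int (- l1 - l2) * P" unfolding 1 2 by (simp add: algebra_simps)
  finally have 3: "z3 * (z2 - z1) = of_int (- l1 - l2) * P" .
  have "P \<noteq> 0" "l1 \<noteq> 0" "l2 \<noteq> 0" "- l1 - l2 \<noteq> 0" using nz 1 2 3 by auto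
  then show ?thesis using l(3) 1 2 3 by (intro that[of P l1 l2 "- l1 - l2"]) auto
qed

definition half :: "gauss \<Rightarrow> gauss" where "half w = Gauss (gre w div 2) (gim w div 2)"

lemma half_double [simp]: "half (2 * z) = z"
  by (simp add: half_def gauss_eq_iff)

section \<open>Quadruples whose common factor \<open>P\<close> is small\<close>

definition small_ratio_triples :: "real \<Rightarrow> real \<Rightarrow> real \<Rightarrow> (gauss \<times> gauss \<times> gauss) set" where
  "small_ratio_triples r N B = {(z1, z2, z3). gmod z1 \<le> r \<and> gmod z2 \<le> r \<and> gmod z3 \<le> N \<and> z1 \<noteq> 0 \<and>
     nondegenerate z1 z2 z3 \<and> (\<exists>P l m. P \<noteq> 0 \<and> gmod P \<le> B \<and> l \<noteq> 0 \<and>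
     z1 * (z3 - z2) = of_int l * P \<and> z2 * (z1 - z3) = of_int m * P)}"

text \<open>Once \<open>z\<^sub>1\<close> and \<open>f = z\<^sub>3 - z\<^sub>2\<close> are chosen, with product \<open>l P\<close>, the vector
  \<open>z\<^sub>2 + z\<^sub>3 - z\<^sub>1\<close> lies on a fixed hyperbola.\<close>

lemma small_ratio_triples_subset:
  assumes "1 \<le> r" "r \<le> N"
  shows "small_ratio_triples r N B \<subseteq>
    (\<Union>P\<in>disc B - {0}. \<Union>l\<in>{l. l \<noteq> 0 \<and> \<bar>of_int l\<bar> \<le> 2 * r * N / gmod P}. \<Union>z1\<in>divisors (of_int l * P).
      let f = (of_int l * P) div z1; c = gim ((z1 - f)\<^sup>2 * gcnj P)
      in if c = 0 then {} else (\<lambda>X. (z1, half (X + z1 - f), half (X + z1 - f) + f)) ` hyperbola (3 * N) P c)"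
proof
  fix x assume "x \<in> small_ratio_triples r N B"
  then obtain z1 z2 z3 P l m where x: "x = (z1, z2, z3)" and b: "gmod z1 \<le> r" "gmod z2 \<le> r" "gmod z3 \<le> N" "z1 \<noteq> 0"
    and nd: "nondegenerate z1 z2 z3" and P: "P \<noteq> 0" "gmod P \<le> B" "l \<noteq> 0"
    and l: "z1 * (z3 - z2) = of_int l * P" and m: "z2 * (z1 - z3) = of_int m * P"
    unfolding small_ratio_triples_def by blast
  define f where "f = z3 - z2"
  have f: "(of_int l * P) div z1 = f" using l b by (simp add: f_def flip: l)
  define c where "c = gim ((z1 - f)\<^sup>2 * gcnj P)"
  define X where "X = z2 + z3 - z1"
  have "\<bar>of_int l\<bar> * gmod P = gmod z1 * gmod (z3 - z2)"
    using arg_cong[OF l, of gmod] by (simp add: gmod_mult)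
  also have "\<dots> \<le> r * (N + N)"
    using b assms gmod_diff_le[of z3 z2] by (intro mult_mono) auto
  finally have lP: "\<bar>of_int l\<bar> \<le> 2 * r * N / gmod P" using P by (simp add: field_simps)
  \<comment> \<open>The quantity in \<open>nondegenerate\<close> equals \<open>l * c\<close>:
    nondegeneracy is exactly what keeps the hyperbola from collapsing to a pair of lines.\<close>
  have c0: "c \<noteq> 0"
  proof
    assume "c = 0"
    have "(z1 + z2 - z3)\<^sup>2 * gcnj (z1 * (z3 - z2)) = of_int l * ((z1 - f)\<^sup>2 * gcnj P)"
      unfolding l by (simp add: f_def mult_ac algebra_simps)
    then have "gim ((z1 + z2 - z3)\<^sup>2 * gcnj (z1 * (z3 - z2))) = l * c"
      unfolding c_def by (simp del: gcnj_simps)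
    then show False using \<open>c = 0\<close> nd by (simp add: nondegenerate_def)
  qed
  have "X\<^sup>2 = (z1 - f)\<^sup>2 - 4 * (z2 * (z1 - z3))"
    by (simp add: X_def f_def power2_eq_square algebra_simps)
  \<comment> \<open>The squares of \<open>X\<close> and \<open>z1 - f\<close> differ by an integer
    multiple of \<open>P\<close>; multiplied by \<open>gcnj P\<close> it becomes an integer and
    leaves the imaginary part unchanged.\<close>
  then have X2: "X\<^sup>2 = (z1 - f)\<^sup>2 - 4 * (of_int m * P)" unfolding m .
  have "X\<^sup>2 * gcnj P = (z1 - f)\<^sup>2 * gcnj P - of_int (4 * m) * (P * gcnj P)"
    unfolding X2 by (simp add: algebra_simps)
  also have "\<dots> = (z1 - f)\<^sup>2 * gcnj P - of_int (4 * m * gnorm P)" by (simp add: mult_gcnj)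
  finally have Xc: "gim (X\<^sup>2 * gcnj P) = c" unfolding c_def by (simp only: gauss_sel gauss_of_int diff_zero)
  have "gmod X \<le> gmod z2 + gmod z3 + gmod z1"
    unfolding X_def using gmod_diff_le[of "z2 + z3" z1] gmod_add_le[of z2 z3] by linarith
  then have X3: "X \<in> hyperbola (3 * N) P c" using Xc b assms by (simp add: hyperbola_def disc_def)
  have X_f: "X + z1 - f = 2 * z2" by (simp add: X_def f_def)
  have h: "x = (z1, half (X + z1 - f), half (X + z1 - f) + f)"
    unfolding X_f half_double by (simp add: x f_def)
  have "z1 dvd of_int l * P" using l by (metis dvd_triv_left)
  moreover have "x \<in> (let f = (of_int l * P) div z1; c = gim ((z1 - f)\<^sup>2 * gcnj P)
      in if c = 0 then {} else (\<lambda>X. (z1, half (X + z1 - f), half (X + z1 - f) + f)) ` hyperbola (3 * N) P c)"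
    unfolding Let_def f c_def[symmetric] using c0 h X3 by auto
  ultimately show "x \<in> (\<Union>P\<in>disc B - {0}. \<Union>l\<in>{l. l \<noteq> 0 \<and> \<bar>of_int l\<bar> \<le> 2 * r * N / gmod P}. \<Union>z1\<in>divisors (of_int l * P).
      let f = (of_int l * P) div z1; c = gim ((z1 - f)\<^sup>2 * gcnj P)
      in if c = 0 then {} else (\<lambda>X. (z1, half (X + z1 - f), half (X + z1 - f) + f)) ` hyperbola (3 * N) P c)"
    using P lP by (intro UN_I) (auto simp: disc_def divisors_def simp del: Let_def)
qed

text \<open>There are \<open>O(r * N / gmod P)\<close> choices of \<open>l\<close>, each with few
  divisors \<open>z1\<close> and few hyperbola points; summing \<open>1 / gmod P\<close> over the
  disc of radius \<open>B\<close> gives at most \<open>12 * B\<close>, hence the main term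
  \<open>r * N * B\<close>.\<close>

lemma card_small_ratio_triples:
  assumes "\<eta> > 0"
  shows "\<exists>C>0. \<forall>r N B. 1 \<le> r \<longrightarrow> r \<le> N \<longrightarrow> 0 \<le> B \<longrightarrow> B \<le> N \<longrightarrow>
    real (card (small_ratio_triples r N B)) \<le> C * r * N * B * N powr \<eta>"
proof -
  obtain C1 where C1: "C1 > 0" "\<And>z. z \<noteq> 0 \<Longrightarrow> real (card (divisors z)) \<le> C1 * gmod z powr (\<eta> / 3)"
    using divisor_bound[of "\<eta> / 3"] assms by auto
  obtain C2 where C2: "C2 > 0" "\<And>N P c. 1 \<le> N \<Longrightarrow> P \<noteq> 0 \<Longrightarrow> gmod P \<le> N \<Longrightarrow> c \<noteq> 0 \<Longrightarrow>
    real (card (hyperbola N P c)) \<le> C2 * N powr (\<eta> / 3)"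
    using hyperbola_bound[of "\<eta> / 3"] assms by auto
  define C where "C = 48 * (C1 * 2 powr (\<eta> / 3)) * (C2 * 3 powr (\<eta> / 3))"
  have "real (card (small_ratio_triples r N B)) \<le> C * r * N * B * N powr \<eta>"
    if *: "1 \<le> r" "r \<le> N" "0 \<le> B" "B \<le> N" for r N B
  proof -
    define L where "L P = {l. l \<noteq> 0 \<and> \<bar>of_int l\<bar> \<le> 2 * r * N / gmod P}" for P
    define H where "H P l z1 = (let f = (of_int l * P) div z1; c = gim ((z1 - f)\<^sup>2 * gcnj P)
      in if c = 0 then {} else (\<lambda>X. (z1, half (X + z1 - f), half (X + z1 - f) + f)) ` hyperbola (3 * N) P c)"
      for P l z1
    define D where "D = C1 * 2 powr (\<eta> / 3) * N powr (2 * \<eta> / 3)"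
    define E where "E = C2 * 3 powr (\<eta> / 3) * N powr (\<eta> / 3)"
    have DE: "D \<ge> 0" "E \<ge> 0" using C1 C2 by (simp_all add: D_def E_def)
    have sub: "small_ratio_triples r N B \<subseteq> (\<Union>P\<in>disc B - {0}. \<Union>l\<in>L P. \<Union>z1\<in>divisors (of_int l * P). H P l z1)"
      using small_ratio_triples_subset[OF *(1,2), of B] unfolding L_def H_def .
    have H: "finite (H P l z1)" "real (card (H P l z1)) \<le> E" if "P \<in> disc B - {0}" for P l z1
    proof -
      show "finite (H P l z1)" by (simp add: H_def Let_def)
      define c where "c = gim ((z1 - (of_int l * P) div z1)\<^sup>2 * gcnj P)"
      show "real (card (H P l z1)) \<le> E"
      proof (cases "c = 0")
        case False
        have "card (H P l z1) \<le> card (hyperbola (3 * N) P c)"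
          using False unfolding H_def Let_def c_def[symmetric] by (simp add: card_image_le)
        also have "real \<dots> \<le> C2 * (3 * N) powr (\<eta> / 3)"
          using * that False by (intro C2) (auto simp: disc_def)
        also have "\<dots> = E" using * by (simp add: E_def powr_mult)
        finally show ?thesis by simp
      next
        case True
        then show ?thesis using DE unfolding H_def Let_def c_def[symmetric] by simp
      qed
    qed
    have l0: "of_int l * P \<noteq> 0" if "P \<in> disc B - {0}" "l \<in> L P" for l P using that by (auto simp: L_def)
    have dv: "real (card (\<Union>z1\<in>divisors (of_int l * P). H P l z1)) \<le> D * E" if "P \<in> disc B - {0}" "l \<in> L P" for l P
    proof -
      have "gmod P > 0" using that by simp
      then have "gmod (of_int l * P) \<le> 2 * r * N"
        using that by (simp add: L_def gmod_mult field_simps)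
      also have "\<dots> \<le> 2 * N * N" using * by (intro mult_mono) auto
      finally have lP: "gmod (of_int l * P) \<le> 2 * N ^ 2" by (simp add: power2_eq_square)
      have "real (card (divisors (of_int l * P))) \<le> C1 * gmod (of_int l * P) powr (\<eta> / 3)"
        using l0[OF that] by (rule C1)
      also have "\<dots> \<le> C1 * (2 * N ^ 2) powr (\<eta> / 3)"
        using C1(1) assms lP by (intro mult_left_mono powr_mono2) auto
      also have "\<dots> = D" using * by (simp add: D_def powr_mult powr_powr flip: powr_numeral)
      finally have d: "real (card (divisors (of_int l * P))) \<le> D" .
      have "real (card (\<Union>z1\<in>divisors (of_int l * P). H P l z1)) \<le> (\<Sum>z1\<in>divisors (of_int l * P). E)"
        using l0[OF that] H[OF that(1)] by (intro card_UN_bound) auto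
      also have "\<dots> \<le> D * E" using d DE by (simp add: mult_right_mono)
      finally show ?thesis .
    qed
    have L: "finite (L P)" "real (card (L P)) \<le> 4 * r * N / gmod P" if "P \<in> disc B - {0}" for P
    proof -
      have A: "2 * r * N / gmod P \<ge> 0" using * by simp
      have "L P \<subseteq> {l. \<bar>of_int l\<bar> \<le> 2 * r * N / gmod P}" by (auto simp: L_def)
      then show "finite (L P)" using card_int_abs_le(1)[OF A] by (rule finite_subset)
      have "real (card (L P)) = 2 * real (nat \<lfloor>2 * r * N / gmod P\<rfloor>)"
        using sum_nonzero_ints[OF A, of "\<lambda>_. 1"] by (simp add: L_def)
      also have "\<dots> \<le> 2 * (2 * r * N / gmod P)"
        using A by (intro mult_left_mono of_nat_floor) auto
      finally show "real (card (L P)) \<le> 4 * r * N / gmod P" by simp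
    qed
    have "finite (\<Union>P\<in>disc B - {0}. \<Union>l\<in>L P. \<Union>z1\<in>divisors (of_int l * P). H P l z1)"
      using L H l0 by (intro finite_UN_I finite_Diff finite_disc finite_divisors) auto
    then have "card (small_ratio_triples r N B) \<le> card (\<Union>P\<in>disc B - {0}. \<Union>l\<in>L P. \<Union>z1\<in>divisors (of_int l * P). H P l z1)"
      using sub by (intro card_mono)
    also have "real \<dots> \<le> (\<Sum>P\<in>disc B - {0}. 4 * r * N / gmod P * (D * E))"
    proof (intro card_UN_bound)
      fix P assume P: "P \<in> disc B - {0}"
      have "real (card (\<Union>l\<in>L P. \<Union>z1\<in>divisors (of_int l * P). H P l z1)) \<le> (\<Sum>l\<in>L P. D * E)"
        using L[OF P] dv[OF P] by (intro card_UN_bound) auto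
      also have "\<dots> \<le> 4 * r * N / gmod P * (D * E)"
        using mult_right_mono[OF L(2)[OF P], of "D * E"] DE by simp
      finally show "real (card (\<Union>l\<in>L P. \<Union>z1\<in>divisors (of_int l * P). H P l z1)) \<le> 4 * r * N / gmod P * (D * E)" .
    qed simp
    also have "\<dots> = 4 * r * N * (D * E) * (\<Sum>P\<in>disc B - {0}. 1 / gmod P)"
      by (simp add: sum_distrib_left mult_ac)
    also have "\<dots> \<le> 4 * r * N * (D * E) * (12 * B)"
      using sum_disc_inverse[OF *(3)] * DE by (intro mult_left_mono) auto
    also have "\<dots> = C * r * N * B * (N powr (2 * \<eta> / 3) * N powr (\<eta> / 3))"
      by (simp add: C_def D_def E_def)
    also have "N powr (2 * \<eta> / 3) * N powr (\<eta> / 3) = N powr \<eta>" by (simp flip: powr_add)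
    finally show ?thesis by simp
  qed
  moreover have "C > 0" using C1 C2 by (simp add: C_def)
  ultimately show ?thesis by blast
qed

section \<open>Quadruples whose multipliers are small: common divisors\<close>

text \<open>For coprime \<open>z\<^sub>i\<close>, the circle condition reads \<open>l\<^sub>1 / z\<^sub>1 + l\<^sub>2 / z\<^sub>2 + l\<^sub>3 / z\<^sub>3 = 0\<close> with integers \<open>l\<^sub>i\<close>
  of sum 0. Here \<open>p\<^sub>i\<close> is the gcd of the two \<open>z\<^sub>j\<close> other than \<open>z\<^sub>i\<close>, and \<open>e\<^sub>i\<close> is the cofactor in
  \<open>z\<^sub>1 = p\<^sub>2 p\<^sub>3 e\<^sub>1\<close> and its analogues.\<close>

definition ratio_structure :: "int \<Rightarrow> int \<Rightarrow> int \<Rightarrow> gauss \<Rightarrow> gauss \<Rightarrow> gauss \<Rightarrow> gauss \<Rightarrow> gauss \<Rightarrow> gauss \<Rightarrow> bool" where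
  "ratio_structure l1 l2 l3 p1 p2 p3 e1 e2 e3 \<longleftrightarrow>
     l1 \<noteq> 0 \<and> l2 \<noteq> 0 \<and> l3 \<noteq> 0 \<and> coprime l1 l2 \<and> coprime l1 l3 \<and> coprime l2 l3 \<and> l1 + l2 + l3 = 0 \<and>
     e1 dvd of_int l1 \<and> e2 dvd of_int l2 \<and> e3 dvd of_int l3 \<and> p1 \<noteq> 0 \<and> p2 \<noteq> 0 \<and> p3 \<noteq> 0 \<and>
     of_int l1 * p1 * e2 * e3 + of_int l2 * p2 * e1 * e3 + of_int l3 * p3 * e1 * e2 = 0"

lemma ratio_structure_swap12: "ratio_structure l1 l2 l3 p1 p2 p3 e1 e2 e3 \<Longrightarrow> ratio_structure l2 l1 l3 p2 p1 p3 e2 e1 e3"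
  and ratio_structure_swap13: "ratio_structure l1 l2 l3 p1 p2 p3 e1 e2 e3 \<Longrightarrow> ratio_structure l3 l2 l1 p3 p2 p1 e3 e2 e1"
  by (auto simp: ratio_structure_def coprime_commute algebra_simps)

text \<open>Since the three \<open>z\<close> have no common factor, their pairwise gcds are coprime
  to each other and can be divided out. Modulo \<open>e1\<close> the relation, freed of
  \<open>p1 * p2 * p3\<close>, reduces to its first term, and \<open>e1\<close> is coprime to
  \<open>p1 * e2 * e3\<close>, so it divides \<open>l1\<close>; the other two are symmetric.\<close>

lemma ratio_structure_exists:
  assumes z: "z1 \<noteq> 0" "z2 \<noteq> 0" "z3 \<noteq> 0" "gcd z1 (gcd z2 z3) = 1"
    and l: "l1 \<noteq> 0" "l2 \<noteq> 0" "l3 \<noteq> 0" "coprime l1 l2" "l1 + l2 + l3 = 0"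
    and eq: "of_int l1 * z2 * z3 + of_int l2 * z1 * z3 + of_int l3 * z1 * z2 = (0 :: gauss)"
  obtains p1 p2 p3 e1 e2 e3 where "ratio_structure l1 l2 l3 p1 p2 p3 e1 e2 e3"
    "z1 = p2 * p3 * e1" "z2 = p1 * p3 * e2" "z3 = p1 * p2 * e3"
proof -
  define p3 p2 p1 where "p3 = gcd z1 z2" and "p2 = gcd z1 z3" and "p1 = gcd z2 z3"
  have p0: "p1 \<noteq> 0" "p2 \<noteq> 0" "p3 \<noteq> 0" using z by (auto simp: p1_def p2_def p3_def)
  have unit: "is_unit d" if "d dvd z1" "d dvd z2" "d dvd z3" for d
    using that z(4) by (metis gcd_greatest)
  have dv: "p3 dvd z1" "p3 dvd z2" "p2 dvd z1" "p2 dvd z3" "p1 dvd z2" "p1 dvd z3"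
    by (auto simp: p1_def p2_def p3_def)
  have cp: "coprime p2 p3" "coprime p1 p3" "coprime p1 p2"
    by (rule coprimeI; rule unit; use dv in \<open>blast intro: dvd_trans\<close>)+
  obtain e1 where e1: "z1 = p2 * p3 * e1" using divides_mult[OF dv(3,1) cp(1)] by (elim dvdE)
  obtain e2 where e2: "z2 = p1 * p3 * e2" using divides_mult[OF dv(5,2) cp(2)] by (elim dvdE)
  obtain e3 where e3: "z3 = p1 * p2 * e3" using divides_mult[OF dv(6,4) cp(3)] by (elim dvdE)
  have q: "coprime x y" if "gcd (p * x) (p * y) = p" "p \<noteq> 0" for p x y :: gauss
  proof -
    have "p * gcd x y dvd p" using that(1) by (metis gcd_greatest dvd_refl mult_dvd_mono gcd_dvd1 gcd_dvd2)
    then have "is_unit (gcd x y)" using that(2) by (metis dvd_mult_cancel_left mult_1_right)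
    then show ?thesis by (simp add: coprime_iff_gcd_eq_1)
  qed
  have c12: "coprime (p2 * e1) (p1 * e2)"
  proof (rule q[of p3])
    have "p3 * (p2 * e1) = z1" "p3 * (p1 * e2) = z2" by (simp_all only: e1 e2 e3 mult_ac)
    then show "gcd (p3 * (p2 * e1)) (p3 * (p1 * e2)) = p3" by (metis p3_def)
  qed (rule p0)
  have c13: "coprime (p3 * e1) (p1 * e3)"
  proof (rule q[of p2])
    have "p2 * (p3 * e1) = z1" "p2 * (p1 * e3) = z3" by (simp_all only: e1 e2 e3 mult_ac)
    then show "gcd (p2 * (p3 * e1)) (p2 * (p1 * e3)) = p2" by (metis p2_def)
  qed (rule p0)
  have c23: "coprime (p3 * e2) (p2 * e3)"
  proof (rule q[of p1])
    have "p1 * (p3 * e2) = z2" "p1 * (p2 * e3) = z3" by (simp_all only: e1 e2 e3 mult_ac)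
    then show "gcd (p1 * (p3 * e2)) (p1 * (p2 * e3)) = p1" by (metis p1_def)
  qed (rule p0)
  have "p1 * p2 * p3 * (of_int l1 * p1 * e2 * e3 + of_int l2 * p2 * e1 * e3 + of_int l3 * p3 * e1 * e2) = 0"
    using eq by (simp add: e1 e2 e3 algebra_simps)
  then have main: "of_int l1 * p1 * e2 * e3 + of_int l2 * p2 * e1 * e3 + of_int l3 * p3 * e1 * e2 = 0"
    using p0 by simp
  define W where "W = of_int l1 * p1 * e2 * e3 + of_int l2 * p2 * e1 * e3 + of_int l3 * p3 * e1 * e2"
  have W: "W = 0" using main by (simp only: W_def)
  have "of_int l1 * (p1 * e2 * e3) = W + e1 * (- of_int l2 * p2 * e3 - of_int l3 * p3 * e2)"
    by (simp add: W_def algebra_simps)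
  then have "e1 dvd of_int l1 * (p1 * e2 * e3)" by (simp add: W)
  moreover have "coprime e1 (p1 * e2 * e3)" using c12 c13 by simp
  ultimately have d1: "e1 dvd of_int l1" by (simp add: coprime_dvd_mult_left_iff)
  have "of_int l2 * (p2 * e1 * e3) = W + e2 * (- of_int l1 * p1 * e3 - of_int l3 * p3 * e1)"
    by (simp add: W_def algebra_simps)
  then have "e2 dvd of_int l2 * (p2 * e1 * e3)" by (simp add: W)
  moreover have "coprime e2 (p2 * e1 * e3)" using c12 c23 by (simp add: coprime_commute)
  ultimately have d2: "e2 dvd of_int l2" by (simp add: coprime_dvd_mult_left_iff)
  have "of_int l3 * (p3 * e1 * e2) = W + e3 * (- of_int l1 * p1 * e2 - of_int l2 * p2 * e1)"
    by (simp add: W_def algebra_simps)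
  then have "e3 dvd of_int l3 * (p3 * e1 * e2)" by (simp add: W)
  moreover have "coprime e3 (p3 * e1 * e2)" using c13 c23 by (simp add: coprime_commute)
  ultimately have d3: "e3 dvd of_int l3" by (simp add: coprime_dvd_mult_left_iff)
  have l12: "l2 = - l1 - l3" "l1 = - l2 - l3" using l by simp_all
  have "coprime l1 l3"
    by (rule coprimeI, rule coprime_common_divisor[OF l(4)]) (simp_all add: l12(1))
  moreover have "coprime l2 l3"
    by (rule coprimeI, rule coprime_common_divisor[OF l(4)]) (simp_all add: l12(2))
  ultimately show ?thesis
    using that[of p1 p2 p3 e1 e2 e3] l p0 d1 d2 d3 main e1 e2 e3 by (simp add: ratio_structure_def)
qed

text \<open>Let \<open>a\<close> be the coordinate of modulus at most \<open>K\<close>: as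
  \<open>y3\<close> is invertible modulo \<open>y1\<close>, the congruence confines \<open>b\<close>
  to one residue class, with at most \<open>(4 * (M / gmod a / gmod y1) + 1)\<^sup>2\<close> members
  in its disc. The squared main terms sum to the \<open>M\<^sup>2\<close> part, the constants to the
  \<open>K\<^sup>2\<close> part.\<close>

lemma card_pairs_residue:
  assumes "\<eta> > 0"
  shows "\<exists>C>0. \<forall>M K y1 y2 y3. 0 \<le> M \<longrightarrow> 1 \<le> K \<longrightarrow> y1 \<noteq> 0 \<longrightarrow> coprime y1 y2 \<longrightarrow> coprime y1 y3 \<longrightarrow>
    real (card {(a, b). a \<noteq> 0 \<and> b \<noteq> 0 \<and> gmod a * gmod b \<le> M \<and> min (gmod a) (gmod b) \<le> K \<and>
      y1 dvd y2 * a + y3 * b}) \<le> C * K powr \<eta> * (M\<^sup>2 / (gmod y1)\<^sup>2 + K\<^sup>2)"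
proof -
  obtain C where C: "C > 0" "\<And>A. A \<ge> 1 \<Longrightarrow> (\<Sum>e\<in>disc A - {0}. 1 / (gmod e)\<^sup>2) \<le> C * A powr \<eta>"
    using sum_disc_inverse_square[OF assms] by auto
  define S where "S M K y1 y2 y3 = {(a, b). a \<noteq> 0 \<and> b \<noteq> 0 \<and> gmod a * gmod b \<le> M \<and> gmod a \<le> K \<and>
      y1 dvd y2 * a + y3 * b}" for M K y1 y2 y3
  define D where "D = 32 * C + 18"
  have one: "finite (S M K y1 y2 y3)" "real (card (S M K y1 y2 y3)) \<le> D * K powr \<eta> * (M\<^sup>2 / (gmod y1)\<^sup>2 + K\<^sup>2)"
    if *: "0 \<le> M" "1 \<le> K" "y1 \<noteq> 0" "coprime y1 y3" for M K y1 y2 y3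
  proof -
    obtain u v where uv: "u * y1 + v * y3 = 1"
      using * by (metis bezout_coefficients_fst_snd coprime_iff_gcd_eq_1)
    have sq: "(x + 1)\<^sup>2 \<le> 2 * x\<^sup>2 + 2" for x :: real
      using zero_le_power2[of "x - 1"] by (simp add: power2_eq_square algebra_simps)
    define T where "T a = {b \<in> disc (M / gmod a). y1 dvd b - (- v * y2 * a)}" for a
    have sub: "S M K y1 y2 y3 \<subseteq> (SIGMA a : disc K - {0}. T a)"
    proof safe
      fix a b assume ab: "(a, b) \<in> S M K y1 y2 y3"
      then have dv: "y1 dvd y2 * a + y3 * b" and a: "gmod a * gmod b \<le> M" "a \<noteq> 0" by (auto simp: S_def)
      have "b - (- v * y2 * a) = v * (y2 * a + y3 * b) + u * y1 * b"
      proof -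
        have "b = (u * y1 + v * y3) * b" using uv by simp
        then show ?thesis by (simp add: algebra_simps)
      qed
      moreover have "y1 dvd v * (y2 * a + y3 * b) + u * y1 * b" using dv by simp
      ultimately have "y1 dvd b - (- v * y2 * a)" by metis
      moreover have "gmod b \<le> M / gmod a" using a by (simp add: field_simps)
      ultimately show "b \<in> T a" by (simp add: T_def disc_def)
    qed (auto simp: S_def disc_def)
    have fin: "finite (SIGMA a : disc K - {0}. T a)" by (auto simp: T_def)
    show "finite (S M K y1 y2 y3)" using sub fin by (rule finite_subset)
    have "real (card (S M K y1 y2 y3)) \<le> real (card (SIGMA a : disc K - {0}. T a))"
      using sub fin by (intro of_nat_mono card_mono)
    also have "\<dots> = (\<Sum>a\<in>disc K - {0}. real (card (T a)))" by (simp add: T_def)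
    also have "\<dots> \<le> (\<Sum>a\<in>disc K - {0}. 32 * (M\<^sup>2 / (gmod y1)\<^sup>2) * (1 / (gmod a)\<^sup>2) + 2)"
    proof (intro sum_mono)
      fix a assume "a \<in> disc K - {0}"
      have "real (card (T a)) \<le> (4 * (M / gmod a / gmod y1) + 1)\<^sup>2"
        unfolding T_def using * by (intro card_disc_residue) auto
      also have "\<dots> \<le> 2 * (4 * (M / gmod a / gmod y1))\<^sup>2 + 2"
        by (rule sq)
      finally show "real (card (T a)) \<le> 32 * (M\<^sup>2 / (gmod y1)\<^sup>2) * (1 / (gmod a)\<^sup>2) + 2"
        by (simp add: power_mult_distrib power_divide mult_ac)
    qed
    also have "\<dots> = 32 * (M\<^sup>2 / (gmod y1)\<^sup>2) * (\<Sum>a\<in>disc K - {0}. 1 / (gmod a)\<^sup>2) + 2 * real (card (disc K - {0}))"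
      by (simp add: sum.distrib sum_distrib_left)
    also have "\<dots> \<le> 32 * (M\<^sup>2 / (gmod y1)\<^sup>2) * (C * K powr \<eta>) + 2 * (9 * K\<^sup>2)"
    proof -
      have "card (disc K - {0}) \<le> card (disc K)" by (intro card_mono) auto
      then have "real (card (disc K - {0})) \<le> 9 * K\<^sup>2" using card_disc'[OF *(2)] by linarith
      then show ?thesis using C(2)[OF *(2)] by (intro add_mono mult_left_mono) auto
    qed
    also have "\<dots> \<le> D * K powr \<eta> * (M\<^sup>2 / (gmod y1)\<^sup>2 + K\<^sup>2)"
    proof -
      have K1: "1 \<le> K powr \<eta>" using * assms by (intro ge_one_powr_ge_zero) auto
      define A where "A = M\<^sup>2 / (gmod y1)\<^sup>2"
      have "0 \<le> A * K powr \<eta>" "0 \<le> C * (K\<^sup>2 * K powr \<eta>)" using C(1) by (simp_all add: A_def)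
      moreover have "K\<^sup>2 * 1 \<le> K\<^sup>2 * K powr \<eta>" using K1 by (intro mult_left_mono) auto
      moreover have "D * K powr \<eta> * (A + K\<^sup>2) = 32 * A * (C * K powr \<eta>) + 18 * (A * K powr \<eta>)
          + 32 * (C * (K\<^sup>2 * K powr \<eta>)) + 18 * (K\<^sup>2 * K powr \<eta>)"
        by (simp add: D_def algebra_simps)
      ultimately have "32 * A * (C * K powr \<eta>) + 2 * (9 * K\<^sup>2) \<le> D * K powr \<eta> * (A + K\<^sup>2)" by linarith
      then show ?thesis unfolding A_def .
    qed
    finally show "real (card (S M K y1 y2 y3)) \<le> D * K powr \<eta> * (M\<^sup>2 / (gmod y1)\<^sup>2 + K\<^sup>2)" .
  qed
  have "real (card {(a, b). a \<noteq> 0 \<and> b \<noteq> 0 \<and> gmod a * gmod b \<le> M \<and> min (gmod a) (gmod b) \<le> K \<and>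
      y1 dvd y2 * a + y3 * b}) \<le> (2 * D) * K powr \<eta> * (M\<^sup>2 / (gmod y1)\<^sup>2 + K\<^sup>2)"
    (is "real (card ?A) \<le> _")
    if *: "0 \<le> M" "1 \<le> K" "y1 \<noteq> 0" "coprime y1 y2" "coprime y1 y3" for M K y1 y2 y3
  proof -
    have "?A \<subseteq> S M K y1 y2 y3 \<union> prod.swap ` S M K y1 y3 y2"
    proof safe
      fix a b assume h: "a \<noteq> 0" "b \<noteq> 0" "gmod a * gmod b \<le> M" "min (gmod a) (gmod b) \<le> K" "y1 dvd y2 * a + y3 * b"
        "(a, b) \<notin> prod.swap ` S M K y1 y3 y2"
      have "(b, a) \<notin> S M K y1 y3 y2" using h(6) by (metis image_eqI swap_simp)
      with h show "(a, b) \<in> S M K y1 y2 y3" by (auto simp: S_def mult.commute add.commute)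
    qed
    then have "card ?A \<le> card (S M K y1 y2 y3 \<union> prod.swap ` S M K y1 y3 y2)"
      using one(1) * by (intro card_mono) auto
    also have "\<dots> \<le> card (S M K y1 y2 y3) + card (prod.swap ` S M K y1 y3 y2)" by (rule card_Un_le)
    also have "\<dots> \<le> card (S M K y1 y2 y3) + card (S M K y1 y3 y2)"
      using one(1) * by (intro add_left_mono card_image_le) auto
    finally have "real (card ?A) \<le> real (card (S M K y1 y2 y3)) + real (card (S M K y1 y3 y2))" by linarith
    then show ?thesis using one(2)[OF *(1,2,3,5), of y2] one(2)[OF *(1,2,3,4), of y3] by linarith
  qed
  moreover have "2 * D > 0" using C by (simp add: D_def)
  ultimately show ?thesis by blast
qed

text \<open>The normalization \<open>\<bar>l2\<bar> \<le> 2 * \<bar>l1\<bar>\<close> leaves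
  \<open>O(\<bar>l1\<bar>)\<close> choices of \<open>l2\<close> once \<open>l1\<close> is given; a
  permutation of the indices achieves it.\<close>

definition ratio_triples :: "real \<Rightarrow> real \<Rightarrow> real \<Rightarrow> (gauss \<times> gauss \<times> gauss) set" where
  "ratio_triples M K L = {(z1, z2, z3). \<exists>l1 l2 l3 p1 p2 p3 e1 e2 e3.
     ratio_structure l1 l2 l3 p1 p2 p3 e1 e2 e3 \<and> z1 = p2 * p3 * e1 \<and> z2 = p1 * p3 * e2 \<and> z3 = p1 * p2 * e3 \<and>
     \<bar>of_int l1\<bar> \<le> L \<and> \<bar>l2\<bar> \<le> 2 * \<bar>l1\<bar> \<and> gmod z1 \<le> M \<and> min (gmod p2) (gmod p3) \<le> K}"

lemma coprime_of_int_gauss: "coprime a b \<Longrightarrow> coprime (of_int a :: gauss) (of_int b)"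
proof -
  assume "coprime a b"
  then obtain u v where "u * a + v * b = 1" using bezout_int[of a b] by auto
  then have uv: "of_int u * of_int a + of_int v * of_int b = (1 :: gauss)"
    by (metis of_int_1 of_int_add of_int_mult)
  show ?thesis
    by (rule coprimeI) (metis uv dvd_add dvd_mult)
qed

text \<open>Division by \<open>e1 * e2 * e3\<close>. It serves to show that \<open>p2\<close> and
  \<open>p3\<close> determine \<open>p1\<close> and satisfy a congruence modulo the quotient of
  \<open>l1\<close> by \<open>e1\<close>.\<close>

lemma ratio_structure_relation:
  assumes "ratio_structure l1 l2 l3 p1 p2 p3 e1 e2 e3"
  shows "of_int l1 div e1 * p1 = - (of_int l2 div e2 * p2 + of_int l3 div e3 * p3)"
proof -
  have l: "of_int l1 = e1 * (of_int l1 div e1)" "of_int l2 = e2 * (of_int l2 div e2)"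
    "of_int l3 = e3 * (of_int l3 div e3)" and l0: "l1 \<noteq> 0" "l2 \<noteq> 0" "l3 \<noteq> 0"
    and eq: "of_int l1 * p1 * e2 * e3 + of_int l2 * p2 * e1 * e3 + of_int l3 * p3 * e1 * e2 = 0"
    using assms by (auto simp: ratio_structure_def)
  define y1 y2 y3 where "y1 = of_int l1 div e1" and "y2 = of_int l2 div e2" and "y3 = of_int l3 div e3"
  have "(of_int l1 :: gauss) \<noteq> 0" "(of_int l2 :: gauss) \<noteq> 0" "(of_int l3 :: gauss) \<noteq> 0" using l0 by simp_all
  then have e0: "e1 \<noteq> 0" "e2 \<noteq> 0" "e3 \<noteq> 0" using assms by (auto simp: ratio_structure_def)
  have "e1 * y1 * p1 * e2 * e3 + e2 * y2 * p2 * e1 * e3 + e3 * y3 * p3 * e1 * e2 = 0"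
    using eq l unfolding y1_def y2_def y3_def by metis
  then have "e1 * e2 * e3 * (y1 * p1 + (y2 * p2 + y3 * p3)) = 0" by (simp add: algebra_simps)
  then have "y1 * p1 + (y2 * p2 + y3 * p3) = 0" using e0 by simp
  then show ?thesis unfolding y1_def y2_def y3_def by (simp only: eq_neg_iff_add_eq_0)
qed

text \<open>For fixed multipliers and divisors, \<open>p2\<close> and \<open>p3\<close> have a
  product of modulus at most \<open>M / gmod e1\<close> and satisfy a congruence modulo
  \<open>y1 = l1 / e1\<close>; the main term
  \<open>(M / gmod e1)\<^sup>2 / (gmod y1)\<^sup>2\<close> is \<open>M\<^sup>2 / l1\<^sup>2\<close>
  whatever \<open>e1\<close> is. Summing
  \<open>\<bar>l1\<bar> * (M\<^sup>2 / l1\<^sup>2 + K\<^sup>2)\<close> over \<open>l1\<close> gives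
  \<open>M\<^sup>2\<close> up to a small power, and \<open>L\<^sup>2 * K\<^sup>2\<close>.\<close>

lemma card_ratio_triples:
  assumes "\<eta> > 0"
  shows "\<exists>C>0. \<forall>M K L X. 0 \<le> M \<longrightarrow> 1 \<le> K \<longrightarrow> 1 \<le> L \<longrightarrow> K \<le> X \<longrightarrow> L \<le> X \<longrightarrow>
    finite (ratio_triples M K L) \<and>
    real (card (ratio_triples M K L)) \<le> C * X powr \<eta> * (M\<^sup>2 + L\<^sup>2 * K\<^sup>2)"
proof -
  \<comment> \<open>Five small powers arise: three divisor counts, the pair count and the harmonic
    sum over \<open>l1\<close>.\<close>
  define \<theta> where "\<theta> = \<eta> / 5"
  have \<theta>: "\<theta> > 0" using assms by (simp add: \<theta>_def)
  obtain C1 where C1: "C1 > 0" "\<And>z. z \<noteq> 0 \<Longrightarrow> real (card (divisors z)) \<le> C1 * gmod z powr \<theta>"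
    using divisor_bound[OF \<theta>] by auto
  define PS where "PS M K y1 y2 y3 = {(a, b). a \<noteq> 0 \<and> b \<noteq> 0 \<and> gmod a * gmod b \<le> M \<and> min (gmod a) (gmod b) \<le> K \<and>
      y1 dvd y2 * a + y3 * b}" for M K y1 y2 y3
  obtain C2 where C2: "C2 > 0" "\<And>M K y1 y2 y3. 0 \<le> M \<Longrightarrow> 1 \<le> K \<Longrightarrow> y1 \<noteq> 0 \<Longrightarrow> coprime y1 y2 \<Longrightarrow> coprime y1 y3 \<Longrightarrow>
    real (card (PS M K y1 y2 y3)) \<le> C2 * K powr \<theta> * (M\<^sup>2 / (gmod y1)\<^sup>2 + K\<^sup>2)"
    using card_pairs_residue[OF \<theta>] unfolding PS_def by auto
  obtain C3 where C3: "C3 > 0" "\<And>A. A \<ge> 1 \<Longrightarrow> (\<Sum>m=1..nat \<lfloor>A\<rfloor>. 1 / real m) \<le> C3 * A powr \<theta>"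
    using sum_inverse_le_powr[OF \<theta>] by auto
  define C where "C = (C1 * 3 powr \<theta>) ^ 3 * C2 * (8 * C3 + 8)"
  have "finite (ratio_triples M K L) \<and> real (card (ratio_triples M K L)) \<le> C * X powr \<eta> * (M\<^sup>2 + L\<^sup>2 * K\<^sup>2)"
    if *: "0 \<le> M" "1 \<le> K" "1 \<le> L" "K \<le> X" "L \<le> X" for M K L X
  proof -
    define g where "g y1 y2 y3 e1 e2 e3 = (\<lambda>(a, b). let p = - (y2 * a + y3 * b) div y1 in (a * b * e1, p * b * e2, p * a * e3))"
      for y1 y2 y3 e1 e2 e3 :: gauss
    define A where "A l1 l2 = (\<lambda>(e1, e2, e3). g (of_int l1 div e1) (of_int l2 div e2) (of_int (- l1 - l2) div e3) e1 e2 e3 `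
       PS (M / gmod e1) K (of_int l1 div e1) (of_int l2 div e2) (of_int (- l1 - l2) div e3))" for l1 l2
    define Dv where "Dv l1 l2 = divisors (of_int l1) \<times> divisors (of_int l2) \<times> divisors (of_int (- l1 - l2))" for l1 l2
    define I1 where "I1 = {l::int. l \<noteq> 0 \<and> \<bar>of_int l\<bar> \<le> L}"
    define I2 where "I2 l1 = {l2. l2 \<noteq> 0 \<and> \<bar>l2\<bar> \<le> 2 * \<bar>l1\<bar> \<and> l1 + l2 \<noteq> 0 \<and> coprime l1 l2 \<and> coprime l1 (- l1 - l2)}" for l1 :: int
    have finPS: "finite (PS M' K y1 y2 y3)" for M' y1 y2 y3
    proof (rule finite_subset)
      show "PS M' K y1 y2 y3 \<subseteq> disc M' \<times> disc M'"
      proof safe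
        fix a b assume ab: "(a, b) \<in> PS M' K y1 y2 y3"
        then have h: "a \<noteq> 0" "b \<noteq> 0" "gmod a * gmod b \<le> M'" by (auto simp: PS_def)
        then have "gmod a * 1 \<le> gmod a * gmod b" "1 * gmod b \<le> gmod a * gmod b"
          using gmod_ge_1 h by (intro mult_mono; simp)+
        with h(3) have "gmod a \<le> M'" "gmod b \<le> M'" by linarith+
        then show "a \<in> disc M'" "b \<in> disc M'" by (simp_all add: disc_def)
      qed
    qed simp
    have sub: "ratio_triples M K L \<subseteq> (\<Union>l1\<in>I1. \<Union>l2\<in>I2 l1. \<Union>e\<in>Dv l1 l2. A l1 l2 e)"
    proof
      fix x assume "x \<in> ratio_triples M K L"
      then obtain l1 l2 l3 p1 p2 p3 e1 e2 e3 where rs: "ratio_structure l1 l2 l3 p1 p2 p3 e1 e2 e3"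
        and x: "x = (p2 * p3 * e1, p1 * p3 * e2, p1 * p2 * e3)"
        and b: "\<bar>of_int l1\<bar> \<le> L" "\<bar>l2\<bar> \<le> 2 * \<bar>l1\<bar>" "gmod (p2 * p3 * e1) \<le> M" "min (gmod p2) (gmod p3) \<le> K"
        unfolding ratio_triples_def by blast
      have l3: "l3 = - l1 - l2" using rs by (auto simp: ratio_structure_def)
      have l1: "l1 \<in> I1" and l2: "l2 \<in> I2 l1" and e: "(e1, e2, e3) \<in> Dv l1 l2"
        using rs b unfolding l3 by (auto simp: ratio_structure_def I1_def I2_def Dv_def divisors_def)
      define y1 y2 y3 where "y1 = of_int l1 div e1" and "y2 = of_int l2 div e2" and "y3 = of_int (- l1 - l2) div e3"
      have rel: "y1 * p1 = - (y2 * p2 + y3 * p3)"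
        using ratio_structure_relation[OF rs] unfolding y1_def y2_def y3_def l3 .
      have "of_int l1 = e1 * y1" using rs by (simp add: ratio_structure_def y1_def)
      moreover have "(of_int l1 :: gauss) \<noteq> 0" using rs by (simp add: ratio_structure_def)
      ultimately have y10: "y1 \<noteq> 0" "e1 \<noteq> 0" by auto
      have p1: "p1 = - (y2 * p2 + y3 * p3) div y1" using rel y10 by (metis nonzero_mult_div_cancel_left)
      have "y1 dvd - (y2 * p2 + y3 * p3)" by (metis rel dvd_triv_left)
      then have "y1 dvd y2 * p2 + y3 * p3" by (simp only: dvd_minus_iff)
      then have "(p2, p3) \<in> PS (M / gmod e1) K y1 y2 y3"
        using rs b y10 by (auto simp: PS_def ratio_structure_def gmod_mult field_simps)
      moreover have "x = g y1 y2 y3 e1 e2 e3 (p2, p3)" by (simp only: g_def x prod.case Let_def p1[symmetric])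
      ultimately have "x \<in> A l1 l2 (e1, e2, e3)" unfolding A_def y1_def y2_def y3_def by auto
      with l1 l2 e show "x \<in> (\<Union>l1\<in>I1. \<Union>l2\<in>I2 l1. \<Union>e\<in>Dv l1 l2. A l1 l2 e)" by blast
    qed
    define D where "D = C1 * (3 * L) powr \<theta>"
    have D0: "D \<ge> 0" using C1 by (simp add: D_def)
    define F where "F x = D ^ 3 * (C2 * K powr \<theta> * (M\<^sup>2 / x\<^sup>2 + K\<^sup>2))" for x :: real
    have F0: "F x \<ge> 0" for x using D0 C2(1) by (simp add: F_def)
    have cA: "finite (A l1 l2 e)" "real (card (A l1 l2 e)) \<le> C2 * K powr \<theta> * (M\<^sup>2 / \<bar>of_int l1\<bar>\<^sup>2 + K\<^sup>2)"
      if l1: "l1 \<in> I1" and l2: "l2 \<in> I2 l1" and e: "e \<in> Dv l1 l2" for l1 l2 e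
    proof -
      obtain e1 e2 e3 where ee: "e = (e1, e2, e3)" by (cases e)
      define y1 y2 y3 where "y1 = of_int l1 div e1" and "y2 = of_int l2 div e2" and "y3 = of_int (- l1 - l2) div e3"
      have dv: "e1 dvd of_int l1" "e2 dvd of_int l2" "e3 dvd of_int (- l1 - l2)" using e by (auto simp: ee Dv_def divisors_def)
      have ly: "of_int l1 = e1 * y1" "of_int l2 = e2 * y2" "of_int (- l1 - l2) = e3 * y3"
        using dv by (simp_all add: y1_def y2_def y3_def del: of_int_diff of_int_minus)
      have yd: "y1 dvd of_int l1" "y2 dvd of_int l2" "y3 dvd of_int (- l1 - l2)"
        unfolding ly by simp_all
      have cop: "coprime y1 y2" "coprime y1 y3"
        using coprime_divisors[OF yd(1,2) coprime_of_int_gauss] coprime_divisors[OF yd(1,3) coprime_of_int_gauss] l2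
        by (auto simp: I2_def)
      have l10: "(of_int l1 :: gauss) \<noteq> 0" using l1 by (simp add: I1_def)
      then have y10: "y1 \<noteq> 0" "e1 \<noteq> 0" using ly(1) by auto
      have gl: "\<bar>of_int l1\<bar> = gmod e1 * gmod y1" using arg_cong[OF ly(1), of gmod] by (simp add: gmod_mult)
      have Ae: "A l1 l2 e = g y1 y2 y3 e1 e2 e3 ` PS (M / gmod e1) K y1 y2 y3"
        by (simp add: A_def ee y1_def y2_def y3_def)
      show "finite (A l1 l2 e)" unfolding Ae using finPS by simp
      have "card (A l1 l2 e) \<le> card (PS (M / gmod e1) K y1 y2 y3)"
        unfolding Ae using finPS by (rule card_image_le)
      then have "real (card (A l1 l2 e)) \<le> real (card (PS (M / gmod e1) K y1 y2 y3))" by simp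
      also have "\<dots> \<le> C2 * K powr \<theta> * ((M / gmod e1)\<^sup>2 / (gmod y1)\<^sup>2 + K\<^sup>2)"
        using * y10 cop by (intro C2) auto
      also have "(M / gmod e1)\<^sup>2 / (gmod y1)\<^sup>2 = M\<^sup>2 / \<bar>of_int l1\<bar>\<^sup>2"
        unfolding gl by (simp add: power_divide power_mult_distrib)
      finally show "real (card (A l1 l2 e)) \<le> C2 * K powr \<theta> * (M\<^sup>2 / \<bar>of_int l1\<bar>\<^sup>2 + K\<^sup>2)" .
    qed
    have cDv: "finite (Dv l1 l2)" "real (card (Dv l1 l2)) \<le> D ^ 3" if l1: "l1 \<in> I1" and l2: "l2 \<in> I2 l1" for l1 l2
    proof -
      have nz: "l1 \<noteq> 0" "l2 \<noteq> 0" "- l1 - l2 \<noteq> 0" using l1 l2 by (auto simp: I1_def I2_def)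
      have d: "real (card (divisors (of_int l))) \<le> D" if "l \<noteq> 0" "\<bar>of_int l\<bar> \<le> 3 * L" for l
      proof -
        have "real (card (divisors (of_int l))) \<le> C1 * gmod (of_int l) powr \<theta>" using that by (intro C1) simp
        also have "\<dots> \<le> D" unfolding D_def using C1 \<theta> that by (intro mult_left_mono powr_mono2) auto
        finally show ?thesis .
      qed
      have L1: "\<bar>of_int l1\<bar> \<le> L" using l1 by (simp add: I1_def)
      have "\<bar>of_int l2\<bar> \<le> 2 * \<bar>of_int l1 :: real\<bar>" using l2 by (simp add: I2_def) linarith
      then have L2: "\<bar>of_int l2\<bar> \<le> 2 * L" using L1 by linarith
      have L3: "\<bar>of_int (- l1 - l2)\<bar> \<le> 3 * L" using L1 L2 by simp
      have b: "real (card (divisors (of_int l1))) \<le> D" "real (card (divisors (of_int l2))) \<le> D"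
        "real (card (divisors (of_int (- l1 - l2)))) \<le> D"
        using nz L1 L2 L3 * by (intro d; linarith)+
      have "real (card (Dv l1 l2)) = real (card (divisors (of_int l1))) * (real (card (divisors (of_int l2)))
          * real (card (divisors (of_int (- l1 - l2)))))"
        unfolding Dv_def by (simp only: card_cartesian_product of_nat_mult)
      also have "\<dots> \<le> D * (D * D)" using b D0 by (intro mult_mono mult_nonneg_nonneg) auto
      finally show "real (card (Dv l1 l2)) \<le> D ^ 3" by (simp add: power3_eq_cube)
      have "(of_int l1 :: gauss) \<noteq> 0" "(of_int l2 :: gauss) \<noteq> 0" "(of_int (- l1 - l2) :: gauss) \<noteq> 0"
        using nz by (simp_all only: of_int_eq_0_iff not_False_eq_True)
      then show "finite (Dv l1 l2)" unfolding Dv_def by (intro finite_cartesian_product finite_divisors)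
    qed
    have c2: "real (card (\<Union>e\<in>Dv l1 l2. A l1 l2 e)) \<le> F \<bar>of_int l1\<bar>" if l1: "l1 \<in> I1" and l2: "l2 \<in> I2 l1" for l1 l2
    proof -
      have "real (card (\<Union>e\<in>Dv l1 l2. A l1 l2 e)) \<le> (\<Sum>e\<in>Dv l1 l2. C2 * K powr \<theta> * (M\<^sup>2 / \<bar>of_int l1\<bar>\<^sup>2 + K\<^sup>2))"
        using cDv[OF l1 l2] cA[OF l1 l2] by (intro card_UN_bound)
      also have "\<dots> = real (card (Dv l1 l2)) * (C2 * K powr \<theta> * (M\<^sup>2 / \<bar>of_int l1\<bar>\<^sup>2 + K\<^sup>2))" by simp
      also have "\<dots> \<le> F \<bar>of_int l1\<bar>" unfolding F_def
        using cDv(2)[OF l1 l2] C2(1) by (intro mult_right_mono) auto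
      finally show ?thesis .
    qed
    have fI1: "finite I1"
      using card_int_abs_le(1)[of L] * by (rule_tac finite_subset[of _ "{l. \<bar>of_int l\<bar> \<le> L}"]) (auto simp: I1_def)
    have fI2: "finite (I2 l1)" "real (card (I2 l1)) \<le> 4 * \<bar>of_int l1\<bar>" for l1
    proof -
      have s: "I2 l1 \<subseteq> {- 2 * \<bar>l1\<bar>..2 * \<bar>l1\<bar>} - {0}" by (auto simp: I2_def)
      then show "finite (I2 l1)" by (rule finite_subset) auto
      have "card (I2 l1) \<le> card ({- 2 * \<bar>l1\<bar>..2 * \<bar>l1\<bar>} - {0})" using s by (intro card_mono) auto
      also have "\<dots> = nat (4 * \<bar>l1\<bar>)" by simp
      finally show "real (card (I2 l1)) \<le> 4 * \<bar>of_int l1\<bar>" by linarith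
    qed
    have fin: "finite (\<Union>l1\<in>I1. \<Union>l2\<in>I2 l1. \<Union>e\<in>Dv l1 l2. A l1 l2 e)"
      using fI1 fI2(1) cDv(1) cA(1) by (intro finite_UN_I) auto
    have "real (card (ratio_triples M K L)) \<le> real (card (\<Union>l1\<in>I1. \<Union>l2\<in>I2 l1. \<Union>e\<in>Dv l1 l2. A l1 l2 e))"
      using fin sub by (intro of_nat_mono card_mono)
    also have "\<dots> \<le> (\<Sum>l1\<in>I1. 4 * \<bar>of_int l1\<bar> * F \<bar>of_int l1\<bar>)"
    proof (intro card_UN_bound fI1)
      fix l1 assume l1: "l1 \<in> I1"
      have "real (card (\<Union>l2\<in>I2 l1. \<Union>e\<in>Dv l1 l2. A l1 l2 e)) \<le> (\<Sum>l2\<in>I2 l1. F \<bar>of_int l1\<bar>)"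
        using fI2(1) c2[OF l1] by (intro card_UN_bound)
      also have "\<dots> = real (card (I2 l1)) * F \<bar>of_int l1\<bar>" by simp
      also have "\<dots> \<le> 4 * \<bar>of_int l1\<bar> * F \<bar>of_int l1\<bar>" using fI2(2) F0 by (intro mult_right_mono)
      finally show "real (card (\<Union>l2\<in>I2 l1. \<Union>e\<in>Dv l1 l2. A l1 l2 e)) \<le> 4 * \<bar>of_int l1\<bar> * F \<bar>of_int l1\<bar>" .
    qed
    also have "\<dots> = 2 * (\<Sum>m=1..nat \<lfloor>L\<rfloor>. 4 * real m * F (real m))"
      unfolding I1_def using * by (intro sum_nonzero_ints) auto
    also have "\<dots> = D ^ 3 * C2 * K powr \<theta> * (8 * M\<^sup>2 * (\<Sum>m=1..nat \<lfloor>L\<rfloor>. 1 / real m) + 8 * K\<^sup>2 * (\<Sum>m=1..nat \<lfloor>L\<rfloor>. real m))"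
    proof -
      have "4 * real m * F (real m) = D ^ 3 * C2 * K powr \<theta> * (4 * M\<^sup>2 * (1 / real m) + 4 * K\<^sup>2 * real m)"
        if "m \<in> {1..nat \<lfloor>L\<rfloor>}" for m
        using that by (simp add: F_def power2_eq_square field_simps)
      then have "(\<Sum>m=1..nat \<lfloor>L\<rfloor>. 4 * real m * F (real m)) =
         (\<Sum>m=1..nat \<lfloor>L\<rfloor>. D ^ 3 * C2 * K powr \<theta> * (4 * M\<^sup>2 * (1 / real m) + 4 * K\<^sup>2 * real m))"
        by (intro sum.cong refl)
      then show ?thesis by (simp add: sum.distrib sum_distrib_left mult_ac distrib_left)
    qed
    also have "\<dots> \<le> D ^ 3 * C2 * K powr \<theta> * (8 * M\<^sup>2 * (C3 * L powr \<theta>) + 8 * K\<^sup>2 * L\<^sup>2)"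
    proof (intro mult_left_mono add_mono)
      show "(\<Sum>m=1..nat \<lfloor>L\<rfloor>. 1 / real m) \<le> C3 * L powr \<theta>" using C3(2) * by simp
      have "(\<Sum>m=1..nat \<lfloor>L\<rfloor>. real m) \<le> (\<Sum>m=1..nat \<lfloor>L\<rfloor>. L)"
        using * by (intro sum_mono) (auto simp: le_nat_iff le_floor_iff)
      also have "\<dots> \<le> L * L" using * by (simp add: mult_right_mono)
      finally show "(\<Sum>m=1..nat \<lfloor>L\<rfloor>. real m) \<le> L\<^sup>2" by (simp add: power2_eq_square)
    qed (use C2(1) D0 in auto)
    also have "\<dots> \<le> D ^ 3 * C2 * X powr \<theta> * ((8 * C3 + 8) * X powr \<theta> * (M\<^sup>2 + L\<^sup>2 * K\<^sup>2))"
    proof (intro mult_mono mult_nonneg_nonneg)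
      show "K powr \<theta> \<le> X powr \<theta>" using * \<theta> by (intro powr_mono2) auto
      have LX: "L powr \<theta> \<le> X powr \<theta>" using * \<theta> by (intro powr_mono2) auto
      have X1: "1 \<le> X powr \<theta>" using * \<theta> by (intro ge_one_powr_ge_zero) auto
      have a: "8 * M\<^sup>2 * (C3 * L powr \<theta>) \<le> 8 * C3 * X powr \<theta> * M\<^sup>2"
        using mult_left_mono[OF LX, of "8 * M\<^sup>2 * C3"] C3(1) by (simp add: mult_ac)
      have b: "8 * K\<^sup>2 * L\<^sup>2 \<le> 8 * X powr \<theta> * (L\<^sup>2 * K\<^sup>2)"
        using mult_right_mono[OF X1, of "8 * (L\<^sup>2 * K\<^sup>2)"] by (simp add: mult_ac)
      have c: "0 \<le> 8 * X powr \<theta> * M\<^sup>2" "0 \<le> 8 * C3 * X powr \<theta> * (L\<^sup>2 * K\<^sup>2)" using C3(1) by auto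
      have "(8 * C3 + 8) * X powr \<theta> * (M\<^sup>2 + L\<^sup>2 * K\<^sup>2) = 8 * C3 * X powr \<theta> * M\<^sup>2 + 8 * X powr \<theta> * (L\<^sup>2 * K\<^sup>2)
         + 8 * X powr \<theta> * M\<^sup>2 + 8 * C3 * X powr \<theta> * (L\<^sup>2 * K\<^sup>2)" by (simp add: algebra_simps)
      with a b c show "8 * M\<^sup>2 * (C3 * L powr \<theta>) + 8 * K\<^sup>2 * L\<^sup>2 \<le> (8 * C3 + 8) * X powr \<theta> * (M\<^sup>2 + L\<^sup>2 * K\<^sup>2)"
        by linarith
    qed (use C2(1) C3(1) D0 in auto)
    also have "\<dots> \<le> (C1 * 3 powr \<theta> * X powr \<theta>) ^ 3 * C2 * X powr \<theta> * ((8 * C3 + 8) * X powr \<theta> * (M\<^sup>2 + L\<^sup>2 * K\<^sup>2))"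
    proof (intro mult_right_mono power_mono)
      have "D \<le> C1 * (3 * X) powr \<theta>" unfolding D_def using * \<theta> C1 by (intro mult_left_mono powr_mono2) auto
      then show "D \<le> C1 * 3 powr \<theta> * X powr \<theta>" using * by (simp add: powr_mult)
    qed (use C2(1) C3(1) D0 in auto)
    also have "\<dots> = C * (X powr \<theta>) ^ 5 * (M\<^sup>2 + L\<^sup>2 * K\<^sup>2)"
      unfolding C_def by (simp add: power_mult_distrib mult_ac eval_nat_numeral)
    also have "(X powr \<theta>) ^ 5 = X powr \<eta>" using * by (simp add: \<theta>_def powr_powr flip: powr_realpow)
    finally show ?thesis using finite_subset[OF sub fin] by simp
  qed
  moreover have "C > 0" using C1 C2 C3 by (simp add: C_def)
  ultimately show ?thesis by blast
qed

text \<open>When all \<open>e\<^sub>i\<close> are small, fix them and \<open>p\<^sub>1, p\<^sub>2\<close>: then the circle condition confines \<open>p\<^sub>3\<close> to a line.\<close>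

definition line_triples :: "real \<Rightarrow> real \<Rightarrow> (gauss \<times> gauss \<times> gauss) set" where
  "line_triples R E = {(z1, z2, z3). \<exists>p1 p2 p3 e1 e2 e3 W c. z1 = p2 * p3 * e1 \<and> z2 = p1 * p3 * e2 \<and> z3 = p1 * p2 * e3 \<and>
     gmod p1 \<le> R \<and> gmod p2 \<le> R \<and> gmod p3 \<le> R \<and> gmod e1 \<le> E \<and> gmod e2 \<le> E \<and> gmod e3 \<le> E \<and>
     W = e1 * e2 * gcnj (p1 * e2 * e3 - p2 * e1 * e3) \<and> c = p2 * e1 * e3 * gcnj (p1 * e2 * e3 - p2 * e1 * e3) \<and>
     W \<noteq> 0 \<and> gim W * gre p3 + gre W * gim p3 = gim c}"

text \<open>There are \<open>O(E\<^sup>2)\<close> choices for each \<open>e\<close> and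
  \<open>O(R\<^sup>2)\<close> each for \<open>p1\<close> and \<open>p2\<close>, but only
  \<open>O(R)\<close> for \<open>p3\<close>, since \<open>W \<noteq> 0\<close> makes its equation a
  genuine line; this lost factor \<open>R\<close> is the gain over the trivial count.\<close>

lemma card_line_triples:
  assumes "R \<ge> 1" "E \<ge> 1"
  shows "finite (line_triples R E)" "real (card (line_triples R E)) \<le> 3 ^ 11 * E ^ 6 * R ^ 5"
proof -
  define I where "I = disc E \<times> disc E \<times> disc E \<times> disc R \<times> disc R"
  define F where "F = (\<lambda>(e1, e2, e3, p1, p2).
    let D = gcnj (p1 * e2 * e3 - p2 * e1 * e3); W = e1 * e2 * D; c = p2 * e1 * e3 * D in
    if W = 0 then {} else (\<lambda>p3. (p2 * p3 * e1, p1 * p3 * e2, p1 * p2 * e3)) `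
      {p3 \<in> disc R. gim W * gre p3 + gre W * gim p3 = gim c})"
  have fI: "finite I" by (simp add: I_def)
  have F: "finite (F x)" "real (card (F x)) \<le> 3 * R" for x
  proof -
    obtain e1 e2 e3 p1 p2 where x: "x = (e1, e2, e3, p1, p2)" by (cases x)
    define D where "D = gcnj (p1 * e2 * e3 - p2 * e1 * e3)"
    define W where "W = e1 * e2 * D"
    define c where "c = p2 * e1 * e3 * D"
    define G where "G = {p3 \<in> disc R. gim W * gre p3 + gre W * gim p3 = gim c}"
    have Fx: "F x = (if W = 0 then {} else (\<lambda>p3. (p2 * p3 * e1, p1 * p3 * e2, p1 * p2 * e3)) ` G)"
      unfolding x F_def prod.case Let_def D_def[symmetric] W_def[symmetric] c_def[symmetric] G_def ..
    have fG: "finite G" by (simp add: G_def)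
    show "finite (F x)" using fG by (simp add: Fx)
    show "real (card (F x)) \<le> 3 * R"
    proof (cases "W = 0")
      case False
      then have "(gim W, gre W) \<noteq> (0, 0)" by (auto simp: gauss_eq_iff)
      then have "real (card G) \<le> 2 * R + 1" unfolding G_def using assms by (intro card_disc_line) auto
      moreover have "card (F x) \<le> card G" using False fG by (simp add: Fx card_image_le)
      ultimately show ?thesis using assms by linarith
    qed (use assms in \<open>simp add: Fx\<close>)
  qed
  have sub: "line_triples R E \<subseteq> (\<Union>x\<in>I. F x)"
  proof
    fix x assume "x \<in> line_triples R E"
    then obtain p1 p2 p3 e1 e2 e3 W c where h: "x = (p2 * p3 * e1, p1 * p3 * e2, p1 * p2 * e3)"
     "gmod p1 \<le> R" "gmod p2 \<le> R" "gmod p3 \<le> R" "gmod e1 \<le> E" "gmod e2 \<le> E" "gmod e3 \<le> E"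
     "W = e1 * e2 * gcnj (p1 * e2 * e3 - p2 * e1 * e3)" "c = p2 * e1 * e3 * gcnj (p1 * e2 * e3 - p2 * e1 * e3)"
     "W \<noteq> 0" "gim W * gre p3 + gre W * gim p3 = gim c" unfolding line_triples_def by blast
    have "x \<in> F (e1, e2, e3, p1, p2)"
      unfolding F_def prod.case Let_def h(8,9)[symmetric] using h by (auto simp: disc_def simp del: gauss_sel)
    moreover have "(e1, e2, e3, p1, p2) \<in> I" using h by (simp add: I_def disc_def)
    ultimately show "x \<in> (\<Union>x\<in>I. F x)" by blast
  qed
  have fin: "finite (\<Union>x\<in>I. F x)" using fI F by blast
  show "finite (line_triples R E)" using sub fin by (rule finite_subset)
  have dE: "real (card (disc E)) \<le> 9 * E\<^sup>2" "real (card (disc R)) \<le> 9 * R\<^sup>2" using assms by (simp_all add: card_disc')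
  have "real (card I) = real (card (disc E)) * (real (card (disc E)) * (real (card (disc E)) * (real (card (disc R)) * real (card (disc R)))))"
    by (simp add: I_def card_cartesian_product)
  also have "\<dots> \<le> (9 * E\<^sup>2) * ((9 * E\<^sup>2) * ((9 * E\<^sup>2) * ((9 * R\<^sup>2) * (9 * R\<^sup>2))))"
    by (intro mult_mono dE mult_nonneg_nonneg) auto
  finally have cI: "real (card I) \<le> 3 ^ 10 * E ^ 6 * R ^ 4" by (simp add: eval_nat_numeral)
  have "real (card (line_triples R E)) \<le> real (card (\<Union>x\<in>I. F x))"
    using sub fin by (intro of_nat_mono card_mono)
  also have "\<dots> \<le> (\<Sum>x\<in>I. 3 * R)" using fI F by (intro card_UN_bound)
  also have "\<dots> = real (card I) * (3 * R)" by simp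
  also have "\<dots> \<le> 3 ^ 10 * E ^ 6 * R ^ 4 * (3 * R)" using cI assms by (intro mult_right_mono) auto
  finally show "real (card (line_triples R E)) \<le> 3 ^ 11 * E ^ 6 * R ^ 5" by (simp add: eval_nat_numeral)
qed

section \<open>Combining the ranges of \<open>P\<close> and of the common divisors\<close>

definition nd_triples :: "real \<Rightarrow> real \<Rightarrow> (gauss \<times> gauss \<times> gauss) set" where
  "nd_triples r N = {(z1, z2, z3). gmod z1 \<le> r \<and> gmod z2 \<le> r \<and> gmod z3 \<le> N \<and>
     cocircular z1 z2 z3 \<and> nondegenerate z1 z2 z3}"

definition nd_coprime_triples :: "real \<Rightarrow> real \<Rightarrow> (gauss \<times> gauss \<times> gauss) set" where
  "nd_coprime_triples r N = {(z1, z2, z3) \<in> nd_triples r N. gcd z1 (gcd z2 z3) = 1}"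

lemma finite_nd_triples [simp]: "finite (nd_triples r N)" "finite (nd_coprime_triples r N)"
proof -
  have "nd_triples r N \<subseteq> disc r \<times> disc r \<times> disc N" by (auto simp: nd_triples_def disc_def)
  then show "finite (nd_triples r N)" by (rule finite_subset) auto
  then show "finite (nd_coprime_triples r N)" by (rule rev_finite_subset) (auto simp: nd_coprime_triples_def)
qed

lemma finite_small_ratio_triples [simp]: "finite (small_ratio_triples r N B)"
proof -
  have "small_ratio_triples r N B \<subseteq> disc r \<times> disc r \<times> disc N" by (auto simp: small_ratio_triples_def disc_def)
  then show ?thesis by (rule finite_subset) auto
qed

text \<open>Each \<open>l * P\<close> is a product of a \<open>z\<close> and a difference and has
  modulus at most \<open>2 * r * N\<close>; hence \<open>gmod P > B\<close> forces all three
  multipliers to be at most \<open>2 * r * N / B\<close>.\<close>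

lemma nd_coprime_cases:
  assumes x: "(z1, z2, z3) \<in> nd_coprime_triples r N" and r: "1 \<le> r" "r \<le> N" and B: "B > 0"
    and L: "L = 2 * r * N / B"
  shows "(z1, z2, z3) \<in> small_ratio_triples r N B \<or>
    (\<exists>l1 l2 l3 p1 p2 p3 e1 e2 e3. ratio_structure l1 l2 l3 p1 p2 p3 e1 e2 e3 \<and>
      z1 = p2 * p3 * e1 \<and> z2 = p1 * p3 * e2 \<and> z3 = p1 * p2 * e3 \<and>
      \<bar>of_int l1\<bar> \<le> L \<and> \<bar>of_int l2\<bar> \<le> L \<and> \<bar>of_int l3\<bar> \<le> L \<and> z1 \<noteq> z2 \<and>
      gmod z1 \<le> r \<and> gmod z2 \<le> r \<and> gmod z3 \<le> N)"
proof -
  have b: "gmod z1 \<le> r" "gmod z2 \<le> r" "gmod z3 \<le> N" and cc: "cocircular z1 z2 z3"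
    and nd: "nondegenerate z1 z2 z3" and g: "gcd z1 (gcd z2 z3) = 1"
    using x by (auto simp: nd_coprime_triples_def nd_triples_def)
  have z0: "z1 \<noteq> 0" "z2 \<noteq> 0" "z3 \<noteq> 0" "z1 \<noteq> z2" using cc by (auto simp: cocircular_def)
  obtain P l1 l2 l3 where P: "P \<noteq> 0" and l: "l1 \<noteq> 0" "l2 \<noteq> 0" "l3 \<noteq> 0" "coprime l1 l2" "l1 + l2 + l3 = 0"
    and eq: "z1 * (z3 - z2) = of_int l1 * P" "z2 * (z1 - z3) = of_int l2 * P" "z3 * (z2 - z1) = of_int l3 * P"
    using cocircular_ratio[OF cc] .
  show ?thesis
  proof (cases "gmod P \<le> B")
    case True
    then have "(z1, z2, z3) \<in> small_ratio_triples r N B"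
      using b nd P l eq z0 unfolding small_ratio_triples_def by blast
    then show ?thesis ..
  next
    case False
    have "P * (of_int l1 * z2 * z3 + of_int l2 * z1 * z3 + of_int l3 * z1 * z2)
      = (of_int l1 * P) * z2 * z3 + (of_int l2 * P) * z1 * z3 + (of_int l3 * P) * z1 * z2"
      by (simp add: algebra_simps)
    also have "\<dots> = 0" unfolding eq[symmetric] by (simp add: algebra_simps)
    finally have eq0: "of_int l1 * z2 * z3 + of_int l2 * z1 * z3 + of_int l3 * z1 * z2 = 0" using P by simp
    obtain p1 p2 p3 e1 e2 e3 where rs: "ratio_structure l1 l2 l3 p1 p2 p3 e1 e2 e3"
      "z1 = p2 * p3 * e1" "z2 = p1 * p3 * e2" "z3 = p1 * p2 * e3"
      using ratio_structure_exists[OF z0(1-3) g l eq0] .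
    have lb: "\<bar>of_int l\<bar> \<le> L" if "z * w = of_int l * P" "gmod z * gmod w \<le> 2 * r * N" for l z w
    proof -
      have "\<bar>of_int l\<bar> * B \<le> \<bar>of_int l\<bar> * gmod P" using False by (intro mult_left_mono) auto
      also have "\<dots> = gmod z * gmod w" using arg_cong[OF that(1), of gmod] by (simp add: gmod_mult)
      also have "\<dots> \<le> 2 * r * N" by (rule that)
      finally show ?thesis using B by (simp add: L field_simps)
    qed
    have d: "gmod (z3 - z2) \<le> 2 * N" "gmod (z1 - z3) \<le> 2 * N" "gmod (z2 - z1) \<le> 2 * r"
      using gmod_diff_le[of z3 z2] gmod_diff_le[of z1 z3] gmod_diff_le[of z2 z1] b r by linarith+
    have m: "gmod z1 * gmod (z3 - z2) \<le> r * (2 * N)" "gmod z2 * gmod (z1 - z3) \<le> r * (2 * N)"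
      "gmod z3 * gmod (z2 - z1) \<le> N * (2 * r)"
      using b d r by (intro mult_mono; simp)+
    have "\<bar>of_int l1\<bar> \<le> L" "\<bar>of_int l2\<bar> \<le> L" "\<bar>of_int l3\<bar> \<le> L"
      using lb[OF eq(1)] lb[OF eq(2)] lb[OF eq(3)] m by (simp_all add: mult_ac)
    then show ?thesis using rs z0 b by blast
  qed
qed

text \<open>Up to a common factor, \<open>U1\<close>, \<open>U2\<close>, \<open>U3\<close> are the
  inverses of \<open>z1\<close>, \<open>z2\<close>, \<open>z3\<close>, and inversion turns a circle
  through \<open>0\<close> into a line: since the multipliers sum to zero, the relation makes the
  three \<open>U\<close> collinear. For given \<open>U1 \<noteq> U2\<close> this is a linear
  equation for \<open>p3\<close>. The sizes come from \<open>gmod (p * q * e) \<le> N\<close> with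
  \<open>p\<close> and \<open>q\<close> above \<open>K\<close>.\<close>

lemma line_triplesI:
  assumes rs: "ratio_structure l1 l2 l3 p1 p2 p3 e1 e2 e3"
    and z: "z1 = p2 * p3 * e1" "z2 = p1 * p3 * e2" "z3 = p1 * p2 * e3" "z1 \<noteq> z2"
    and b: "gmod z1 \<le> N" "gmod z2 \<le> N" "gmod z3 \<le> N"
    and K: "K > 0" "gmod p1 > K" "gmod p2 > K" "gmod p3 > K"
  shows "(z1, z2, z3) \<in> line_triples (N / K) (N / K\<^sup>2)"
proof -
  have nz: "of_int l1 \<noteq> (0::gauss)" "of_int l2 \<noteq> (0::gauss)" "of_int l3 \<noteq> (0::gauss)" using rs by (auto simp: ratio_structure_def)
  then have e0: "e1 \<noteq> 0" "e2 \<noteq> 0" "e3 \<noteq> 0" using rs by (auto simp: ratio_structure_def)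
  have p0: "p1 \<noteq> 0" "p2 \<noteq> 0" "p3 \<noteq> 0" using rs by (auto simp: ratio_structure_def)
  have bound: "gmod e \<le> N / K\<^sup>2" "gmod p \<le> N / K" if "gmod (p * q * e) \<le> N" "gmod p > K" "gmod q > K" "e \<noteq> 0" for p q e
  proof -
    have e1: "gmod e \<ge> 1" using that(4) by (rule gmod_ge_1)
    have "K * K * gmod e \<le> gmod p * gmod q * gmod e"
      using that K by (intro mult_mono mult_nonneg_nonneg) auto
    then have "K * K * gmod e \<le> N" using that(1) by (simp add: gmod_mult)
    then show "gmod e \<le> N / K\<^sup>2" using K(1) by (simp add: field_simps power2_eq_square)
    have "gmod p * K * 1 \<le> gmod p * gmod q * gmod e"
      using that K e1 by (intro mult_mono mult_nonneg_nonneg) auto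
    then have "gmod p * K \<le> N" using that(1) by (simp add: gmod_mult)
    then show "gmod p \<le> N / K" using K(1) by (simp add: field_simps)
  qed
  have be: "gmod e1 \<le> N / K\<^sup>2" "gmod e2 \<le> N / K\<^sup>2" "gmod e3 \<le> N / K\<^sup>2"
    using bound(1)[of p2 p3 e1] bound(1)[of p1 p3 e2] bound(1)[of p1 p2 e3] b K e0 unfolding z by auto
  have bp: "gmod p1 \<le> N / K" "gmod p2 \<le> N / K" "gmod p3 \<le> N / K"
    using bound(2)[of p1 p3 e2] bound(2)[of p2 p3 e1] bound(2)[of p3 p2 e1] b K e0 unfolding z by (auto simp: mult_ac)
  define U1 U2 U3 where "U1 = p1 * e2 * e3" and "U2 = p2 * e1 * e3" and "U3 = p3 * e1 * e2"
  have "p1 * e2 \<noteq> p2 * e1" using z by (auto simp: mult_ac)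
  then have D: "U1 - U2 \<noteq> 0" using e0(3) by (simp add: U1_def U2_def)
  have l3: "l3 = - l1 - l2" using rs by (simp add: ratio_structure_def)
  have "of_int l1 * U1 + of_int l2 * U2 + of_int l3 * U3 = 0"
    using rs by (simp add: ratio_structure_def U1_def U2_def U3_def mult_ac)
  then have "of_int (- l3) * (U3 - U2) = of_int l1 * (U1 - U2)" unfolding l3 by (simp add: algebra_simps add_eq_0_iff)
  then have "of_int (- l3) * ((U3 - U2) * gcnj (U1 - U2)) = of_int l1 * ((U1 - U2) * gcnj (U1 - U2))"
    by (simp only: mult.assoc[symmetric])
  also have "\<dots> = of_int (l1 * gnorm (U1 - U2))" by (simp only: mult_gcnj of_int_mult)
  finally have "gim (of_int (- l3) * ((U3 - U2) * gcnj (U1 - U2))) = 0" by (simp only: gauss_of_int)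
  moreover have "gim (of_int k * z) = k * gim z" for k z by simp
  ultimately have "- l3 * gim ((U3 - U2) * gcnj (U1 - U2)) = 0" by metis
  then have "gim ((U3 - U2) * gcnj (U1 - U2)) = 0" using rs by (simp add: ratio_structure_def)
  then have eq: "gim (U3 * gcnj (U1 - U2)) = gim (U2 * gcnj (U1 - U2))"
    by (simp only: left_diff_distrib gauss_sel)
  define W where "W = e1 * e2 * gcnj (U1 - U2)"
  have "U3 * gcnj (U1 - U2) = p3 * W" by (simp only: W_def U3_def mult_ac)
  moreover have "gim (p3 * W) = gim W * gre p3 + gre W * gim p3" by simp
  ultimately have lin: "gim W * gre p3 + gre W * gim p3 = gim (U2 * gcnj (U1 - U2))" using eq by metis
  have "W \<noteq> 0" using D e0 by (simp add: W_def del: gcnj_simps)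
  then show ?thesis
    unfolding line_triples_def using z be bp lin W_def unfolding U1_def U2_def by blast
qed

definition swap12 :: "'a \<times> 'a \<times> 'a \<Rightarrow> 'a \<times> 'a \<times> 'a" where "swap12 = (\<lambda>(a, b, c). (b, a, c))"
definition swap13 :: "'a \<times> 'a \<times> 'a \<Rightarrow> 'a \<times> 'a \<times> 'a" where "swap13 = (\<lambda>(a, b, c). (c, b, a))"

text \<open>As \<open>gmod p2 * gmod p3 \<le> gmod z1 \<le> r\<close>, the smaller of the two is
  automatically at most \<open>sqrt r\<close>, and likewise for \<open>z2\<close>. Only
  \<open>z1\<close> and \<open>z2\<close> take the leading role, which keeps the size at
  \<open>r\<close> rather than \<open>N\<close>; one of \<open>l1\<close>, \<open>l2\<close> is
  always at most twice the other.\<close>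

lemma nd_coprime_subset_unbalanced:
  assumes r: "1 \<le> r" "r \<le> N" and B: "B > 0" and L: "L = 2 * r * N / B"
  shows "nd_coprime_triples r N \<subseteq> small_ratio_triples r N B \<union>
    (ratio_triples r (sqrt r) L \<union> swap12 ` ratio_triples r (sqrt r) L)"
proof
  fix x assume x: "x \<in> nd_coprime_triples r N"
  obtain z1 z2 z3 where xz: "x = (z1, z2, z3)" by (cases x)
  show "x \<in> small_ratio_triples r N B \<union> (ratio_triples r (sqrt r) L \<union> swap12 ` ratio_triples r (sqrt r) L)"
    using nd_coprime_cases[OF x[unfolded xz] r B L]
  proof (elim disjE exE conjE)
    fix l1 l2 l3 p1 p2 p3 e1 e2 e3
    assume rs: "ratio_structure l1 l2 l3 p1 p2 p3 e1 e2 e3" and z: "z1 = p2 * p3 * e1" "z2 = p1 * p3 * e2" "z3 = p1 * p2 * e3"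
      and l: "\<bar>of_int l1\<bar> \<le> L" "\<bar>of_int l2\<bar> \<le> L" "\<bar>of_int l3\<bar> \<le> L"
      and b: "gmod z1 \<le> r" "gmod z2 \<le> r"
    have nz: "of_int l1 \<noteq> (0::gauss)" "of_int l2 \<noteq> (0::gauss)" using rs by (auto simp: ratio_structure_def)
    then have e0: "e1 \<noteq> 0" "e2 \<noteq> 0" using rs by (auto simp: ratio_structure_def)
    have mn: "min (gmod p) (gmod q) \<le> sqrt r" if "gmod (p * q * e) \<le> r" "e \<noteq> 0" for p q e
    proof -
      have "(min (gmod p) (gmod q))\<^sup>2 \<le> gmod p * gmod q * 1"
        unfolding power2_eq_square mult_1_right by (intro mult_mono) auto
      also have "\<dots> \<le> gmod p * gmod q * gmod e"
        using gmod_ge_1[OF that(2)] by (intro mult_left_mono) auto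
      finally have "(min (gmod p) (gmod q))\<^sup>2 \<le> r" using that by (simp add: gmod_mult)
      then show ?thesis by (rule real_le_rsqrt)
    qed
    have "(z1, z2, z3) \<in> ratio_triples r (sqrt r) L" if "\<bar>l2\<bar> \<le> 2 * \<bar>l1\<bar>"
      using rs z l b mn[of p2 p3 e1] e0 that unfolding ratio_triples_def by blast
    moreover have "(z2, z1, z3) \<in> ratio_triples r (sqrt r) L" if "\<bar>l1\<bar> \<le> 2 * \<bar>l2\<bar>"
    proof -
      have "z3 = p2 * p1 * e3" using z by simp
      then show ?thesis
        using ratio_structure_swap12[OF rs] z l b mn[of p1 p3 e2] e0 that unfolding ratio_triples_def by blast
    qed
    moreover have "\<bar>l2\<bar> \<le> 2 * \<bar>l1\<bar> \<or> \<bar>l1\<bar> \<le> 2 * \<bar>l2\<bar>" by linarith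
    ultimately show ?thesis by (force simp: xz swap12_def)
  qed (simp add: xz)
qed

text \<open>When \<open>r\<close> is close to \<open>N\<close>, \<open>sqrt r\<close> is too weak a
  bound for the smaller \<open>p\<close>; the threshold \<open>K\<close> is therefore kept free, and
  triples with all three \<open>p\<close> above it go to the line count.\<close>

lemma nd_coprime_subset_balanced:
  assumes r: "1 \<le> r" "r \<le> N" and B: "B > 0" and L: "L = 2 * r * N / B" and K: "K > 0"
  shows "nd_coprime_triples r N \<subseteq> small_ratio_triples r N B \<union>
    (ratio_triples N K L \<union> swap12 ` ratio_triples N K L \<union> swap13 ` ratio_triples N K L) \<union>
    line_triples (N / K) (N / K\<^sup>2)"
proof
  fix x assume x: "x \<in> nd_coprime_triples r N"
  obtain z1 z2 z3 where xz: "x = (z1, z2, z3)" by (cases x)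
  show "x \<in> small_ratio_triples r N B \<union>
    (ratio_triples N K L \<union> swap12 ` ratio_triples N K L \<union> swap13 ` ratio_triples N K L) \<union>
    line_triples (N / K) (N / K\<^sup>2)"
    using nd_coprime_cases[OF x[unfolded xz] r B L]
  proof (elim disjE exE conjE)
    fix l1 l2 l3 p1 p2 p3 e1 e2 e3
    assume rs: "ratio_structure l1 l2 l3 p1 p2 p3 e1 e2 e3" and z: "z1 = p2 * p3 * e1" "z2 = p1 * p3 * e2" "z3 = p1 * p2 * e3"
      and l: "\<bar>of_int l1\<bar> \<le> L" "\<bar>of_int l2\<bar> \<le> L" "\<bar>of_int l3\<bar> \<le> L"
      and ne: "z1 \<noteq> z2" and b': "gmod z1 \<le> r" "gmod z2 \<le> r" "gmod z3 \<le> N"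
    have b: "gmod z1 \<le> N" "gmod z2 \<le> N" "gmod z3 \<le> N" using b' r by linarith+
    have sum: "l1 + l2 + l3 = 0" using rs by (simp add: ratio_structure_def)
    have 1: "(z1, z2, z3) \<in> ratio_triples N K L" if "\<bar>l2\<bar> \<le> 2 * \<bar>l1\<bar>" "min (gmod p2) (gmod p3) \<le> K"
      using rs z l b that unfolding ratio_triples_def by blast
    have 2: "(z2, z1, z3) \<in> ratio_triples N K L" if "\<bar>l1\<bar> \<le> 2 * \<bar>l2\<bar>" "min (gmod p1) (gmod p3) \<le> K"
    proof -
      have "z3 = p2 * p1 * e3" using z by simp
      then show ?thesis
        using ratio_structure_swap12[OF rs] z l b that unfolding ratio_triples_def by blast
    qed
    have 3: "(z3, z2, z1) \<in> ratio_triples N K L" if "\<bar>l2\<bar> \<le> 2 * \<bar>l3\<bar>" "min (gmod p2) (gmod p1) \<le> K"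
    proof -
      have "z3 = p2 * p1 * e3" "z2 = p3 * p1 * e2" "z1 = p3 * p2 * e1" using z by simp_all
      then show ?thesis
        using ratio_structure_swap13[OF rs] l b that unfolding ratio_triples_def by blast
    qed
    show ?thesis
    proof (cases "gmod p1 > K \<and> gmod p2 > K \<and> gmod p3 > K")
      case True
      then have "x \<in> line_triples (N / K) (N / K\<^sup>2)"
        unfolding xz using line_triplesI[OF rs z ne b K] by simp
      then show ?thesis by blast
    next
      case False
      \<comment> \<open>As the multipliers sum to zero, at least two of the three size comparisons
        hold; a small \<open>p\<close> occurs in two of the three minima, so some minimum and
        comparison go together.\<close>
      have "\<bar>l2\<bar> \<le> 2 * \<bar>l1\<bar> \<and> \<bar>l1\<bar> \<le> 2 * \<bar>l2\<bar> \<or> \<bar>l2\<bar> \<le> 2 * \<bar>l1\<bar> \<and> \<bar>l2\<bar> \<le> 2 * \<bar>l3\<bar> \<or>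
        \<bar>l1\<bar> \<le> 2 * \<bar>l2\<bar> \<and> \<bar>l2\<bar> \<le> 2 * \<bar>l3\<bar>" using sum by linarith
      with False 1 2 3 have "(z1, z2, z3) \<in> ratio_triples N K L \<or> (z2, z1, z3) \<in> ratio_triples N K L \<or>
        (z3, z2, z1) \<in> ratio_triples N K L" by (auto simp: min_le_iff_disj not_less)
      then show ?thesis by (force simp: xz swap12_def swap13_def)
    qed
  qed (simp add: xz)
qed

text \<open>With \<open>B = N powr (1 - 2 * d)\<close> the small-\<open>P\<close> count saves
  \<open>N powr d\<close> after its own loss of \<open>N powr d\<close>. For \<open>r\<close> at
  most \<open>N powr (1 - 4 * d)\<close> the unbalanced ratio count is enough. Otherwise
  \<open>K = N powr (1 / 2 - 6 * d)\<close> makes the ratio count of order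
  \<open>N powr (3 - 6 * d)\<close> and the line count of order
  \<open>N powr (5 / 2 + 102 * d)\<close>. The latter has to stay below
  \<open>N powr (3 - 5 * d)\<close>, which means \<open>107 * d \<le> 1 / 2\<close>;
  \<open>1 / 250\<close> is a round value below \<open>1 / 214\<close>.\<close>

lemma card_nd_coprime_triples:
  "\<exists>C>0. \<forall>r N. 1 \<le> r \<longrightarrow> r \<le> N \<longrightarrow>
    real (card (nd_coprime_triples r N)) \<le> C * r * N powr (2 - 1 / 250)"
proof -
  define d :: real where "d = 1 / 250"
  have d: "d > 0" by (simp add: d_def)
  obtain C1 where C1: "C1 > 0" "\<And>r N B. 1 \<le> r \<Longrightarrow> r \<le> N \<Longrightarrow> 0 \<le> B \<Longrightarrow> B \<le> N \<Longrightarrow>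
    real (card (small_ratio_triples r N B)) \<le> C1 * r * N * B * N powr d"
    using card_small_ratio_triples[OF d] by auto
  obtain C2 where C2: "C2 > 0" "\<And>M K L X. 0 \<le> M \<Longrightarrow> 1 \<le> K \<Longrightarrow> 1 \<le> L \<Longrightarrow> K \<le> X \<Longrightarrow> L \<le> X \<Longrightarrow>
    finite (ratio_triples M K L) \<and>
    real (card (ratio_triples M K L)) \<le> C2 * X powr d * (M\<^sup>2 + L\<^sup>2 * K\<^sup>2)"
    using card_ratio_triples[OF d] by auto
  define C where "C = C1 + 30 * C2 * 2 powr d + 3 ^ 11"
  have main: "real (card (nd_coprime_triples r N)) \<le> C * r * N powr (2 - d)" if r: "1 \<le> r" "r \<le> N" for r N
  proof -
    have N: "N \<ge> 1" using r by linarith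
    define B where "B = N powr (1 - 2 * d)"
    define L where "L = 2 * r * N / B"
    have B: "1 \<le> B" "B \<le> N" using N powr_mono[of "1 - 2 * d" 1 N]
      by (auto simp: B_def d_def intro: ge_one_powr_ge_zero)
    have LN: "L = 2 * r * N powr (2 * d)"
      using N by (simp add: L_def B_def powr_diff)
    have N2d: "1 \<le> N powr (2 * d)" "N powr (2 * d) \<le> N"
      using N powr_mono[of "2 * d" 1 N] by (auto simp: d_def intro: ge_one_powr_ge_zero)
    have L1: "1 \<le> L" unfolding LN using r N2d mult_mono[of 1 r 1 "N powr (2 * d)"] by simp
    have LX: "L \<le> 2 * N\<^sup>2" unfolding LN using r N2d N mult_mono[of r N "N powr (2 * d)" N] by (simp add: power2_eq_square)
    have X: "(2 * N\<^sup>2) powr d = 2 powr d * N powr (2 * d)"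
      using N by (simp add: powr_mult powr_powr flip: powr_numeral)
    have sr: "real (card (small_ratio_triples r N B)) \<le> C1 * r * N powr (2 - d)"
    proof -
      have "real (card (small_ratio_triples r N B)) \<le> C1 * r * N * B * N powr d"
        using r B by (intro C1) auto
      also have "\<dots> = C1 * r * (N powr 1 * N powr (1 - 2 * d) * N powr d)" using N by (simp add: B_def)
      also have "N powr 1 * N powr (1 - 2 * d) * N powr d = N powr (2 - d)"
        by (simp only: powr_add[symmetric]) simp
      finally show ?thesis .
    qed
    have rN: "0 \<le> r * N powr (2 - d)" using r by simp
    show ?thesis
    proof (cases "r \<le> N powr (1 - 4 * d)")
      case True
      have sq: "1 \<le> sqrt r" "sqrt r \<le> 2 * N\<^sup>2"
      proof -
        show "1 \<le> sqrt r" using r by simp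
        have "sqrt r \<le> r" using r by (intro real_le_lsqrt) (auto simp: power2_eq_square)
        also have "\<dots> \<le> 2 * N\<^sup>2" using r N by (smt (verit) power2_eq_square mult_left_mono mult_cancel_left1)
        finally show "sqrt r \<le> 2 * N\<^sup>2" .
      qed
      have RT: "finite (ratio_triples r (sqrt r) L)"
        "real (card (ratio_triples r (sqrt r) L)) \<le> C2 * (2 * N\<^sup>2) powr d * (r\<^sup>2 + L\<^sup>2 * (sqrt r)\<^sup>2)"
        using C2(2)[of r "sqrt r" L "2 * N\<^sup>2"] r sq L1 LX by auto
      have "r\<^sup>2 + L\<^sup>2 * (sqrt r)\<^sup>2 = r * (r * 1 + 4 * (r * r) * (N powr (2 * d))\<^sup>2)"
        using r by (simp add: LN power_mult_distrib power2_eq_square algebra_simps)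
      also have "(N powr (2 * d))\<^sup>2 = N powr (4 * d)" using N by (simp add: powr_powr flip: powr_numeral)
      also have "r * (r * 1 + 4 * (r * r) * N powr (4 * d)) \<le> r * (5 * N powr (2 - 4 * d))"
      proof -
        have rr: "r * r \<le> N powr (1 - 4 * d) * N powr (1 - 4 * d)" using True r by (intro mult_mono) auto
        have a: "r * r * N powr (4 * d) \<le> N powr (1 - 4 * d) * N powr (1 - 4 * d) * N powr (4 * d)"
          using rr by (intro mult_right_mono) auto
        also have "\<dots> = N powr (2 - 4 * d)" by (simp only: powr_add[symmetric]) simp
        finally have "r * r * N powr (4 * d) \<le> N powr (2 - 4 * d)" .
        moreover have "r * 1 \<le> N powr (2 - 4 * d)"
          using True powr_mono[of "1 - 4 * d" "2 - 4 * d" N] N by linarith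
        ultimately show ?thesis using r by (intro mult_left_mono) auto
      qed
      finally have "real (card (ratio_triples r (sqrt r) L)) \<le> C2 * (2 * N\<^sup>2) powr d * (r * (5 * N powr (2 - 4 * d)))"
        using RT(2) C2(1) by (smt (verit) mult_left_mono mult_nonneg_nonneg powr_ge_zero)
      also have "\<dots> = 5 * C2 * 2 powr d * r * (N powr (2 * d) * N powr (2 - 4 * d))" by (simp add: X)
      also have "N powr (2 * d) * N powr (2 - 4 * d) = N powr (2 - 2 * d)" by (simp only: powr_add[symmetric]) simp
      also have "\<dots> \<le> N powr (2 - d)" using N d by (intro powr_mono) auto
      finally have rt: "real (card (ratio_triples r (sqrt r) L)) \<le> 5 * C2 * 2 powr d * r * N powr (2 - d)"
        using C2(1) r by (simp add: mult_left_mono)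
      have "card (nd_coprime_triples r N) \<le> card (small_ratio_triples r N B \<union>
          (ratio_triples r (sqrt r) L \<union> swap12 ` ratio_triples r (sqrt r) L))"
        using RT(1) B L_def r by (intro card_mono nd_coprime_subset_unbalanced) auto
      also have "\<dots> \<le> card (small_ratio_triples r N B) + (card (ratio_triples r (sqrt r) L) + card (ratio_triples r (sqrt r) L))"
        using card_image_le[OF RT(1), of swap12] by (meson add_mono card_Un_le le_refl order.trans)
      finally have "real (card (nd_coprime_triples r N)) \<le> real (card (small_ratio_triples r N B)) + 2 * real (card (ratio_triples r (sqrt r) L))"
        by linarith
      also have "\<dots> \<le> (C1 + 10 * C2 * 2 powr d) * (r * N powr (2 - d))" using sr rt by (simp add: algebra_simps)
      also have "\<dots> \<le> C * (r * N powr (2 - d))" using C2(1) rN unfolding C_def by (intro mult_right_mono) auto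
      finally show ?thesis by (simp add: mult.assoc)
    next
      case False
      define K where "K = N powr (1 / 2 - 6 * d)"
      have K: "1 \<le> K" "K \<le> 2 * N\<^sup>2"
      proof -
        show "1 \<le> K" using N by (auto simp: K_def d_def intro: ge_one_powr_ge_zero)
        have "K \<le> N powr 2" unfolding K_def using N by (intro powr_mono) (auto simp: d_def)
        then have "K \<le> N\<^sup>2" using N by simp
        then show "K \<le> 2 * N\<^sup>2" using zero_le_power2[of N] by linarith
      qed
      have rN3: "N powr (3 - 5 * d) \<le> r * N powr (2 - d)"
      proof -
        have "N powr (3 - 5 * d) = N powr (1 - 4 * d) * N powr (2 - d)" by (simp add: powr_add[symmetric])
        also have "\<dots> \<le> r * N powr (2 - d)" using False by (intro mult_right_mono) auto
        finally show ?thesis .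
      qed
      have RT: "finite (ratio_triples N K L)"
        "real (card (ratio_triples N K L)) \<le> C2 * (2 * N\<^sup>2) powr d * (N\<^sup>2 + L\<^sup>2 * K\<^sup>2)"
        using C2(2)[of N K L "2 * N\<^sup>2"] N K L1 LX by auto
      have "L\<^sup>2 * K\<^sup>2 \<le> (2 * N * N powr (2 * d))\<^sup>2 * K\<^sup>2"
        unfolding LN using r by (intro mult_right_mono power_mono mult_mono) auto
      also have "\<dots> = 4 * (N powr 2 * (N powr (2 * d)) powr 2 * (N powr (1 / 2 - 6 * d)) powr 2)"
        using N by (simp add: K_def power_mult_distrib mult_ac)
      also have "\<dots> = 4 * N powr (3 - 8 * d)" by (simp add: powr_powr flip: powr_add)
      finally have LK: "L\<^sup>2 * K\<^sup>2 \<le> 4 * N powr (3 - 8 * d)" .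
      have "N\<^sup>2 = N powr 2" using N by simp
      also have "\<dots> \<le> N powr (3 - 8 * d)" using N by (intro powr_mono) (auto simp: d_def)
      finally have "N\<^sup>2 + L\<^sup>2 * K\<^sup>2 \<le> 5 * N powr (3 - 8 * d)" using LK by linarith
      then have "real (card (ratio_triples N K L)) \<le> C2 * (2 * N\<^sup>2) powr d * (5 * N powr (3 - 8 * d))"
        using RT(2) C2(1) by (smt (verit) mult_left_mono mult_nonneg_nonneg powr_ge_zero)
      also have "\<dots> = 5 * C2 * 2 powr d * (N powr (2 * d) * N powr (3 - 8 * d))" by (simp add: X)
      also have "N powr (2 * d) * N powr (3 - 8 * d) = N powr (3 - 6 * d)" by (simp only: powr_add[symmetric]) simp
      also have "\<dots> \<le> N powr (3 - 5 * d)" using N d by (intro powr_mono) auto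
      also have "\<dots> \<le> r * N powr (2 - d)" by (rule rN3)
      finally have rt: "real (card (ratio_triples N K L)) \<le> 5 * C2 * 2 powr d * (r * N powr (2 - d))"
        using C2(1) by (simp add: mult_left_mono)
      have NK: "N / K = N powr (1 / 2 + 6 * d)" "N / K\<^sup>2 = N powr (12 * d)"
      proof -
        have "N / K = N powr 1 / N powr (1 / 2 - 6 * d)" using N by (simp add: K_def)
        also have "\<dots> = N powr (1 / 2 + 6 * d)" by (simp only: powr_diff[symmetric]) simp
        finally show "N / K = N powr (1 / 2 + 6 * d)" .
        have "N / K\<^sup>2 = N powr 1 / (N powr (1 / 2 - 6 * d)) powr 2" using N by (simp add: K_def)
        also have "\<dots> = N powr (12 * d)" by (simp only: powr_powr powr_diff[symmetric]) simp
        finally show "N / K\<^sup>2 = N powr (12 * d)" .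
      qed
      have NK1: "1 \<le> N / K" "1 \<le> N / K\<^sup>2" unfolding NK using N d by (auto intro: ge_one_powr_ge_zero)
      have "real (card (line_triples (N / K) (N / K\<^sup>2))) \<le> 3 ^ 11 * (N / K\<^sup>2) ^ 6 * (N / K) ^ 5"
        by (rule card_line_triples(2)[OF NK1])
      also have "\<dots> = 3 ^ 11 * ((N powr (12 * d)) powr 6 * (N powr (1 / 2 + 6 * d)) powr 5)"
        unfolding NK using N by simp
      also have "\<dots> = 3 ^ 11 * N powr (5 / 2 + 102 * d)" by (simp add: powr_powr field_simps flip: powr_add)
      also have "\<dots> \<le> 3 ^ 11 * N powr (3 - 5 * d)" using N by (intro mult_left_mono powr_mono) (auto simp: d_def)
      also have "\<dots> \<le> 3 ^ 11 * (r * N powr (2 - d))" using rN3 by (intro mult_left_mono) auto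
      finally have lt: "real (card (line_triples (N / K) (N / K\<^sup>2))) \<le> 3 ^ 11 * (r * N powr (2 - d))" .
      let ?R = "ratio_triples N K L" and ?T = "line_triples (N / K) (N / K\<^sup>2)"
      have "card (nd_coprime_triples r N) \<le> card (small_ratio_triples r N B \<union> (?R \<union> swap12 ` ?R \<union> swap13 ` ?R) \<union> ?T)"
        using RT(1) B L_def r K card_line_triples(1)[OF NK1] by (intro card_mono nd_coprime_subset_balanced) auto
      also have "\<dots> \<le> card (small_ratio_triples r N B) + (card ?R + card ?R + card ?R) + card ?T"
        using card_image_le[OF RT(1), of swap12] card_image_le[OF RT(1), of swap13]
        by (meson add_mono card_Un_le le_refl order.trans)
      finally have "real (card (nd_coprime_triples r N)) \<le>
          real (card (small_ratio_triples r N B)) + 3 * real (card ?R) + real (card ?T)"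
        by linarith
      also have "\<dots> \<le> (C1 + 15 * C2 * 2 powr d + 3 ^ 11) * (r * N powr (2 - d))"
        using sr rt lt by (simp add: algebra_simps)
      also have "\<dots> \<le> C * (r * N powr (2 - d))" using C2(1) rN unfolding C_def by (intro mult_right_mono) auto
      finally show ?thesis by (simp add: mult.assoc)
    qed
  qed
  moreover have "C > 0" using C1 C2 by (simp add: C_def add_pos_pos)
  ultimately show ?thesis unfolding d_def by blast
qed

lemma cocircular_scale: "cocircular (g * a) (g * b) (g * c) \<Longrightarrow> cocircular a b c"
  and nondegenerate_scale: "nondegenerate (g * a) (g * b) (g * c) \<Longrightarrow> nondegenerate a b c"
proof -
  have k: "gim (of_int k * z) = k * gim z" for k z by simp
  have gg: "g\<^sup>2 * gcnj (g\<^sup>2) = of_int (gnorm (g\<^sup>2))" by (rule mult_gcnj)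
  have 1: "(g * a) * (g * c - g * b) * gcnj ((g * b) * (g * a - g * c)) = of_int (gnorm (g\<^sup>2)) * (a * (c - b) * gcnj (b * (a - c)))"
    unfolding gg[symmetric] by (simp add: power2_eq_square algebra_simps)
  have 2: "(g * a + g * b - g * c)\<^sup>2 * gcnj ((g * a) * (g * c - g * b)) = of_int (gnorm (g\<^sup>2)) * ((a + b - c)\<^sup>2 * gcnj (a * (c - b)))"
    unfolding gg[symmetric] by (simp add: power2_eq_square algebra_simps)
  show "cocircular (g * a) (g * b) (g * c) \<Longrightarrow> cocircular a b c"
    unfolding cocircular_def 1 k by auto
  show "nondegenerate (g * a) (g * b) (g * c) \<Longrightarrow> nondegenerate a b c"
    unfolding nondegenerate_def 2 k by auto
qed

text \<open>Dividing by the gcd \<open>g\<close> scales the bound by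
  \<open>gmod g powr - (3 - 1 / 250)\<close>, and the sum of this over the lattice converges because
  the exponent exceeds \<open>2\<close>.\<close>

theorem card_nd_triples:
  "\<exists>C>0. \<forall>r N. 1 \<le> r \<longrightarrow> r \<le> N \<longrightarrow> real (card (nd_triples r N)) \<le> C * r * N powr (2 - 1 / 250)"
proof -
  obtain C1 where C1: "C1 > 0" "\<And>r N. 1 \<le> r \<Longrightarrow> r \<le> N \<Longrightarrow>
      real (card (nd_coprime_triples r N)) \<le> C1 * r * N powr (2 - 1 / 250)"
    using card_nd_coprime_triples by auto
  obtain C2 where C2: "C2 > 0" "\<And>A. (\<Sum>e\<in>disc A - {0}. gmod e powr - (3 - 1 / 250)) \<le> C2"
    using sum_disc_powr_bounded[of "3 - 1 / 250"] by auto
  have "real (card (nd_triples r N)) \<le> C1 * C2 * r * N powr (2 - 1 / 250)" if r: "1 \<le> r" "r \<le> N" for r N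
  proof -
    define S where "S g = (\<lambda>(a, b, c). (g * a, g * b, g * c)) ` nd_coprime_triples (r / gmod g) (N / gmod g)" for g
    have sub: "nd_triples r N \<subseteq> (\<Union>g\<in>disc r - {0}. S g)"
    proof
      fix x assume "x \<in> nd_triples r N"
      then obtain z1 z2 z3 where x: "x = (z1, z2, z3)" and b: "gmod z1 \<le> r" "gmod z2 \<le> r" "gmod z3 \<le> N"
        and c: "cocircular z1 z2 z3" "nondegenerate z1 z2 z3" by (auto simp: nd_triples_def)
      define g where "g = gcd z1 (gcd z2 z3)"
      have z1: "z1 \<noteq> 0" using c by (simp add: cocircular_def)
      then have g0: "g \<noteq> 0" by (simp add: g_def)
      have gd: "g dvd z1" "g dvd z2" "g dvd z3"
        unfolding g_def by (auto intro: dvd_trans[OF gcd_dvd2])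
      then obtain w1 w2 w3 where w: "z1 = g * w1" "z2 = g * w2" "z3 = g * w3" by (elim dvdE)
      have "g \<in> disc r - {0}" using gmod_dvd_le[OF gd(1) z1] b g0 by (auto simp: disc_def)
      moreover have "gcd w1 (gcd w2 w3) = 1"
      proof -
        define h where "h = gcd w1 (gcd w2 w3)"
        have "h dvd w1" "h dvd w2" "h dvd w3" unfolding h_def by (auto intro: dvd_trans[OF gcd_dvd2])
        then have "g * h dvd g" unfolding g_def[of ] by (metis g_def gcd_greatest mult_dvd_mono dvd_refl w)
        then have "is_unit h" using g0 by (metis dvd_mult_cancel_left mult_1_right)
        then show ?thesis by (simp add: h_def)
      qed
      moreover have "gmod w1 \<le> r / gmod g" "gmod w2 \<le> r / gmod g" "gmod w3 \<le> N / gmod g"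
        using b g0 by (simp_all add: w gmod_mult field_simps)
      ultimately have "x \<in> S g"
        using c cocircular_scale nondegenerate_scale unfolding S_def x w nd_coprime_triples_def nd_triples_def by force
      then show "x \<in> (\<Union>g\<in>disc r - {0}. S g)" using \<open>g \<in> disc r - {0}\<close> by blast
    qed
    have fin: "finite (\<Union>g\<in>disc r - {0}. S g)" by (auto simp: S_def)
    have "real (card (nd_triples r N)) \<le> real (card (\<Union>g\<in>disc r - {0}. S g))"
      using sub fin by (intro of_nat_mono card_mono)
    also have "\<dots> \<le> (\<Sum>g\<in>disc r - {0}. C1 * r * N powr (2 - 1 / 250) * gmod g powr - (3 - 1 / 250))"
    proof (intro card_UN_bound)
      fix g assume g: "g \<in> disc r - {0}"
      then have g1: "gmod g \<ge> 1" "gmod g \<le> r" by (auto simp: gmod_ge_1 disc_def)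
      have "real (card (S g)) \<le> real (card (nd_coprime_triples (r / gmod g) (N / gmod g)))"
        unfolding S_def by (intro of_nat_mono card_image_le) simp
      also have "\<dots> \<le> C1 * (r / gmod g) * (N / gmod g) powr (2 - 1 / 250)"
        using g1 r by (intro C1) (auto simp: divide_right_mono le_divide_eq)
      also have "\<dots> = C1 * r * N powr (2 - 1 / 250) * (1 / (gmod g powr 1 * gmod g powr (2 - 1 / 250)))"
        using g1 r by (simp add: powr_divide)
      also have "1 / (gmod g powr 1 * gmod g powr (2 - 1 / 250)) = gmod g powr - (3 - 1 / 250)"
        by (simp only: powr_add[symmetric] powr_minus_divide) simp
      finally show "real (card (S g)) \<le> C1 * r * N powr (2 - 1 / 250) * gmod g powr - (3 - 1 / 250)" .
    qed simp
    also have "\<dots> = C1 * r * N powr (2 - 1 / 250) * (\<Sum>g\<in>disc r - {0}. gmod g powr - (3 - 1 / 250))"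
      by (simp only: sum_distrib_left)
    also have "\<dots> \<le> C1 * r * N powr (2 - 1 / 250) * C2"
      using C1(1) r C2(2) by (intro mult_left_mono) auto
    finally show ?thesis by (simp add: mult_ac)
  qed
  then show ?thesis using C1 C2 by (intro exI[of _ "C1 * C2"]) auto
qed

section \<open>Trapezoids and lines\<close>

text \<open>The segments from \<open>0\<close> to \<open>w\<close> and from \<open>u\<close> to \<open>v\<close> are parallel with a common perpendicular bisector.\<close>

definition trapezoid :: "gauss \<Rightarrow> gauss \<Rightarrow> gauss \<Rightarrow> bool" where
  "trapezoid w u v \<longleftrightarrow> gim (w * gcnj (u - v)) = 0 \<and> gre (w * gcnj (u + v - w)) = 0"

lemma parallel_trans:
  assumes "X \<noteq> 0" "gim (X * gcnj Y) = 0 \<and> gim (X * gcnj Z) = 0 \<or> gre (X * gcnj Y) = 0 \<and> gre (X * gcnj Z) = 0"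
  shows "gim (Y * gcnj Z) = 0"
proof -
  have "gnorm X * gim (Y * gcnj Z) = gim (X * gcnj Z) * gre (X * gcnj Y) - gre (X * gcnj Z) * gim (X * gcnj Y)"
    by (simp add: gnorm_def power2_eq_square algebra_simps)
  then have "gnorm X * gim (Y * gcnj Z) = 0" using assms(2) by auto
  then show ?thesis using assms(1) by simp
qed

text \<open>Three nonzero plane vectors cannot be pairwise orthogonal, so they fall into at most two
  parallel classes, orthogonal to each other; a zero vector is parallel and orthogonal to
  everything.\<close>

lemma gauss_orthogonality_cases:
  assumes 12: "gim (X1 * gcnj X2) = 0 \<or> gre (X1 * gcnj X2) = 0"
    and 13: "gim (X1 * gcnj X3) = 0 \<or> gre (X1 * gcnj X3) = 0"
    and 23: "gim (X2 * gcnj X3) = 0 \<or> gre (X2 * gcnj X3) = 0"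
  shows "gim (X1 * gcnj X2) = 0 \<and> gim (X1 * gcnj X3) = 0 \<and> gim (X2 * gcnj X3) = 0 \<or>
    gim (X2 * gcnj X3) = 0 \<and> gre (X1 * gcnj X2) = 0 \<and> gre (X1 * gcnj X3) = 0 \<or>
    gim (X1 * gcnj X3) = 0 \<and> gre (X1 * gcnj X2) = 0 \<and> gre (X2 * gcnj X3) = 0 \<or>
    gim (X1 * gcnj X2) = 0 \<and> gre (X1 * gcnj X3) = 0 \<and> gre (X2 * gcnj X3) = 0"
proof -
  have comm: "gim (Y * gcnj Z) = 0 \<longleftrightarrow> gim (Z * gcnj Y) = 0" "gre (Y * gcnj Z) = 0 \<longleftrightarrow> gre (Z * gcnj Y) = 0" for Y Z
    by (auto simp: mult.commute)
  show ?thesis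
  proof (cases "X1 = 0 \<or> X2 = 0 \<or> X3 = 0")
    case True
    then show ?thesis using 12 13 23 by auto
  next
    case False
    then have nz: "X1 \<noteq> 0" "X2 \<noteq> 0" "X3 \<noteq> 0" by auto
    note t1 = parallel_trans[OF nz(1), of X2 X3] and t2 = parallel_trans[OF nz(2), of X1 X3]
      and t3 = parallel_trans[OF nz(3), of X1 X2]
    show ?thesis using 12 13 23 t1 t2 t3 comm[of X2 X1] comm[of X3 X1] comm[of X3 X2]
      by argo
  qed
qed

text \<open>Degeneracy places \<open>X3\<close> on one of two perpendicular lines, the asymptotes of
  the collapsed hyperbola; the squares of \<open>X1\<close>, \<open>X2\<close>, \<open>X3\<close>
  differ by integer multiples of \<open>P\<close>, so all three lie on this pair of lines. If they
  are all parallel, so are the \<open>z\<close>; if one is orthogonal to the other two,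
  \<open>2 * z1 = X2 + X3\<close> and its analogues give a trapezoid.\<close>

lemma degenerate_cases:
  assumes c: "cocircular z1 z2 z3" and nd: "\<not> nondegenerate z1 z2 z3"
  shows "gim (z1 * gcnj z2) = 0 \<and> gim (z1 * gcnj z3) = 0 \<or>
    trapezoid z1 z2 z3 \<or> trapezoid z2 z1 z3 \<or> trapezoid z3 z1 z2"
proof -
  obtain P l1 l2 l3 where P: "P \<noteq> 0" and l: "l1 \<noteq> 0"
    and eq: "z1 * (z3 - z2) = of_int l1 * P" "z2 * (z1 - z3) = of_int l2 * P"
    using cocircular_ratio[OF c] by metis
  obtain g w where w: "g > 0" "P = of_int g * w" "primitive w" using primitive_decompose[OF P] by metis
  define X1 X2 X3 where "X1 = z2 + z3 - z1" and "X2 = z1 + z3 - z2" and "X3 = z1 + z2 - z3"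
  have k: "gim (of_int k * z) = k * gim z" for k z by simp
  have "X3\<^sup>2 * gcnj (z1 * (z3 - z2)) = of_int (l1 * g) * (X3\<^sup>2 * gcnj w)"
    unfolding eq w(2) by (simp add: mult_ac)
  then have "gim (of_int (l1 * g) * (X3\<^sup>2 * gcnj w)) = 0"
    using nd unfolding nondegenerate_def X3_def[symmetric] by metis
  then have "l1 * g * gim (X3\<^sup>2 * gcnj w) = 0" by (simp only: k)
  then have "gim (X3\<^sup>2 * gcnj w) = 0" using l w(1) by simp
  then obtain k3 where k3: "X3\<^sup>2 = of_int k3 * w" using parallel_primitive[OF w(3)] by metis
  have "X1\<^sup>2 = X3\<^sup>2 - 4 * (z2 * (z1 - z3))" by (simp add: X1_def X3_def power2_eq_square algebra_simps)
  then have k1: "X1\<^sup>2 = of_int (k3 - 4 * l2 * g) * w" unfolding eq k3 w(2) by (simp add: algebra_simps)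
  have "X2\<^sup>2 = X3\<^sup>2 + 4 * (z1 * (z3 - z2))" by (simp add: X2_def X3_def power2_eq_square algebra_simps)
  then have k2: "X2\<^sup>2 = of_int (k3 + 4 * l1 * g) * w" unfolding eq k3 w(2) by (simp add: algebra_simps)
  have par: "gim (X * gcnj Y) = 0 \<or> gre (X * gcnj Y) = 0" if "X\<^sup>2 = of_int m * w" "Y\<^sup>2 = of_int n * w" for X Y m n
  proof -
    have "(X * gcnj Y)\<^sup>2 = X\<^sup>2 * gcnj (Y\<^sup>2)" by (simp add: power_mult_distrib)
    also have "\<dots> = of_int (m * n) * (w * gcnj w)" unfolding that by (simp add: mult_ac)
    also have "\<dots> = of_int (m * n * gnorm w)" by (simp add: mult_gcnj)
    finally have "gim ((X * gcnj Y)\<^sup>2) = 0" by (simp only: gauss_of_int)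
    moreover have "gim (Z\<^sup>2) = 2 * (gre Z * gim Z)" for Z by (simp add: power2_eq_square)
    ultimately have "gre (X * gcnj Y) * gim (X * gcnj Y) = 0" by (metis mult_eq_0_iff zero_neq_numeral)
    then show ?thesis by (metis mult_eq_0_iff)
  qed
  have z: "2 * z1 = X2 + X3" "2 * z2 = X1 + X3" "2 * z3 = X1 + X2" by (simp_all add: X1_def X2_def X3_def)
  have coll: "4 * gim (z1 * gcnj z2) = gim (X2 * gcnj X1) + gim (X2 * gcnj X3) + gim (X3 * gcnj X1)"
    "4 * gim (z1 * gcnj z3) = gim (X2 * gcnj X1) + gim (X3 * gcnj X2) + gim (X3 * gcnj X1)"
    by (simp_all add: X1_def X2_def X3_def algebra_simps)
  have tr: "2 * gim (z1 * gcnj (z2 - z3)) = gim (X2 * gcnj X3)" "2 * gre (z1 * gcnj X1) = gre (X1 * gcnj X2) + gre (X1 * gcnj X3)"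
    "2 * gim (z2 * gcnj (z1 - z3)) = gim (X1 * gcnj X3)" "2 * gre (z2 * gcnj X2) = gre (X1 * gcnj X2) + gre (X2 * gcnj X3)"
    "2 * gim (z3 * gcnj (z1 - z2)) = gim (X1 * gcnj X2)" "2 * gre (z3 * gcnj X3) = gre (X1 * gcnj X3) + gre (X2 * gcnj X3)"
    by (simp_all add: X1_def X2_def X3_def algebra_simps)
  have comm: "gim (Y * gcnj Z) = - gim (Z * gcnj Y)" for Y Z by simp
  show ?thesis
    using gauss_orthogonality_cases[OF par[OF k1 k2] par[OF k1 k3] par[OF k2 k3]]
  proof (elim disjE conjE)
    assume "gim (X1 * gcnj X2) = 0" "gim (X1 * gcnj X3) = 0" "gim (X2 * gcnj X3) = 0"
    then show ?thesis using coll comm[of X2 X1] comm[of X3 X1] comm[of X3 X2] by linarith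
  next
    assume "gim (X2 * gcnj X3) = 0" "gre (X1 * gcnj X2) = 0" "gre (X1 * gcnj X3) = 0"
    then have "gim (z1 * gcnj (z2 - z3)) = 0" "gre (z1 * gcnj X1) = 0" using tr(1,2) by linarith+
    then have "trapezoid z1 z2 z3" unfolding trapezoid_def X1_def by simp
    then show ?thesis by simp
  next
    assume "gim (X1 * gcnj X3) = 0" "gre (X1 * gcnj X2) = 0" "gre (X2 * gcnj X3) = 0"
    then have "gim (z2 * gcnj (z1 - z3)) = 0" "gre (z2 * gcnj X2) = 0" using tr(3,4) by linarith+
    then have "trapezoid z2 z1 z3" unfolding trapezoid_def X2_def by simp
    then show ?thesis by simp
  next
    assume "gim (X1 * gcnj X2) = 0" "gre (X1 * gcnj X3) = 0" "gre (X2 * gcnj X3) = 0"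
    then have "gim (z3 * gcnj (z1 - z2)) = 0" "gre (z3 * gcnj X3) = 0" using tr(5,6) by linarith+
    then have "trapezoid z3 z1 z2" unfolding trapezoid_def X3_def by simp
    then show ?thesis by simp
  qed
qed

definition trapezoids :: "real \<Rightarrow> real \<Rightarrow> (gauss \<times> gauss \<times> gauss) set" where
  "trapezoids A B = {(w, u, v). w \<noteq> 0 \<and> u \<noteq> 0 \<and> gmod w \<le> A \<and> gmod u \<le> B \<and> trapezoid w u v}"

text \<open>The points whose mirror image in a line orthogonal to the primitive vector \<open>e\<close> is again integral:
  in a trapezoid, \<open>v\<close> is such an image of \<open>u\<close>.\<close>

definition reflection_points :: "real \<Rightarrow> gauss \<Rightarrow> gauss set" where
  "reflection_points B e = {u. u \<noteq> 0 \<and> gmod u \<le> B \<and> gnorm e dvd 2 * gre (e * gcnj u)}"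

lemma perpendicular_primitive:
  assumes "primitive e" "gre (e * gcnj u) = 0"
  obtains k where "u = of_int k * (Gauss 0 1 * e)"
proof -
  have "primitive (Gauss 0 1 * e)" using assms(1) by (simp add: primitive_def coprime_commute)
  moreover have "gim (u * gcnj (Gauss 0 1 * e)) = 0" using assms(2) by (simp add: algebra_simps)
  ultimately show ?thesis using parallel_primitive that by metis
qed

text \<open>The points lie on the lines \<open>2 * gre (e * gcnj u) = j * gnorm e\<close> with
  \<open>\<bar>j\<bar> \<le> 2 * (B / gmod e)\<close>, and on each line their distances are
  multiples of \<open>gmod e\<close>. The sum over \<open>e\<close> needs a bound without additive
  constants, so \<open>gmod e > 2 * B\<close> is treated separately: only \<open>j = 0\<close> is
  left, and \<open>u\<close> would be a nonzero multiple of \<open>e\<close> turned by a right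
  angle, which is too long.\<close>

lemma card_reflection_points:
  assumes e: "primitive e" "e \<noteq> 0" and B: "B \<ge> 0"
  shows "finite (reflection_points B e)" "real (card (reflection_points B e)) \<le> 36 * (B / gmod e)\<^sup>2"
proof -
  have "reflection_points B e \<subseteq> disc B" by (auto simp: reflection_points_def disc_def)
  then show fin: "finite (reflection_points B e)" by (rule finite_subset) simp
  define J where "J = {j::int. \<bar>of_int j\<bar> \<le> 2 * (B / gmod e)}"
  define L where "L j = {u \<in> disc B. 2 * gre (e * gcnj u) = j * gnorm e}" for j
  have ge: "gmod e > 0" using e by simp
  have ie: "gmod (Gauss 0 1 * e) = gmod e"
    by (simp add: gmod_altdef gnorm_mult) (simp add: gnorm_def)
  have B0: "2 * (B / gmod e) \<ge> 0" using B by simp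
  have sub: "reflection_points B e \<subseteq> (\<Union>j\<in>J. L j)"
  proof
    fix u assume u: "u \<in> reflection_points B e"
    then obtain j where j: "2 * gre (e * gcnj u) = gnorm e * j" by (auto simp: reflection_points_def elim!: dvdE)
    have "\<bar>of_int (gre (e * gcnj u))\<bar> \<le> gmod (e * gcnj u)" by (rule abs_gre_le)
    also have "\<dots> \<le> gmod e * B" using u by (simp add: gmod_mult reflection_points_def mult_left_mono)
    finally have "\<bar>of_int (2 * gre (e * gcnj u))\<bar> \<le> 2 * gmod e * B" unfolding of_int_mult abs_mult by (simp add: mult_ac)
    then have "(gmod e)\<^sup>2 * \<bar>of_int j\<bar> \<le> 2 * gmod e * B" unfolding j by (simp add: abs_mult gmod_power2)
    then have "\<bar>of_int j\<bar> \<le> 2 * (B / gmod e)" using ge by (simp add: field_simps power2_eq_square)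
    then show "u \<in> (\<Union>j\<in>J. L j)" using u j by (auto simp: J_def L_def disc_def reflection_points_def mult.commute)
  qed
  have fJ: "finite J" "real (card J) \<le> 2 * (2 * (B / gmod e)) + 1"
    using card_int_abs_le[OF B0] by (auto simp: J_def)
  have cL: "real (card (L j)) \<le> 2 * (2 * (B / gmod e)) + 1" for j
  proof (cases "L j = {}")
    case False
    then obtain u0 where u0: "u0 \<in> L j" by auto
    have "L j \<subseteq> (\<lambda>k. u0 + of_int k * (Gauss 0 1 * e)) ` J"
    proof
      fix u assume u: "u \<in> L j"
      have "gre (e * gcnj u) = gre (e * gcnj u0)" using u u0 by (auto simp: L_def)
      then have "gre (e * gcnj (u - u0)) = 0" by (simp add: algebra_simps)
      then obtain k where k: "u - u0 = of_int k * (Gauss 0 1 * e)" using perpendicular_primitive[OF e(1)] by metis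
      have "\<bar>of_int k\<bar> * gmod e = gmod (u - u0)" by (simp only: k gmod_mult ie gmod_of_int) (simp add: gmod_mult ie[unfolded gmod_mult])
      also have "\<dots> \<le> 2 * B" using gmod_diff_le[of u u0] u u0 by (simp add: L_def disc_def)
      finally have "k \<in> J" using ge by (simp add: J_def field_simps)
      with k show "u \<in> (\<lambda>k. u0 + of_int k * (Gauss 0 1 * e)) ` J"
        by (intro image_eqI[of _ _ k]) (simp_all add: algebra_simps)
    qed
    then have "card (L j) \<le> card J" using fJ(1) by (rule surj_card_le[rotated])
    then show ?thesis using fJ(2) by linarith
  qed (use B0 in simp)
  show "real (card (reflection_points B e)) \<le> 36 * (B / gmod e)\<^sup>2"
  proof (cases "gmod e \<le> 2 * B")
    case True
    then have x: "1 / 2 \<le> B / gmod e" using ge by (simp add: field_simps)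
    have "real (card (reflection_points B e)) \<le> real (card (\<Union>j\<in>J. L j))"
      using sub fJ by (intro of_nat_mono card_mono) (auto simp: L_def)
    also have "\<dots> \<le> (\<Sum>j\<in>J. 2 * (2 * (B / gmod e)) + 1)" using fJ(1) cL by (intro card_UN_bound)
    also have "\<dots> = real (card J) * (2 * (2 * (B / gmod e)) + 1)" by simp
    also have "\<dots> \<le> (6 * (B / gmod e)) * (6 * (B / gmod e))"
      using fJ(2) x by (intro mult_mono) auto
    finally show ?thesis by (simp add: power2_eq_square)
  next
    case False
    have "reflection_points B e = {}"
    proof (rule ccontr)
      assume "reflection_points B e \<noteq> {}"
      then obtain u where u: "u \<in> reflection_points B e" by auto
      then obtain j where j: "j \<in> J" "u \<in> L j" using sub by blast
      have "2 * (B / gmod e) < 1" using False ge by (simp add: field_simps)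
      moreover have "\<bar>of_int j\<bar> \<le> 2 * (B / gmod e)" using j(1) by (simp add: J_def)
      ultimately have "\<bar>of_int j\<bar> < (1::real)" by linarith
      then have "j = 0" by simp
      then have "gre (e * gcnj u) = 0" using j(2) by (simp add: L_def)
      then obtain k where k: "u = of_int k * (Gauss 0 1 * e)" using perpendicular_primitive[OF e(1)] by metis
      have "Gauss 0 1 * e dvd u" using k by simp
      then have "gmod e \<le> gmod u" using gmod_dvd_le[of "Gauss 0 1 * e" u] u ie by (simp add: reflection_points_def)
      then show False using u False B by (simp add: reflection_points_def)
    qed
    then show ?thesis by simp
  qed
qed

text \<open>For \<open>w\<close> in the primitive direction \<open>e\<close> there are at most
  \<open>A / gmod e\<close> lengths and \<open>36 * (B / gmod e)\<^sup>2\<close> choices of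
  \<open>u\<close>; then \<open>v\<close> is determined as a mirror image. The sum of
  \<open>gmod e powr - 3\<close> converges.\<close>

lemma card_trapezoids:
  "\<exists>C>0. \<forall>A B. 0 \<le> A \<longrightarrow> 0 \<le> B \<longrightarrow> finite (trapezoids A B) \<and> real (card (trapezoids A B)) \<le> C * A * B\<^sup>2"
proof -
  obtain C where C: "C > 0" "\<And>A. (\<Sum>e\<in>disc A - {0}. gmod e powr - 3) \<le> C"
    using sum_disc_powr_bounded[of 3] by auto
  have "finite (trapezoids A B) \<and> real (card (trapezoids A B)) \<le> 36 * C * A * B\<^sup>2" if *: "0 \<le> A" "0 \<le> B" for A B
  proof -
    define E where "E = {e \<in> disc A - {0}. primitive e}"
    define T where "T e = {1..\<lfloor>A / gmod e\<rfloor>} \<times> reflection_points B e" for e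
    define S where "S = (\<lambda>(w, u, v). (w, u)) ` trapezoids A B"
    have fE: "finite E" by (simp add: E_def)
    have inj: "inj_on (\<lambda>(w, u, v). (w, u)) (trapezoids A B)"
    proof (rule inj_onI)
      fix x y assume xy: "x \<in> trapezoids A B" "y \<in> trapezoids A B" "(\<lambda>(w, u, v). (w, u)) x = (\<lambda>(w, u, v). (w, u)) y"
      then obtain w u v v' where "x = (w, u, v)" "y = (w, u, v')" by (cases x; cases y) auto
      note xy = xy this
      then have h: "w \<noteq> 0" "gim (w * gcnj (u - v)) = 0" "gre (w * gcnj (u + v - w)) = 0"
        "gim (w * gcnj (u - v')) = 0" "gre (w * gcnj (u + v' - w)) = 0" by (auto simp: trapezoids_def trapezoid_def)
      have "gim (w * gcnj (v - v')) = gim (w * gcnj (u - v')) - gim (w * gcnj (u - v))"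
        "gre (w * gcnj (v - v')) = gre (w * gcnj (u + v - w)) - gre (w * gcnj (u + v' - w))"
        by (simp_all add: algebra_simps)
      then have "w * gcnj (v - v') = 0" using h by (simp add: gauss_eq_iff)
      then have "v = v'" using h(1) by (metis gcnj_eq_0_iff mult_eq_0_iff right_minus_eq)
      then show "x = y" using xy by simp
    qed
    have sub: "S \<subseteq> (\<lambda>(e, t, u). (of_int t * e, u)) ` (SIGMA e : E. T e)"
    proof
      fix x assume "x \<in> S"
      then obtain w u v where x: "x = (w, u)" "(w, u, v) \<in> trapezoids A B" by (auto simp: S_def)
      then have h: "w \<noteq> 0" "u \<noteq> 0" "gmod w \<le> A" "gmod u \<le> B" "gim (w * gcnj (u - v)) = 0" "gre (w * gcnj (u + v - w)) = 0"
        by (auto simp: trapezoids_def trapezoid_def)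
      obtain t e where te: "t > 0" "w = of_int t * e" "primitive e" "e \<noteq> 0" using primitive_decompose[OF h(1)] .
      have "t * gim (e * gcnj (u - v)) = 0" "t * gre (e * gcnj (u + v - w)) = 0"
        using h(5,6) unfolding te(2) by (simp_all add: algebra_simps)
      then have g: "gim (e * gcnj (u - v)) = 0" "gre (e * gcnj (u + v - w)) = 0" using te(1) by simp_all
      have "gim ((u - v) * gcnj e) = - gim (e * gcnj (u - v))" by (simp add: algebra_simps)
      also have "\<dots> = 0" unfolding g(1) by simp
      finally obtain s where s: "u - v = of_int s * e" using parallel_primitive[OF te(3), of "u - v"] by metis
      \<comment> \<open>As \<open>u - v\<close> is a multiple of \<open>e\<close>, the bisector
        condition becomes \<open>2 * gre (e * gcnj u) = (s + t) * gnorm e\<close>, the divisibility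
        that defines reflection points.\<close>
      have uvw: "u + v - w = 2 * u - of_int (s + t) * e" using s te(2) by (simp add: algebra_simps)
      have "e * gcnj (u + v - w) = 2 * (e * gcnj u) - of_int (s + t) * (e * gcnj e)"
        unfolding uvw by (simp add: algebra_simps)
      also have "\<dots> = 2 * (e * gcnj u) - of_int ((s + t) * gnorm e)" by (simp only: mult_gcnj of_int_mult)
      finally have "gre (2 * (e * gcnj u) - of_int ((s + t) * gnorm e)) = 0" using g(2) by metis
      moreover have "gre (2 * z - of_int k) = 2 * gre z - k" for z k by simp
      ultimately have "2 * gre (e * gcnj u) = (s + t) * gnorm e" by (metis right_minus_eq)
      then have "u \<in> reflection_points B e" using h unfolding reflection_points_def by (metis (mono_tags, lifting) dvd_triv_right mem_Collect_eq)
      moreover have wt: "gmod w = of_int t * gmod e" using te by (simp add: gmod_mult)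
      have "1 * gmod e \<le> of_int t * gmod e" using te by (intro mult_right_mono) auto
      then have "gmod e \<le> A" using h(3) wt by linarith
      then have "e \<in> E" using te by (simp add: E_def disc_def)
      moreover have "t \<in> {1..\<lfloor>A / gmod e\<rfloor>}" using te h wt by (simp add: le_floor_iff field_simps)
      ultimately show "x \<in> (\<lambda>(e, t, u). (of_int t * e, u)) ` (SIGMA e : E. T e)"
        using x te by (intro image_eqI[of _ _ "(e, t, u)"]) (auto simp: T_def)
    qed
    have fT: "finite (T e)" "real (card (T e)) \<le> 36 * A * B\<^sup>2 * gmod e powr - 3" if "e \<in> E" for e
    proof -
      have e: "primitive e" "e \<noteq> 0" "gmod e > 0" using that by (auto simp: E_def)
      show "finite (T e)" using card_reflection_points(1)[OF e(1,2) *(2)] by (simp add: T_def)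
      have "real (card (T e)) = real (nat \<lfloor>A / gmod e\<rfloor>) * real (card (reflection_points B e))"
        by (simp add: T_def card_cartesian_product)
      also have "\<dots> \<le> A / gmod e * (36 * (B / gmod e)\<^sup>2)"
        using card_reflection_points(2)[OF e(1,2) *(2)] * by (intro mult_mono) auto
      also have "\<dots> = 36 * A * B\<^sup>2 * gmod e powr - 3"
        using e(3) by (simp add: powr_minus_divide power_divide power2_eq_square power3_eq_cube mult_ac)
      finally show "real (card (T e)) \<le> 36 * A * B\<^sup>2 * gmod e powr - 3" .
    qed
    have fS: "finite S" using sub by (rule finite_subset) (use fE fT in auto)
    have "real (card (trapezoids A B)) = real (card S)" unfolding S_def by (simp add: card_image[OF inj])
    also have "\<dots> \<le> real (card (SIGMA e : E. T e))"
      using sub fE fT by (intro of_nat_mono surj_card_le) auto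
    also have "\<dots> = (\<Sum>e\<in>E. real (card (T e)))" using fE fT by simp
    also have "\<dots> \<le> (\<Sum>e\<in>E. 36 * A * B\<^sup>2 * gmod e powr - 3)" using fT by (intro sum_mono)
    also have "\<dots> \<le> (\<Sum>e\<in>disc A - {0}. 36 * A * B\<^sup>2 * gmod e powr - 3)"
      using * by (intro sum_mono2) (auto simp: E_def)
    also have "\<dots> = 36 * A * B\<^sup>2 * (\<Sum>e\<in>disc A - {0}. gmod e powr - 3)" by (simp only: sum_distrib_left)
    also have "\<dots> \<le> 36 * A * B\<^sup>2 * C" using C(2) * by (intro mult_left_mono) auto
    finally have "real (card (trapezoids A B)) \<le> 36 * C * A * B\<^sup>2" by (simp add: mult_ac)
    moreover have "finite (trapezoids A B)" using fS inj unfolding S_def by (rule finite_imageD)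
    ultimately show ?thesis by simp
  qed
  then show ?thesis using C(1) by (intro exI[of _ "36 * C"]) auto
qed

section \<open>Collinear triples and the total count\<close>

definition line_through_origin :: "real \<Rightarrow> real \<Rightarrow> real \<Rightarrow> (gauss \<times> gauss \<times> gauss) set" where
  "line_through_origin a b c = {(z1, z2, z3). z1 \<noteq> 0 \<and> z2 \<noteq> 0 \<and> z3 \<noteq> 0 \<and> gmod z1 \<le> a \<and> gmod z2 \<le> b \<and> gmod z3 \<le> c \<and>
     gim (z1 * gcnj z2) = 0 \<and> gim (z1 * gcnj z3) = 0}"

text \<open>The three points are nonzero integer multiples of one primitive \<open>e\<close>.
  Excluding the multiple \<open>0\<close> avoids additive constants: each \<open>e\<close>
  contributes at most \<open>8 * a * b * c / gmod e ^ 3\<close>, which is summable.\<close>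

lemma card_line_through_origin:
  "\<exists>C>0. \<forall>a b c. 0 \<le> a \<longrightarrow> 0 \<le> b \<longrightarrow> 0 \<le> c \<longrightarrow> finite (line_through_origin a b c) \<and>
    real (card (line_through_origin a b c)) \<le> C * a * b * c"
proof -
  obtain C where C: "C > 0" "\<And>A. (\<Sum>e\<in>disc A - {0}. gmod e powr - 3) \<le> C"
    using sum_disc_powr_bounded[of 3] by auto
  have "finite (line_through_origin a b c) \<and> real (card (line_through_origin a b c)) \<le> 8 * C * a * b * c"
    if *: "0 \<le> a" "0 \<le> b" "0 \<le> c" for a b c
  proof -
    define I where "I r e = {t::int. t \<noteq> 0 \<and> \<bar>of_int t\<bar> \<le> r / gmod e}" for r e
    define T where "T e = I a e \<times> I b e \<times> I c e" for e
    have I: "finite (I r e)" "real (card (I r e)) \<le> 2 * (r / gmod e)" if "r \<ge> 0" for r e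
    proof -
      have A: "r / gmod e \<ge> 0" using that by simp
      have "I r e \<subseteq> {l. \<bar>of_int l\<bar> \<le> r / gmod e}" by (auto simp: I_def)
      then show "finite (I r e)" using card_int_abs_le(1)[OF A] by (rule finite_subset)
      have "real (card (I r e)) = 2 * real (nat \<lfloor>r / gmod e\<rfloor>)"
        using sum_nonzero_ints[OF A, of "\<lambda>_. 1"] by (simp add: I_def)
      also have "\<dots> \<le> 2 * (r / gmod e)" using A by (intro mult_left_mono of_nat_floor) auto
      finally show "real (card (I r e)) \<le> 2 * (r / gmod e)" .
    qed
    have sub: "line_through_origin a b c \<subseteq> (\<lambda>(e, t1, t2, t3). (of_int t1 * e, of_int t2 * e, of_int t3 * e)) ` (SIGMA e : disc a - {0}. T e)"
    proof
      fix x assume "x \<in> line_through_origin a b c"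
      then obtain z1 z2 z3 where x: "x = (z1, z2, z3)" and h: "z1 \<noteq> 0" "z2 \<noteq> 0" "z3 \<noteq> 0" "gmod z1 \<le> a" "gmod z2 \<le> b" "gmod z3 \<le> c"
        "gim (z1 * gcnj z2) = 0" "gim (z1 * gcnj z3) = 0" by (auto simp: line_through_origin_def)
      obtain t e where te: "t > 0" "z1 = of_int t * e" "primitive e" "e \<noteq> 0" using primitive_decompose[OF h(1)] .
      have "\<exists>s. z = of_int s * e" if "gim (z1 * gcnj z) = 0" for z
      proof -
        have "t * gim (z * gcnj e) = - gim (z1 * gcnj z)" unfolding te(2) by (simp add: algebra_simps)
        then have "gim (z * gcnj e) = 0" using that te(1) by simp
        then show ?thesis using parallel_primitive[OF te(3)] by metis
      qed
      then obtain s2 s3 where s: "z2 = of_int s2 * e" "z3 = of_int s3 * e" using h by metis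
      have dI: "k \<in> I r e" if "gmod (of_int k * e) \<le> r" "of_int k * e \<noteq> 0" for k r
        using that te(4) by (auto simp: I_def gmod_mult field_simps)
      have "t \<in> I a e" "s2 \<in> I b e" "s3 \<in> I c e" using h dI unfolding te(2) s by auto
      moreover have "e \<in> disc a - {0}"
        using gmod_dvd_le[of e z1] h te by (auto simp: disc_def)
      ultimately show "x \<in> (\<lambda>(e, t1, t2, t3). (of_int t1 * e, of_int t2 * e, of_int t3 * e)) ` (SIGMA e : disc a - {0}. T e)"
        by (intro image_eqI[of _ _ "(e, t, s2, s3)"]) (auto simp: T_def x te s)
    qed
    have fT: "finite (T e)" "real (card (T e)) \<le> 8 * a * b * c * gmod e powr - 3" if "e \<in> disc a - {0}" for e
    proof -
      have ge: "gmod e > 0" using that by simp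
      show "finite (T e)" using I * by (simp add: T_def)
      have "real (card (T e)) = real (card (I a e)) * (real (card (I b e)) * real (card (I c e)))"
        by (simp add: T_def card_cartesian_product)
      also have "\<dots> \<le> 2 * (a / gmod e) * (2 * (b / gmod e) * (2 * (c / gmod e)))"
        using I * by (intro mult_mono mult_nonneg_nonneg) auto
      also have "\<dots> = 8 * a * b * c * gmod e powr - 3"
        using ge by (simp add: powr_minus_divide power3_eq_cube mult_ac)
      finally show "real (card (T e)) \<le> 8 * a * b * c * gmod e powr - 3" .
    qed
    have "real (card (line_through_origin a b c)) \<le> real (card (SIGMA e : disc a - {0}. T e))"
      using sub fT by (intro of_nat_mono surj_card_le finite_SigmaI) auto
    also have "\<dots> = (\<Sum>e\<in>disc a - {0}. real (card (T e)))" using fT by simp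
    also have "\<dots> \<le> (\<Sum>e\<in>disc a - {0}. 8 * a * b * c * gmod e powr - 3)" using fT by (intro sum_mono)
    also have "\<dots> = 8 * a * b * c * (\<Sum>e\<in>disc a - {0}. gmod e powr - 3)" by (simp only: sum_distrib_left)
    also have "\<dots> \<le> 8 * a * b * c * C" using C(2) * by (intro mult_left_mono) auto
    finally have "real (card (line_through_origin a b c)) \<le> 8 * C * a * b * c" by (simp add: mult_ac)
    moreover have "finite (line_through_origin a b c)" using sub
      by (rule finite_subset) (intro finite_imageI finite_SigmaI, use fT in auto)
    ultimately show ?thesis by simp
  qed
  then show ?thesis using C(1) by (intro exI[of _ "8 * C"]) auto
qed

definition cocircular_triples :: "real \<Rightarrow> real \<Rightarrow> real \<Rightarrow> (gauss \<times> gauss \<times> gauss) set" where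
  "cocircular_triples a b c = {(z1, z2, z3). gmod z1 \<le> a \<and> gmod z2 \<le> b \<and> gmod z3 \<le> c \<and> cocircular z1 z2 z3}"

lemma finite_cocircular_triples [simp]: "finite (cocircular_triples a b c)"
proof -
  have "cocircular_triples a b c \<subseteq> disc a \<times> disc b \<times> disc c" by (auto simp: cocircular_triples_def disc_def)
  then show ?thesis by (rule finite_subset) auto
qed

text \<open>The nondegenerate count is applied with \<open>r = b\<close> and \<open>N = c\<close>;
  its saving in \<open>c\<close> alone is enough because \<open>a \<ge> 1\<close>. All degenerate
  families are \<open>O(a * b * c)\<close>, which is \<open>b * c\<^sup>2 * (a / c)\<close> up to a
  constant and hence stronger, as \<open>a / c \<le> 1\<close>.\<close>

theorem card_cocircular_triples:
  "\<exists>C>0. \<forall>a b c. 1 \<le> a \<longrightarrow> a \<le> b \<longrightarrow> b \<le> c \<longrightarrow>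
    real (card (cocircular_triples a b c)) \<le> C * b * c\<^sup>2 * (a / c) powr (1 / 250)"
proof -
  obtain C1 where C1: "C1 > 0" "\<And>r N. 1 \<le> r \<Longrightarrow> r \<le> N \<Longrightarrow> real (card (nd_triples r N)) \<le> C1 * r * N powr (2 - 1 / 250)"
    using card_nd_triples by auto
  obtain C2 where C2: "C2 > 0" "\<And>A B. 0 \<le> A \<Longrightarrow> 0 \<le> B \<Longrightarrow> finite (trapezoids A B) \<and> real (card (trapezoids A B)) \<le> C2 * A * B\<^sup>2"
    using card_trapezoids by auto
  obtain C3 where C3: "C3 > 0" "\<And>a b c. 0 \<le> a \<Longrightarrow> 0 \<le> b \<Longrightarrow> 0 \<le> c \<Longrightarrow> finite (line_through_origin a b c) \<and>
    real (card (line_through_origin a b c)) \<le> C3 * a * b * c"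
    using card_line_through_origin by auto
  have "real (card (cocircular_triples a b c)) \<le> (C1 + C3 + 3 * C2) * b * c\<^sup>2 * (a / c) powr (1 / 250)"
    if *: "1 \<le> a" "a \<le> b" "b \<le> c" for a b c
  proof -
    define rot where "rot = (\<lambda>(w, u, v). (u, v, w) :: gauss \<times> gauss \<times> gauss)"
    let ?N = "nd_triples b c" and ?L = "line_through_origin a b c"
    \<comment> \<open>The side \<open>w\<close> may be any of the three points, and \<open>u\<close>
      is the one of the other two with the smaller size bound; then each
      \<open>A * B\<^sup>2\<close> is at most \<open>a * b * c\<close>.\<close>
    let ?T1 = "trapezoids a b" and ?T2 = "trapezoids b a" and ?T3 = "trapezoids c a"
    have pos: "0 \<le> a" "0 \<le> b" "0 \<le> c" "0 < c" using * by auto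
    have fin: "finite ?L" "finite ?T1" "finite ?T2" "finite ?T3" using C2(2) C3(2) pos by auto
    have sub: "cocircular_triples a b c \<subseteq> ?N \<union> (?L \<union> (?T1 \<union> (swap12 ` ?T2 \<union> rot ` ?T3)))"
    proof
      fix x assume "x \<in> cocircular_triples a b c"
      then obtain z1 z2 z3 where x: "x = (z1, z2, z3)" "gmod z1 \<le> a" "gmod z2 \<le> b" "gmod z3 \<le> c" "cocircular z1 z2 z3"
        by (auto simp: cocircular_triples_def)
      then have nz: "z1 \<noteq> 0" "z2 \<noteq> 0" "z3 \<noteq> 0" by (auto simp: cocircular_def)
      show "x \<in> ?N \<union> (?L \<union> (?T1 \<union> (swap12 ` ?T2 \<union> rot ` ?T3)))"
      proof (cases "nondegenerate z1 z2 z3")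
        case True
        then have "x \<in> ?N" using x * by (auto simp: nd_triples_def)
        then show ?thesis by blast
      next
        case False
        from degenerate_cases[OF x(5) this] show ?thesis
        proof (elim disjE)
          assume "trapezoid z2 z1 z3"
          then have "(z2, z1, z3) \<in> ?T2" using x nz by (auto simp: trapezoids_def)
          then show ?thesis by (force simp: x swap12_def)
        next
          assume "trapezoid z3 z1 z2"
          then have "(z3, z1, z2) \<in> ?T3" using x nz by (auto simp: trapezoids_def)
          then show ?thesis by (force simp: x rot_def)
        qed (use x nz in \<open>auto simp: trapezoids_def line_through_origin_def\<close>)
      qed
    qed
    have "card (cocircular_triples a b c) \<le> card (?N \<union> (?L \<union> (?T1 \<union> (swap12 ` ?T2 \<union> rot ` ?T3))))"
      using sub fin by (intro card_mono) auto
    also have "\<dots> \<le> card ?N + (card ?L + (card ?T1 + (card ?T2 + card ?T3)))"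
      using card_image_le[OF fin(3), of swap12] card_image_le[OF fin(4), of rot]
      by (meson add_mono card_Un_le le_refl order.trans)
    finally have "real (card (cocircular_triples a b c)) \<le>
        real (card ?N) + real (card ?L) + real (card ?T1) + real (card ?T2) + real (card ?T3)" by linarith
    also have "\<dots> \<le> C1 * b * c powr (2 - 1 / 250) + C3 * a * b * c + C2 * a * b\<^sup>2 + C2 * b * a\<^sup>2 + C2 * c * a\<^sup>2"
      using C1(2)[of b c] C2(2)[of a b] C2(2)[of b a] C2(2)[of c a] C3(2)[of a b c] * by (intro add_mono) auto
    also have "\<dots> \<le> C1 * (b * c\<^sup>2 * (a / c) powr (1 / 250)) + (C3 + 3 * C2) * (a * b * c)"
    proof -
      have "c powr (2 - 1 / 250) = c\<^sup>2 * (1 / c) powr (1 / 250)"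
        unfolding powr_diff using pos by (simp add: powr_divide)
      also have "\<dots> \<le> c\<^sup>2 * (a / c) powr (1 / 250)" using * pos by (intro mult_left_mono powr_mono2) (auto simp: divide_right_mono)
      finally have 1: "C1 * b * c powr (2 - 1 / 250) \<le> C1 * (b * c\<^sup>2 * (a / c) powr (1 / 250))"
        using C1(1) pos by (simp add: mult.assoc mult_left_mono)
      have i: "a * b * b \<le> a * b * c" "b * a * a \<le> b * a * c" "c * a * a \<le> c * a * b"
        using * pos by (intro mult_left_mono; simp)+
      have "C2 * (a * b * b) \<le> C2 * (a * b * c)" "C2 * (b * a * a) \<le> C2 * (b * a * c)" "C2 * (c * a * a) \<le> C2 * (c * a * b)"
        using C2(1) i by (auto intro: mult_left_mono)
      then show ?thesis using 1 by (simp add: power2_eq_square algebra_simps)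
    qed
    also have "\<dots> \<le> C1 * (b * c\<^sup>2 * (a / c) powr (1 / 250)) + (C3 + 3 * C2) * (b * c\<^sup>2 * (a / c) powr (1 / 250))"
    proof (intro add_left_mono mult_left_mono)
      have "a * b * c = b * c\<^sup>2 * (a / c) powr 1" using pos * by (simp add: power2_eq_square)
      also have "\<dots> \<le> b * c\<^sup>2 * (a / c) powr (1 / 250)"
        using * pos by (intro mult_left_mono powr_mono') auto
      finally show "a * b * c \<le> b * c\<^sup>2 * (a / c) powr (1 / 250)" .
    qed (use C2(1) C3(1) in simp)
    finally show ?thesis by (simp add: algebra_simps)
  qed
  moreover have "C1 + C3 + 3 * C2 > 0" using C1 C2 C3 by simp
  ultimately show ?thesis by blast
qed

section \<open>Random selection from blocks\<close>

lemma ennreal_exists_le_average: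
  fixes f :: "'b \<Rightarrow> ennreal"
  assumes "finite F" "F \<noteq> {}" "(\<Sum>B\<in>F. f B) \<le> of_nat (card F) * c"
  shows "\<exists>B\<in>F. f B \<le> c"
proof -
  have "Min (f ` F) \<in> f ` F" using assms by simp
  then obtain B where B: "B \<in> F" "f B = Min (f ` F)" by (metis imageE)
  have "of_nat (card F) * f B \<le> (\<Sum>B\<in>F. f B)"
    using assms B by (intro sum_bounded_below) auto
  also have "\<dots> \<le> of_nat (card F) * c" by (rule assms)
  finally have "f B \<le> c"
    using assms by (subst (asm) ennreal_mult_le_mult_iff) auto
  with B show ?thesis by blast
qed

text \<open>A random set picks one member of each family \<open>F k\<close>, uniformly and independently;
  \<open>p z\<close> bounds the probability that it contains \<open>z\<close>. The sets in \<open>Q m\<close> have their last point in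
  block \<open>m\<close>, and \<open>N m\<close> is the order of magnitude of the number of them that may survive.\<close>

locale block_selection =
  fixes V :: "nat \<Rightarrow> 'a set" and F :: "nat \<Rightarrow> 'a set set" and p :: "'a \<Rightarrow> real"
    and Q :: "nat \<Rightarrow> 'a set set" and N :: "nat \<Rightarrow> real" and \<theta> \<epsilon> :: real
  assumes disjoint: "i \<noteq> j \<Longrightarrow> V i \<inter> V j = {}"
    and V0: "V 0 = {}"
    and F: "finite (F k)" "F k \<noteq> {}" "B \<in> F k \<Longrightarrow> B \<subseteq> V k"
    and p: "p z \<ge> 0"
    and prob: "T \<subseteq> V k \<Longrightarrow> finite T \<Longrightarrow> real (card {B \<in> F k. T \<subseteq> B}) \<le> real (card (F k)) * (\<Prod>z\<in>T. p z)"
    and Q: "finite (Q m)" "q \<in> Q m \<Longrightarrow> finite q" "q \<in> Q m \<Longrightarrow> q \<noteq> {}" "q \<in> Q m \<Longrightarrow> q \<subseteq> (\<Union>k\<le>m. V k)"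
    and N: "N m > 0"
    and \<theta>: "0 < \<theta>" "\<theta> < 1" and \<epsilon>: "\<epsilon> > 0"
    and weight: "j \<le> m \<Longrightarrow> (\<Sum>q\<in>{q \<in> Q m. q \<inter> V j \<noteq> {} \<and> q \<inter> (\<Union>k<j. V k) = {}}. \<Prod>z\<in>q. p z) \<le> \<epsilon> * N m * \<theta> ^ (2 * (m - j))"
begin

definition "U j = (\<Union>k\<le>j. V k)"

text \<open>The conditional expectation of the number of surviving sets in \<open>Q m\<close> that meet the first \<open>j\<close> blocks,
  once the random set is known to be \<open>A\<close> there.\<close>

definition "expected j m A = (\<Sum>q\<in>Q m. if q \<inter> U j \<noteq> {} \<and> q \<inter> U j \<subseteq> A then \<Prod>z\<in>q - U j. p z else 0)"

text \<open>A set enters the count only when the process reaches the first block it meets, and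
  \<open>fresh\<close> is the weight entering at step \<open>j\<close>. Counting all sets from the
  start would leave only a bound of order \<open>\<epsilon> * N m\<close> for each \<open>m\<close>,
  too weak for the potential to converge.\<close>

definition "fresh j m = (\<Sum>q\<in>{q \<in> Q m. q \<inter> V j \<noteq> {} \<and> q \<inter> (\<Union>k<j. V k) = {}}. \<Prod>z\<in>q. p z)"

text \<open>Because of the division by \<open>\<theta> ^ i\<close>, passing to the next block
  multiplies old terms by \<open>\<theta>\<close>, while weights entering \<open>i\<close> blocks
  ahead, of size \<open>\<epsilon> * N (j + i) * \<theta> ^ (2 * i)\<close>, still give a geometric
  series. Values in \<open>ennreal\<close> spare a convergence proof.\<close>

definition "potential j A = (\<Sum>i. ennreal (expected j (j + i) A / (N (j + i) * \<theta> ^ i)))"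

lemma U_Suc: "U (Suc j) = U j \<union> V (Suc j)"
  by (auto simp: U_def atMost_Suc)

lemma U_disjoint: "U j \<inter> V (Suc j) = {}"
proof -
  have "V k \<inter> V (Suc j) = {}" if "k \<le> j" for k using disjoint[of k "Suc j"] that by simp
  then show ?thesis by (auto simp: U_def)
qed

lemma expected_nonneg: "expected j m A \<ge> 0"
  unfolding expected_def by (intro sum_nonneg) (auto intro!: prod_nonneg p)

text \<open>Averaging over \<open>B\<close> turns the event that \<open>q \<inter> V (Suc j)\<close>
  lies in \<open>B\<close> into a factor bounded by the product of \<open>p\<close> over that
  intersection, which completes the product over \<open>q - U j\<close>. Sets met for the first time
  account for \<open>fresh\<close>.\<close>

lemma expected_step:
  assumes A: "A \<subseteq> U j"
  shows "(\<Sum>B\<in>F (Suc j). expected (Suc j) m (A \<union> B)) \<le> real (card (F (Suc j))) * (expected j m A + fresh (Suc j) m)"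
proof -
  define f where "f q = (if q \<inter> U j \<noteq> {} \<and> q \<inter> U j \<subseteq> A then \<Prod>z\<in>q - U j. p z else 0) +
    (if q \<inter> V (Suc j) \<noteq> {} \<and> q \<inter> U j = {} then \<Prod>z\<in>q. p z else 0)" for q
  have f0: "f q \<ge> 0" for q unfolding f_def by (auto intro!: add_nonneg_nonneg prod_nonneg p)
  have step: "(\<Sum>B\<in>F (Suc j). if q \<inter> U (Suc j) \<noteq> {} \<and> q \<inter> U (Suc j) \<subseteq> A \<union> B then \<Prod>z\<in>q - U (Suc j). p z else 0)
      \<le> real (card (F (Suc j))) * f q" if q: "q \<in> Q m" for q
  proof (cases "q \<inter> U (Suc j) \<noteq> {} \<and> q \<inter> U j \<subseteq> A")
    case True
    have iff: "q \<inter> U (Suc j) \<subseteq> A \<union> B \<longleftrightarrow> q \<inter> V (Suc j) \<subseteq> B" if "B \<in> F (Suc j)" for B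
      using True A F(3)[OF that] U_disjoint[of j] by (auto simp: U_Suc)
    define r where "r = (\<Prod>z\<in>q - U (Suc j). p z)"
    have r0: "r \<ge> 0" unfolding r_def by (intro prod_nonneg) (simp add: p)
    have "(\<Sum>B\<in>F (Suc j). if q \<inter> U (Suc j) \<noteq> {} \<and> q \<inter> U (Suc j) \<subseteq> A \<union> B then r else 0)
      = (\<Sum>B\<in>F (Suc j). if q \<inter> V (Suc j) \<subseteq> B then r else 0)"
      using True iff by (intro sum.cong) auto
    also have "\<dots> = real (card {B \<in> F (Suc j). q \<inter> V (Suc j) \<subseteq> B}) * r"
      using F(1) by (simp add: sum.If_cases Int_def)
    also have "\<dots> \<le> real (card (F (Suc j))) * (\<Prod>z\<in>q \<inter> V (Suc j). p z) * r"
      using Q(2)[OF q] by (intro mult_right_mono prob r0) auto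
    also have "(\<Prod>z\<in>q \<inter> V (Suc j). p z) * r = (\<Prod>z\<in>q - U j. p z)"
    proof -
      have "q - U j = (q \<inter> V (Suc j)) \<union> (q - U (Suc j))" using U_disjoint[of j] by (auto simp: U_Suc)
      moreover have "(q \<inter> V (Suc j)) \<inter> (q - U (Suc j)) = {}" by (auto simp: U_Suc)
      ultimately show ?thesis using Q(2)[OF q] by (simp add: r_def prod.union_disjoint)
    qed
    then have "real (card (F (Suc j))) * (\<Prod>z\<in>q \<inter> V (Suc j). p z) * r = real (card (F (Suc j))) * (\<Prod>z\<in>q - U j. p z)"
      by (simp only: mult.assoc)
    also have "(\<Prod>z\<in>q - U j. p z) \<le> f q"
    proof (cases "q \<inter> U j = {}")
      case e: True
      then have "q \<inter> V (Suc j) \<noteq> {}" "q - U j = q" using True by (auto simp: U_Suc)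
      then show ?thesis using e by (simp add: f_def)
    next
      case False
      then show ?thesis using True by (simp add: f_def)
    qed
    finally show ?thesis unfolding r_def by (simp add: mult_left_mono)
  next
    case False
    have no: "\<not> (q \<inter> U (Suc j) \<noteq> {} \<and> q \<inter> U (Suc j) \<subseteq> A \<union> B)" if "B \<in> F (Suc j)" for B
      using False F(3)[OF that] U_disjoint[of j] by (auto simp: U_Suc)
    then have "(\<Sum>B\<in>F (Suc j). if q \<inter> U (Suc j) \<noteq> {} \<and> q \<inter> U (Suc j) \<subseteq> A \<union> B then \<Prod>z\<in>q - U (Suc j). p z else 0) = 0"
      by (intro sum.neutral) auto
    also have "0 \<le> real (card (F (Suc j))) * f q" using f0 by simp
    finally show ?thesis .
  qed
  have "(\<Sum>B\<in>F (Suc j). expected (Suc j) m (A \<union> B)) = (\<Sum>q\<in>Q m. \<Sum>B\<in>F (Suc j).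
      if q \<inter> U (Suc j) \<noteq> {} \<and> q \<inter> U (Suc j) \<subseteq> A \<union> B then \<Prod>z\<in>q - U (Suc j). p z else 0)"
    unfolding expected_def by (rule sum.swap)
  also have "\<dots> \<le> (\<Sum>q\<in>Q m. real (card (F (Suc j))) * f q)" by (intro sum_mono step)
  also have "\<dots> = real (card (F (Suc j))) * (\<Sum>q\<in>Q m. f q)" by (simp add: sum_distrib_left)
  also have "(\<Sum>q\<in>Q m. f q) = expected j m A + fresh (Suc j) m"
  proof -
    have "(\<Union>k<Suc j. V k) = U j" by (auto simp: U_def less_Suc_eq_le)
    then show ?thesis
      using Q(1)[of m] by (simp add: f_def expected_def fresh_def sum.distrib sum.If_cases Int_def)
  qed
  finally show ?thesis .
qed

text \<open>The fixed point of \<open>K = \<theta> * K + \<epsilon> / (1 - \<theta>)\<close>, the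
  recursion governing an average step.\<close>

definition "K = \<epsilon> / (1 - \<theta>)\<^sup>2"

lemma potential_step:
  assumes A: "A \<subseteq> U j" and pot: "potential j A \<le> ennreal K"
  shows "\<exists>B\<in>F (Suc j). potential (Suc j) (A \<union> B) \<le> ennreal K"
proof (rule ennreal_exists_le_average)
  let ?F = "F (Suc j)"
  define c where "c i = N (Suc j + i) * \<theta> ^ i" for i
  have c: "c i > 0" for i using N \<theta> by (simp add: c_def)
  have fr: "fresh (Suc j) (Suc j + i) / c i \<le> \<epsilon> * \<theta> ^ i" for i
  proof -
    have "fresh (Suc j) (Suc j + i) \<le> \<epsilon> * N (Suc j + i) * \<theta> ^ (2 * i)"
      using weight[of "Suc j" "Suc j + i"] by (simp add: fresh_def)
    also have "\<dots> = \<epsilon> * \<theta> ^ i * c i" by (simp add: c_def mult_2 power_add)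
    finally show ?thesis using c[of i] by (simp add: divide_le_eq)
  qed
  have "(\<Sum>B\<in>?F. potential (Suc j) (A \<union> B)) = (\<Sum>i. \<Sum>B\<in>?F. ennreal (expected (Suc j) (Suc j + i) (A \<union> B) / c i))"
    unfolding potential_def c_def by (rule suminf_sum[symmetric]) simp
  also have "\<dots> \<le> (\<Sum>i. ennreal (real (card ?F)) * (ennreal \<theta> * ennreal (expected j (j + Suc i) A / (N (j + Suc i) * \<theta> ^ Suc i)) + ennreal (\<epsilon> * \<theta> ^ i)))"
  proof (intro suminf_le allI)
    fix i
    have "(\<Sum>B\<in>?F. ennreal (expected (Suc j) (Suc j + i) (A \<union> B) / c i)) =
       ennreal ((\<Sum>B\<in>?F. expected (Suc j) (Suc j + i) (A \<union> B)) / c i)"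
      using c[of i] expected_nonneg by (simp add: sum_ennreal sum_divide_distrib)
    also have "\<dots> \<le> ennreal (real (card ?F) * (expected j (Suc j + i) A + fresh (Suc j) (Suc j + i)) / c i)"
      using expected_step[OF A, of "Suc j + i"] c[of i] by (intro ennreal_leI divide_right_mono) auto
    also have "\<dots> \<le> ennreal (real (card ?F) * (\<theta> * (expected j (j + Suc i) A / (N (j + Suc i) * \<theta> ^ Suc i)) + \<epsilon> * \<theta> ^ i))"
    proof (intro ennreal_leI)
      have "expected j (Suc j + i) A / c i = \<theta> * (expected j (j + Suc i) A / (N (j + Suc i) * \<theta> ^ Suc i))"
        using \<theta> by (simp add: c_def)
      then have "(expected j (Suc j + i) A + fresh (Suc j) (Suc j + i)) / c i \<le>
         \<theta> * (expected j (j + Suc i) A / (N (j + Suc i) * \<theta> ^ Suc i)) + \<epsilon> * \<theta> ^ i"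
        using fr[of i] by (simp add: add_divide_distrib)
      then show "real (card ?F) * (expected j (Suc j + i) A + fresh (Suc j) (Suc j + i)) / c i \<le>
         real (card ?F) * (\<theta> * (expected j (j + Suc i) A / (N (j + Suc i) * \<theta> ^ Suc i)) + \<epsilon> * \<theta> ^ i)"
        unfolding times_divide_eq_right[symmetric] by (intro mult_left_mono) auto
    qed
    also have "\<dots> = ennreal (real (card ?F)) * (ennreal \<theta> * ennreal (expected j (j + Suc i) A / (N (j + Suc i) * \<theta> ^ Suc i)) + ennreal (\<epsilon> * \<theta> ^ i))"
    proof -
      have "ennreal (r * (t * x + y)) = ennreal r * (ennreal t * ennreal x + ennreal y)"
        if "0 \<le> r" "0 \<le> t" "0 \<le> x" "0 \<le> y" for r t x y
        using that by (simp add: ennreal_mult)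
      moreover have "0 \<le> expected j (j + Suc i) A / (N (j + Suc i) * \<theta> ^ Suc i)"
        using expected_nonneg N[of "j + Suc i"] \<theta> by (intro divide_nonneg_nonneg) auto
      moreover have "0 \<le> \<epsilon> * \<theta> ^ i" using \<theta> \<epsilon> by simp
      ultimately show ?thesis using \<theta> by (meson less_eq_real_def of_nat_0_le_iff)
    qed
    finally show "(\<Sum>B\<in>?F. ennreal (expected (Suc j) (Suc j + i) (A \<union> B) / c i)) \<le>
       ennreal (real (card ?F)) * (ennreal \<theta> * ennreal (expected j (j + Suc i) A / (N (j + Suc i) * \<theta> ^ Suc i)) + ennreal (\<epsilon> * \<theta> ^ i))" .
  qed simp_all
  also have "\<dots> = ennreal (real (card ?F)) * (ennreal \<theta> * (\<Sum>i. ennreal (expected j (j + Suc i) A / (N (j + Suc i) * \<theta> ^ Suc i))) + (\<Sum>i. ennreal (\<epsilon> * \<theta> ^ i)))"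
    by (simp only: ennreal_suminf_cmult suminf_add[symmetric] summableI)
  also have "(\<Sum>i. ennreal (\<epsilon> * \<theta> ^ i)) = ennreal (\<epsilon> / (1 - \<theta>))"
  proof -
    have "(\<lambda>i. \<epsilon> * \<theta> ^ i) sums (\<epsilon> * (1 / (1 - \<theta>)))" using \<theta> by (intro sums_mult geometric_sums) simp
    then show ?thesis using \<theta> \<epsilon> by (intro suminf_ennreal_eq) auto
  qed
  also have "ennreal (real (card ?F)) * (ennreal \<theta> * (\<Sum>i. ennreal (expected j (j + Suc i) A / (N (j + Suc i) * \<theta> ^ Suc i))) + ennreal (\<epsilon> / (1 - \<theta>)))
      \<le> ennreal (real (card ?F)) * (ennreal \<theta> * ennreal K + ennreal (\<epsilon> / (1 - \<theta>)))"
  proof -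
    \<comment> \<open>The shifted sum omits the term \<open>i = 0\<close>, which concerns the sets
      whose last block is already decided.\<close>
    have "(\<Sum>i. ennreal (expected j (j + Suc i) A / (N (j + Suc i) * \<theta> ^ Suc i))) \<le> potential j A"
      unfolding potential_def
      by (subst (2) suminf_offset[where i = 1]) (auto simp: summableI)
    then have "(\<Sum>i. ennreal (expected j (j + Suc i) A / (N (j + Suc i) * \<theta> ^ Suc i))) \<le> ennreal K"
      using pot by (rule order_trans)
    then show ?thesis by (intro mult_left_mono add_right_mono) auto
  qed
  also have "ennreal \<theta> * ennreal K + ennreal (\<epsilon> / (1 - \<theta>)) = ennreal K"
  proof -
    have "\<epsilon> / (1 - \<theta>) = (1 - \<theta>) * K" using \<theta> by (simp add: K_def power2_eq_square)
    then have "\<theta> * K + \<epsilon> / (1 - \<theta>) = K" by (simp add: algebra_simps)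
    moreover have "K \<ge> 0" using \<epsilon> by (simp add: K_def)
    moreover have "\<epsilon> / (1 - \<theta>) \<ge> 0" using \<theta> \<epsilon> by simp
    ultimately show ?thesis using \<theta> by (simp add: ennreal_mult[symmetric] ennreal_plus[symmetric] del: ennreal_plus)
  qed
  finally show "(\<Sum>B\<in>?F. potential (Suc j) (A \<union> B)) \<le> of_nat (card ?F) * ennreal K"
    by (simp add: ennreal_of_nat_eq_real_of_nat)
qed (rule F)+

text \<open>Once block \<open>m\<close> is decided, \<open>expected m m\<close> is the exact number
  of surviving sets in \<open>Q m\<close>, and as the term \<open>i = 0\<close> it is bounded by the
  whole potential; thus one sequence of choices works for every \<open>m\<close>.\<close>

theorem selection:
  "\<exists>B. (\<forall>k\<ge>1. B k \<in> F k) \<and> (\<forall>m. real (card {q \<in> Q m. q \<subseteq> (\<Union>k\<in>{1..}. B k)}) \<le> K * N m)"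
proof -
  define P where "P j A \<longleftrightarrow> A \<subseteq> U j \<and> potential j A \<le> ennreal K" for j A
  have "\<exists>S. \<forall>j. P j (S j) \<and> (\<exists>B\<in>F (Suc j). S (Suc j) = S j \<union> B)"
  proof (rule dependent_nat_choice)
    have "expected 0 m {} = 0" for m by (simp add: expected_def U_def V0)
    then show "\<exists>A. P 0 A" by (intro exI[of _ "{}"]) (simp add: P_def potential_def)
    fix A j assume "P j A"
    then have A: "A \<subseteq> U j" "potential j A \<le> ennreal K" by (auto simp: P_def)
    from potential_step[OF this] obtain B where B: "B \<in> F (Suc j)" "potential (Suc j) (A \<union> B) \<le> ennreal K" by blast
    then have "P (Suc j) (A \<union> B)" using A F(3)[OF B(1)] by (auto simp: P_def U_Suc)
    then show "\<exists>A'. P (Suc j) A' \<and> (\<exists>B\<in>F (Suc j). A' = A \<union> B)" using B by blast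
  qed
  then obtain S where S: "\<And>j. P j (S j)" "\<And>j. \<exists>B\<in>F (Suc j). S (Suc j) = S j \<union> B" by blast
  then obtain B' where B': "\<And>j. B' j \<in> F (Suc j)" "\<And>j. S (Suc j) = S j \<union> B' j" by metis
  define B where "B k = B' (k - 1)" for k
  have S0: "S 0 = {}" using S(1)[of 0] by (simp add: P_def U_def V0)
  have SB: "S j = (\<Union>k\<in>{1..j}. B k)" for j
  proof (induction j)
    case (Suc j)
    have "{1..Suc j} = insert (Suc j) {1..j}" by auto
    then show ?case using Suc B'(2)[of j] by (auto simp: B_def)
  qed (simp add: S0)
  have BV: "B k \<subseteq> V k" "B k \<in> F k" if "k \<ge> 1" for k
    using F(3) B'(1)[of "k - 1"] that by (auto simp: B_def)
  have "real (card {q \<in> Q m. q \<subseteq> (\<Union>k\<in>{1..}. B k)}) \<le> K * N m" for m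
  proof -
    have sub: "(\<Union>k\<in>{1..}. B k) \<inter> U m \<subseteq> S m"
    proof
      fix z assume "z \<in> (\<Union>k\<in>{1..}. B k) \<inter> U m"
      then obtain k i where k: "k \<ge> 1" "z \<in> B k" "i \<le> m" "z \<in> V i" by (auto simp: U_def)
      then have "k = i" using BV(1)[OF k(1)] disjoint[of k i] by blast
      with k show "z \<in> S m" by (auto simp: SB)
    qed
    have qU: "q \<subseteq> U m" if "q \<in> Q m" for q using Q(4)[OF that] by (simp add: U_def)
    have "expected m m (S m) = (\<Sum>q\<in>Q m. if q \<subseteq> S m then 1 else 0)"
      unfolding expected_def
    proof (intro sum.cong refl)
      fix q assume q: "q \<in> Q m"
      then have d: "q - U m = {}" using qU by blast
      then have "prod p (q - U m) = 1" by (simp only: prod.empty)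
      moreover have "q \<inter> U m = q" "q \<noteq> {}" using d q Q(3) by auto
      ultimately show "(if q \<inter> U m \<noteq> {} \<and> q \<inter> U m \<subseteq> S m then \<Prod>z\<in>q - U m. p z else 0) = (if q \<subseteq> S m then 1 else 0)"
        by simp
    qed
    also have "\<dots> = real (card {q \<in> Q m. q \<subseteq> S m})" using Q(1) by (simp add: sum.If_cases Int_def)
    finally have e: "expected m m (S m) = real (card {q \<in> Q m. q \<subseteq> S m})" .
    have "ennreal (expected m m (S m) / N m) \<le> potential m (S m)"
      unfolding potential_def
      using sum_le_suminf[of "\<lambda>i. ennreal (expected m (m + i) (S m) / (N (m + i) * \<theta> ^ i))" "{0}"] by simp
    also have "\<dots> \<le> ennreal K" using S(1)[of m] by (simp add: P_def)
    finally have "expected m m (S m) / N m \<le> K"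
      using \<epsilon> by (subst (asm) ennreal_le_iff) (auto simp: K_def)
    then have "real (card {q \<in> Q m. q \<subseteq> S m}) \<le> K * N m" using N[of m] by (simp add: e divide_le_eq)
    moreover have "card {q \<in> Q m. q \<subseteq> (\<Union>k\<in>{1..}. B k)} \<le> card {q \<in> Q m. q \<subseteq> S m}"
    proof (intro card_mono)
      show "finite {q \<in> Q m. q \<subseteq> S m}" using Q(1)[of m] by simp
      show "{q \<in> Q m. q \<subseteq> (\<Union>k\<in>{1..}. B k)} \<subseteq> {q \<in> Q m. q \<subseteq> S m}" using qU sub by blast
    qed
    ultimately show ?thesis by linarith
  qed
  with BV(2) show ?thesis by (intro exI[of _ B]) auto
qed

end

section \<open>The grid of blocks\<close>

definition to_gauss :: "int \<times> int \<Rightarrow> gauss" where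
  "to_gauss p = Gauss (fst p) (snd p)"

lemma to_gauss_sel [simp]: "gre (to_gauss p) = fst p" "gim (to_gauss p) = snd p"
  by (simp_all add: to_gauss_def)

lemma to_gauss_inject: "to_gauss p = to_gauss q \<longleftrightarrow> p = q"
  by (simp add: to_gauss_def prod_eq_iff)

definition bad :: "(int \<times> int) set \<Rightarrow> bool" where
  "bad q \<longleftrightarrow> concyclic (to_plane ` q) \<or> collinear (to_plane ` q)"

text \<open>\<open>D\<close> is the determinant whose rows consist of
  \<open>X\<^sup>2 + Y\<^sup>2\<close>, \<open>X\<close> and \<open>Y\<close>. On a circle through
  the origin the first column is a linear combination of the other two; on a line through the origin
  those two are linearly dependent. Expanded, \<open>D\<close> is the imaginary part in
  \<open>cocircular\<close>.\<close>

lemma cocircular_differences: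
  assumes bad: "bad {p0, p1, p2, p3}" and dist: "distinct [p0, p1, p2, p3]"
  shows "cocircular (to_gauss p1 - to_gauss p0) (to_gauss p2 - to_gauss p0) (to_gauss p3 - to_gauss p0)"
proof -
  define x1 y1 x2 y2 x3 y3 where xy: "x1 = fst p1 - fst p0" "y1 = snd p1 - snd p0" "x2 = fst p2 - fst p0" "y2 = snd p2 - snd p0"
    "x3 = fst p3 - fst p0" "y3 = snd p3 - snd p0"
  define D where "D X1 Y1 X2 Y2 X3 Y3 = (X1\<^sup>2 + Y1\<^sup>2) * (X2 * Y3 - X3 * Y2) - (X2\<^sup>2 + Y2\<^sup>2) * (X1 * Y3 - X3 * Y1) +
    (X3\<^sup>2 + Y3\<^sup>2) * (X1 * Y2 - X2 * Y1)" for X1 Y1 X2 Y2 X3 Y3 :: real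
  have "D (of_int x1) (of_int y1) (of_int x2) (of_int y2) (of_int x3) (of_int y3) = 0"
    using bad unfolding bad_def
  proof
    assume "concyclic (to_plane ` {p0, p1, p2, p3})"
    then obtain z r where s: "to_plane ` {p0, p1, p2, p3} \<subseteq> sphere z r" by (auto simp: concyclic_def)
    obtain a b where z: "z = (a, b)" by (cases z)
    have on: "(a - of_int (fst p))\<^sup>2 + (b - of_int (snd p))\<^sup>2 = r\<^sup>2" if "p \<in> {p0, p1, p2, p3}" for p
    proof -
      have "dist (a, b) (to_plane p) = r" using s that z by auto
      then show ?thesis by (auto simp: to_plane_def dist_prod_def dist_real_def)
    qed
    define \<alpha> \<beta> where ab: "\<alpha> = 2 * (a - of_int (fst p0))" "\<beta> = 2 * (b - of_int (snd p0))"
    have lin: "(of_int (fst p - fst p0))\<^sup>2 + (of_int (snd p - snd p0))\<^sup>2 = \<alpha> * of_int (fst p - fst p0) + \<beta> * of_int (snd p - snd p0)"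
      if "p \<in> {p0, p1, p2, p3}" for p
      using on[OF that] on[of p0] unfolding ab by (simp add: power2_eq_square algebra_simps)
    show ?thesis
      unfolding D_def using lin[of p1] lin[of p2] lin[of p3] unfolding xy[symmetric] by (simp add: algebra_simps)
  next
    assume "collinear (to_plane ` {p0, p1, p2, p3})"
    then obtain u where "\<forall>x\<in>to_plane ` {p0, p1, p2, p3}. \<forall>y\<in>to_plane ` {p0, p1, p2, p3}. \<exists>c. x - y = c *\<^sub>R u"
      unfolding collinear_def by blast
    then have "\<exists>c. to_plane p - to_plane p0 = c *\<^sub>R u" if "p \<in> {p0, p1, p2, p3}" for p using that by blast
    then obtain c where c: "\<And>p. p \<in> {p0, p1, p2, p3} \<Longrightarrow> to_plane p - to_plane p0 = c p *\<^sub>R u" by metis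
    have "real_of_int (fst p - fst p0) = c p * fst u" "real_of_int (snd p - snd p0) = c p * snd u"
      if "p \<in> {p0, p1, p2, p3}" for p
      using c[OF that] by (auto simp: to_plane_def prod_eq_iff)
    then have "of_int x1 = c p1 * fst u" "of_int y1 = c p1 * snd u" "of_int x2 = c p2 * fst u" "of_int y2 = c p2 * snd u"
      "of_int x3 = c p3 * fst u" "of_int y3 = c p3 * snd u" unfolding xy by simp_all
    then show ?thesis by (simp add: D_def algebra_simps)
  qed
  then have "of_int ((x1\<^sup>2 + y1\<^sup>2) * (x2 * y3 - x3 * y2) - (x2\<^sup>2 + y2\<^sup>2) * (x1 * y3 - x3 * y1) +
    (x3\<^sup>2 + y3\<^sup>2) * (x1 * y2 - x2 * y1)) = (0 :: real)" unfolding D_def by simp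
  then have d: "(x1\<^sup>2 + y1\<^sup>2) * (x2 * y3 - x3 * y2) - (x2\<^sup>2 + y2\<^sup>2) * (x1 * y3 - x3 * y1) +
    (x3\<^sup>2 + y3\<^sup>2) * (x1 * y2 - x2 * y1) = 0" by (simp only: of_int_eq_0_iff)
  define z1 z2 z3 where z: "z1 = to_gauss p1 - to_gauss p0" "z2 = to_gauss p2 - to_gauss p0" "z3 = to_gauss p3 - to_gauss p0"
  have "gim (z1 * (z3 - z2) * gcnj (z2 * (z1 - z3))) = 0"
  proof -
    have "gre z1 = x1" "gim z1 = y1" "gre z2 = x2" "gim z2 = y2" "gre z3 = x3" "gim z3 = y3" by (simp_all add: z xy)
    then have "gim (z1 * (z3 - z2) * gcnj (z2 * (z1 - z3))) = (x1\<^sup>2 + y1\<^sup>2) * (x2 * y3 - x3 * y2) -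
        (x2\<^sup>2 + y2\<^sup>2) * (x1 * y3 - x3 * y1) + (x3\<^sup>2 + y3\<^sup>2) * (x1 * y2 - x2 * y1)"
      by (simp add: power2_eq_square algebra_simps)
    then show ?thesis using d by simp
  qed
  moreover have "z1 \<noteq> 0" "z2 \<noteq> 0" "z3 \<noteq> 0" "z1 \<noteq> z2" "z1 \<noteq> z3" "z2 \<noteq> z3"
    using dist by (auto simp: z to_gauss_inject)
  ultimately show ?thesis unfolding z[symmetric] by (simp add: cocircular_def)
qed

text \<open>Disjointness of the cells lets a transversal determine its choice function, and
  containing \<open>T\<close> prescribes the choice in \<open>card T\<close> cells. This is the
  division-free form of a probability bound with one factor \<open>1 / n\<close> per point of
  \<open>T\<close>.\<close>

lemma card_transversals:
  fixes C :: "'i \<Rightarrow> 'a set"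
  assumes I: "finite I" and C: "\<And>i. i \<in> I \<Longrightarrow> finite (C i) \<and> card (C i) = n"
    and disj: "\<And>i j. i \<in> I \<Longrightarrow> j \<in> I \<Longrightarrow> i \<noteq> j \<Longrightarrow> C i \<inter> C j = {}"
    and T: "T \<subseteq> (\<Union>i\<in>I. C i)"
  shows "card {B \<in> (\<lambda>h. h ` I) ` PiE I C. T \<subseteq> B} * n ^ card T \<le> card ((\<lambda>h. h ` I) ` PiE I C)"
proof -
  define H where "H = {h \<in> PiE I C. T \<subseteq> h ` I}"
  have same: "i = j" if "i \<in> I" "j \<in> I" "x \<in> C i" "x \<in> C j" for i j x using disj[OF that(1,2)] that by blast
  have inj: "inj_on (\<lambda>h. h ` I) (PiE I C)"
  proof (rule inj_onI)
    fix h h' assume h: "h \<in> PiE I C" "h' \<in> PiE I C" "h ` I = h' ` I"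
    show "h = h'"
    proof (rule PiE_ext[OF h(1,2)])
      fix i assume i: "i \<in> I"
      then have "h i \<in> h' ` I" using h by blast
      then obtain j where j: "j \<in> I" "h i = h' j" by auto
      then have "i = j" using same[OF i j(1), of "h i"] h i by (auto simp: PiE_def Pi_def)
      then show "h i = h' i" using j by simp
    qed
  qed
  have cardF: "card ((\<lambda>h. h ` I) ` PiE I C) = n ^ card I"
    using I C by (simp add: card_image[OF inj] card_PiE)
  have finPi: "finite (PiE I C)" using I C by (intro finite_PiE) auto
  then have finH: "finite H" by (simp add: H_def)
  have le: "card {B \<in> (\<lambda>h. h ` I) ` PiE I C. T \<subseteq> B} \<le> card H"
  proof -
    have "{B \<in> (\<lambda>h. h ` I) ` PiE I C. T \<subseteq> B} = (\<lambda>h. h ` I) ` H" by (auto simp: H_def)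
    then show ?thesis using card_image_le[OF finH] by simp
  qed
  have "card H * n ^ card T \<le> n ^ card I"
  proof (cases "H = {}")
    case False
    then obtain h0 where h0: "h0 \<in> PiE I C" "T \<subseteq> h0 ` I" by (auto simp: H_def)
    \<comment> \<open>Any one transversal containing \<open>T\<close> shows which cells
      \<open>T\<close> meets; if there is none, the bound is trivial.\<close>
    define J where "J = {i \<in> I. h0 i \<in> T}"
    have "h0 ` J = T" using h0 by (auto simp: J_def)
    moreover have "inj_on h0 J"
    proof (rule inj_onI)
      fix i j assume "i \<in> J" "j \<in> J" "h0 i = h0 j"
      then show "i = j" using same[of i j "h0 i"] h0 by (auto simp: J_def PiE_def Pi_def)
    qed
    ultimately have cJ: "card T = card J" by (metis card_image)
    have "H \<subseteq> PiE I (\<lambda>i. if i \<in> J then {h0 i} else C i)"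
    proof
      fix h assume h: "h \<in> H"
      have "h i = h0 i" if "i \<in> J" for i
      proof -
        have i: "i \<in> I" "h0 i \<in> T" using that by (auto simp: J_def)
        then have "h0 i \<in> h ` I" using h by (auto simp: H_def)
        then obtain j where j: "j \<in> I" "h0 i = h j" by auto
        then have "i = j" using same[OF i(1) j(1), of "h0 i"] h h0 i by (auto simp: H_def PiE_def Pi_def)
        then show ?thesis using j by simp
      qed
      then show "h \<in> PiE I (\<lambda>i. if i \<in> J then {h0 i} else C i)"
        using h by (auto simp: H_def PiE_def Pi_def)
    qed
    then have "card H \<le> card (PiE I (\<lambda>i. if i \<in> J then {h0 i} else C i))"
      using I C by (intro card_mono finite_PiE) auto
    also have "\<dots> = (\<Prod>i\<in>I. if i \<in> J then 1 else n)"
      using I C by (subst card_PiE) (auto intro!: prod.cong)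
    also have "\<dots> = n ^ card (I - J)"
    proof -
      have "(\<Prod>i\<in>I. if i \<in> J then 1 else n) = (\<Prod>i\<in>I - J. n)"
        using I by (intro prod.mono_neutral_cong_right) auto
      then show ?thesis by simp
    qed
    finally have "card H * n ^ card T \<le> n ^ card (I - J) * n ^ card J" by (simp add: cJ)
    moreover have "card (I - J) + card J = card I"
      using I by (subst card_Un_disjoint[symmetric]) (auto simp: J_def intro!: arg_cong[of _ _ card])
    ultimately show ?thesis by (simp add: power_add[symmetric])
  qed simp
  then show ?thesis using le unfolding cardF by (meson le_trans mult_le_mono1)
qed

lemma card_four_sorted:
  fixes f :: "'a \<Rightarrow> nat"
  assumes "card q = 4"
  obtains a b c d where "q = {a, b, c, d}" "distinct [a, b, c, d]" "f a \<le> f b" "f b \<le> f c" "f c \<le> f d"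
proof -
  have "finite q" using assms card.infinite by fastforce
  then obtain xs where xs: "set xs = q" "distinct xs" using finite_distinct_list by blast
  define ys where "ys = sort_key f xs"
  have ys: "set ys = q" "distinct ys" "sorted (map f ys)" using xs by (auto simp: ys_def)
  then have "length ys = 4" using assms distinct_card by fastforce
  then obtain a b c d where "ys = [a, b, c, d]"
    by (auto simp: numeral_eq_Suc length_Suc_conv)
  then show ?thesis using ys by (intro that[of a b c d]) auto
qed

lemma linear_times_geometric_bounded:
  fixes y :: real
  assumes "0 < y" "y < 1"
  obtains M where "M > 0" "\<And>i::nat. real (i + 1) * y ^ i \<le> M"
proof -
  have "(\<lambda>i. real i * y ^ i + y ^ i) \<longlonglongrightarrow> 0 + 0"
    using assms by (intro tendsto_add powser_times_n_limit_0 LIMSEQ_power_zero) auto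
  then have "Bseq (\<lambda>i. real i * y ^ i + y ^ i)" by (rule convergent_imp_Bseq[OF convergentI])
  then obtain M where M: "M > 0" "\<And>i. \<bar>real i * y ^ i + y ^ i\<bar> \<le> M" by (auto simp: Bseq_def)
  have "real (i + 1) * y ^ i \<le> M" for i using M(2)[of i] by (simp add: algebra_simps)
  with M(1) show ?thesis by (rule that)
qed

section \<open>Blocks, cells and the expected number of bad quadruples\<close>

locale block_grid =
  fixes L :: nat
  assumes L: "L \<ge> 1"
begin

definition R :: "nat \<Rightarrow> nat" where "R k = L * 2 ^ k"

text \<open>Cells are indexed by absolute position, so the \<open>2 ^ k\<close> indices in
  \<open>cells k\<close> fill the abscissae from \<open>R k\<close> up to
  \<open>2 * R k\<close>.\<close>

definition cell :: "nat \<Rightarrow> nat \<Rightarrow> (int \<times> int) set" where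
  "cell k i = {int (L * i)..<int (L * i + L)} \<times> {1..int (R k)}"

abbreviation cells :: "nat \<Rightarrow> nat set" where "cells k \<equiv> {2 ^ k..<2 ^ (k + 1)}"

text \<open>Block \<open>0\<close> is left empty, and its family is the singleton
  \<open>{{}}\<close>, so that the selection starts with nothing chosen.\<close>

definition V :: "nat \<Rightarrow> (int \<times> int) set" where
  "V k = (if k = 0 then {} else \<Union>i\<in>cells k. cell k i)"

definition F :: "nat \<Rightarrow> (int \<times> int) set set" where
  "F k = (if k = 0 then {{}} else (\<lambda>h. h ` cells k) ` PiE (cells k) (cell k))"

lemma R_pos: "R k > 0"
  using L by (simp add: R_def)

lemma R_mono: "j \<le> k \<Longrightarrow> R j \<le> R k"
  by (simp add: R_def)

lemma V_subset: "V k \<subseteq> {int (R k)..<2 * int (R k)} \<times> {1..int (R k)}"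
proof
  fix p assume "p \<in> V k"
  then obtain i where i: "2 ^ k \<le> i" "i < 2 ^ (k + 1)" "p \<in> cell k i" by (auto simp: V_def split: if_splits)
  have "R k \<le> L * i" using i(1) by (simp add: R_def)
  moreover have "L * (i + 1) \<le> L * 2 ^ (k + 1)" using i(2) by (intro mult_left_mono) auto
  then have "L * i + L \<le> 2 * R k" by (simp add: R_def)
  ultimately have "int (R k) \<le> int (L * i)" "int (L * i + L) \<le> 2 * int (R k)" by linarith+
  then show "p \<in> {int (R k)..<2 * int (R k)} \<times> {1..int (R k)}"
    using i(3) unfolding cell_def by auto
qed

lemma V_disjoint: "i \<noteq> j \<Longrightarrow> V i \<inter> V j = {}"
proof (induction i j rule: linorder_wlog)
  case (le i j)
  then have "R (Suc i) \<le> R j" by (intro R_mono) auto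
  then have "2 * R i \<le> R j" by (simp add: R_def)
  then show ?case using V_subset[of i] V_subset[of j] by fastforce
qed (simp add: Int_commute)

definition blk :: "int \<times> int \<Rightarrow> nat" where "blk z = (THE k. z \<in> V k)"

lemma blk_eq: "z \<in> V k \<Longrightarrow> blk z = k"
  unfolding blk_def using V_disjoint by (intro the_equality) blast+

lemma finite_V [simp]: "finite (V k)"
  by (rule finite_subset[OF V_subset]) simp

lemma card_V: "card (V k) \<le> (R k)\<^sup>2"
proof -
  have "card (V k) \<le> card ({int (R k)..<2 * int (R k)} \<times> {1..int (R k)})"
    by (intro card_mono V_subset) simp
  then show ?thesis by (simp add: power2_eq_square)
qed

lemma cell_disjoint: "i \<noteq> j \<Longrightarrow> cell k i \<inter> cell k j = {}"
proof (induction i j rule: linorder_wlog)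
  case (le i j)
  then have "L * (i + 1) \<le> L * j" by (intro mult_left_mono) auto
  then have "L * i + L \<le> L * j" by simp
  then have "int (L * i + L) \<le> int (L * j)" by (simp only: of_nat_le_iff)
  then show ?case unfolding cell_def by fastforce
qed (simp add: Int_commute)

lemma card_cell: "finite (cell k i) \<and> card (cell k i) = L * R k"
  by (simp add: cell_def)

lemma F_subset: "B \<in> F k \<Longrightarrow> B \<subseteq> V k"
  by (auto simp: F_def V_def split: if_splits dest!: PiE_mem)

lemma finite_F: "finite (F k)"
  using card_cell by (simp add: F_def finite_PiE)

lemma F_nonempty: "F k \<noteq> {}"
proof -
  have "cell k i \<noteq> {}" for i
    using L R_pos[of k] by (simp add: cell_def)
  then show ?thesis by (simp add: F_def PiE_eq_empty_iff)
qed

lemma card_member_F: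
  assumes "B \<in> F k" "k \<ge> 1"
  shows "card B = 2 ^ k"
proof -
  obtain h where h: "h \<in> PiE (cells k) (cell k)" "B = h ` cells k" using assms by (auto simp: F_def)
  have "inj_on h (cells k)"
  proof (rule inj_onI)
    fix i j assume "i \<in> cells k" "j \<in> cells k" "h i = h j"
    then show "i = j" using h(1) cell_disjoint[of i j k] by (metis PiE_mem disjoint_iff)
  qed
  then show ?thesis by (simp add: h(2) card_image)
qed

text \<open>Each cell of block \<open>k\<close> has \<open>L * R k\<close> points, so for a point of
  a block this is the probability of being selected.\<close>

definition w :: "int \<times> int \<Rightarrow> real" where "w z = 1 / (real L * real (R (blk z)))"

lemma w_nonneg: "w z \<ge> 0"
  by (simp add: w_def)

lemma F_prob:
  assumes T: "T \<subseteq> V k"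
  shows "real (card {B \<in> F k. T \<subseteq> B}) \<le> real (card (F k)) * (\<Prod>z\<in>T. w z)"
proof (cases "k = 0")
  case True
  then have "T = {}" using T by (simp add: V_def)
  then show ?thesis by simp
next
  case False
  let ?n = "L * R k"
  have n: "real ?n > 0" using L R_pos[of k] by simp
  have "(\<Prod>z\<in>T. w z) = (\<Prod>z\<in>T. 1 / real ?n)"
    using T by (intro prod.cong) (auto simp: w_def blk_eq)
  then have prod: "(\<Prod>z\<in>T. w z) = 1 / real ?n ^ card T" by (simp add: power_one_over)
  have "card {B \<in> F k. T \<subseteq> B} * ?n ^ card T \<le> card (F k)"
    using card_transversals[of "cells k" "cell k" ?n T] T card_cell cell_disjoint False
    by (simp add: F_def V_def)
  then have "real (card {B \<in> F k. T \<subseteq> B} * ?n ^ card T) \<le> real (card (F k))" by (rule of_nat_mono)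
  then have "real (card {B \<in> F k. T \<subseteq> B}) * real ?n ^ card T \<le> real (card (F k))" by simp
  then show ?thesis unfolding prod using n by (simp add: pos_le_divide_eq)
qed

definition Q :: "nat \<Rightarrow> (int \<times> int) set set" where
  "Q m = {q. card q = 4 \<and> q \<subseteq> (\<Union>k\<le>m. V k) \<and> q \<inter> V m \<noteq> {} \<and> bad q}"

lemma finite_Q: "finite (Q m)"
proof -
  have "Q m \<subseteq> Pow (\<Union>k\<le>m. V k)" by (auto simp: Q_def)
  then show ?thesis by (rule finite_subset) simp
qed

lemma gmod_difference:
  assumes "p \<in> V j" "p' \<in> V k" "j \<le> k"
  shows "gmod (to_gauss p' - to_gauss p) \<le> 3 * real (R k)"
proof -
  have "p \<in> {int (R j)..<2 * int (R j)} \<times> {1..int (R j)}" "p' \<in> {int (R k)..<2 * int (R k)} \<times> {1..int (R k)}"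
    using assms V_subset by blast+
  moreover have "int (R j) \<le> int (R k)" using R_mono[OF assms(3)] by simp
  ultimately have "\<bar>fst p' - fst p\<bar> \<le> 2 * int (R k)" "\<bar>snd p' - snd p\<bar> \<le> int (R k)" by auto
  then have "real_of_int \<bar>fst p' - fst p\<bar> \<le> real_of_int (2 * int (R k))" "real_of_int \<bar>snd p' - snd p\<bar> \<le> real_of_int (int (R k))"
    by (simp_all only: of_int_le_iff)
  then show ?thesis using gmod_le[of "to_gauss p' - to_gauss p"] by simp
qed

definition sorted_quads :: "nat \<Rightarrow> nat \<Rightarrow> nat \<Rightarrow> nat \<Rightarrow> (int \<times> int) set set" where
  "sorted_quads j k l m = {{p0, p1, p2, p3} |p0 p1 p2 p3. distinct [p0, p1, p2, p3] \<and> bad {p0, p1, p2, p3} \<and>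
     p0 \<in> V j \<and> p1 \<in> V k \<and> p2 \<in> V l \<and> p3 \<in> V m}"

text \<open>The point in the first block serves as origin: it has at most
  \<open>(R j)\<^sup>2\<close> positions, and the differences to the other three have moduli
  governed by the later blocks, whence \<open>3 * R k\<close> as the smallest radius.\<close>

lemma card_sorted_quads:
  assumes "j \<le> k" "k \<le> l" "l \<le> m"
  shows "finite (sorted_quads j k l m)"
    "card (sorted_quads j k l m) \<le> (R j)\<^sup>2 * card (cocircular_triples (3 * R k) (3 * R l) (3 * R m))"
proof -
  let ?X = "V j \<times> cocircular_triples (3 * R k) (3 * R l) (3 * R m)"
  define \<phi> where "\<phi> = (\<lambda>(p, z1, z2, z3). {p, (fst p + gre z1, snd p + gim z1), (fst p + gre z2, snd p + gim z2), (fst p + gre z3, snd p + gim z3)})"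
  have sub: "sorted_quads j k l m \<subseteq> \<phi> ` ?X"
  proof
    fix q assume "q \<in> sorted_quads j k l m"
    then obtain p0 p1 p2 p3 where q: "q = {p0, p1, p2, p3}" "distinct [p0, p1, p2, p3]" "bad {p0, p1, p2, p3}"
      "p0 \<in> V j" "p1 \<in> V k" "p2 \<in> V l" "p3 \<in> V m" unfolding sorted_quads_def by blast
    let ?z = "\<lambda>p. to_gauss p - to_gauss p0"
    have "cocircular (?z p1) (?z p2) (?z p3)" by (rule cocircular_differences[OF q(3,2)])
    then have "(p0, ?z p1, ?z p2, ?z p3) \<in> ?X"
      using q assms gmod_difference[of p0 j] by (auto simp: cocircular_triples_def)
    moreover have "q = \<phi> (p0, ?z p1, ?z p2, ?z p3)" by (simp add: q(1) \<phi>_def)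
    ultimately show "q \<in> \<phi> ` ?X" by blast
  qed
  have fin: "finite ?X" by simp
  show "finite (sorted_quads j k l m)" using finite_surj[OF fin sub] .
  have "card (sorted_quads j k l m) \<le> card ?X" using surj_card_le[OF fin sub] .
  also have "\<dots> \<le> (R j)\<^sup>2 * card (cocircular_triples (3 * R k) (3 * R l) (3 * R m))"
    using card_V[of j] by (simp add: card_cartesian_product)
  finally show "card (sorted_quads j k l m) \<le> (R j)\<^sup>2 * card (cocircular_triples (3 * R k) (3 * R l) (3 * R m))" .
qed

lemma Q_sorted:
  assumes q: "q \<in> Q m" "q \<inter> V j \<noteq> {}" "q \<inter> (\<Union>k<j. V k) = {}"
  shows "\<exists>k l. j \<le> k \<and> k \<le> l \<and> l \<le> m \<and> q \<in> sorted_quads j k l m"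
proof -
  have q': "card q = 4" "q \<subseteq> (\<Union>k\<le>m. V k)" "q \<inter> V m \<noteq> {}" "bad q" using q(1) by (auto simp: Q_def)
  obtain a b c d where abcd: "q = {a, b, c, d}" "distinct [a, b, c, d]" "blk a \<le> blk b" "blk b \<le> blk c" "blk c \<le> blk d"
    using card_four_sorted[OF q'(1), of blk] by blast
  have inV: "z \<in> V (blk z)" "j \<le> blk z" "blk z \<le> m" if z: "z \<in> q" for z
  proof -
    obtain k where k: "k \<le> m" "z \<in> V k" using z q'(2) by blast
    moreover have "j \<le> k" using z k q(3) by (cases "k < j") auto
    ultimately show "z \<in> V (blk z)" "j \<le> blk z" "blk z \<le> m" by (simp_all add: blk_eq)
  qed
  obtain z where z: "z \<in> q" "z \<in> V j" using q(2) by blast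
  then have "blk z = j" by (simp add: blk_eq)
  then have "blk a \<le> j" using z(1) abcd by auto
  moreover obtain y where y: "y \<in> q" "y \<in> V m" using q'(3) by blast
  then have "blk y = m" by (simp add: blk_eq)
  then have "m \<le> blk d" using y(1) abcd by auto
  ultimately have e: "blk a = j" "blk d = m" using inV[of a] inV[of d] abcd(1) by auto
  have "a \<in> V j" "b \<in> V (blk b)" "c \<in> V (blk c)" "d \<in> V m" using inV(1)[of a] inV(1)[of b] inV(1)[of c] inV(1)[of d] abcd(1) e by simp_all
  then have "q \<in> sorted_quads j (blk b) (blk c) m"
    using abcd(1,2) q'(4) unfolding sorted_quads_def by blast
  then show ?thesis using abcd(3-5) e by auto
qed

text \<open>A quadruple in blocks \<open>j\<close>, \<open>k\<close>, \<open>l\<close>,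
  \<open>m\<close> has weight \<open>1 / (L ^ 4 * R j * R k * R l * R m)\<close>. Times the count
  this gives \<open>27 * C / L ^ 4 * R m * (R j / R k) * (R k / R m) powr (1 / 250)\<close>, and
  weakening the exponent of \<open>R j / R k\<close> to \<open>1 / 250\<close> leaves
  \<open>(R j / R m) powr (1 / 250) = y ^ (4 * (m - j))\<close>. Half of this decay absorbs the at
  most \<open>(m - j + 1)\<^sup>2\<close> pairs \<open>(k, l)\<close>; the other half is what the
  selection requires.\<close>

lemma Q_weight:
  assumes C: "C > 0" "\<And>a b c. 1 \<le> a \<Longrightarrow> a \<le> b \<Longrightarrow> b \<le> c \<Longrightarrow>
      real (card (cocircular_triples a b c)) \<le> C * b * c\<^sup>2 * (a / c) powr (1 / 250)"
    and y: "y = 2 powr - (1 / 1000)" and M: "\<And>i::nat. real (i + 1) * y ^ i \<le> M"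
    and jm: "j \<le> m"
  shows "(\<Sum>q\<in>{q \<in> Q m. q \<inter> V j \<noteq> {} \<and> q \<inter> (\<Union>k<j. V k) = {}}. \<Prod>z\<in>q. w z)
    \<le> 27 * C * M\<^sup>2 / L ^ 4 * R m * y ^ (2 * (m - j))"
proof -
  define D where "D = {q \<in> Q m. q \<inter> V j \<noteq> {} \<and> q \<inter> (\<Union>k<j. V k) = {}}"
  define J where "J = {(k, l). j \<le> k \<and> k \<le> l \<and> l \<le> m}"
  have J: "J \<subseteq> {j..m} \<times> {j..m}" by (auto simp: J_def)
  then have finJ: "finite J" by (rule finite_subset) simp
  have finD: "finite D" using finite_Q by (simp add: D_def)
  have L0: "real L > 0" using L by simp
  have Rp: "real (R i) > 0" for i using R_pos by simp
  have yp: "y > 0" by (simp add: y)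
  define G where "G = 27 * C / L ^ 4 * R m * y ^ (4 * (m - j))"
  have "\<forall>q\<in>D. \<exists>x. x \<in> J \<and> q \<in> sorted_quads j (fst x) (snd x) m"
    using Q_sorted by (fastforce simp: D_def J_def)
  then obtain \<kappa> where \<kappa>: "\<And>q. q \<in> D \<Longrightarrow> \<kappa> q \<in> J \<and> q \<in> sorted_quads j (fst (\<kappa> q)) (snd (\<kappa> q)) m" by metis
  have part: "(\<Sum>q\<in>{q \<in> D. \<kappa> q = x}. \<Prod>z\<in>q. w z) \<le> G" if x: "x \<in> J" for x
  proof -
    obtain k l where kl: "x = (k, l)" "j \<le> k" "k \<le> l" "l \<le> m" using x by (auto simp: J_def)
    define P where "P = 1 / (real L ^ 4 * R j * R k * R l * R m)"
    have wq: "(\<Prod>z\<in>q. w z) = P" if q: "q \<in> sorted_quads j k l m" for q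
    proof -
      obtain p0 p1 p2 p3 where q: "q = {p0, p1, p2, p3}" "distinct [p0, p1, p2, p3]"
        "p0 \<in> V j" "p1 \<in> V k" "p2 \<in> V l" "p3 \<in> V m" using q unfolding sorted_quads_def by blast
      then have "(\<Prod>z\<in>q. w z) = w p0 * w p1 * w p2 * w p3" by simp
      then show ?thesis using q by (simp add: w_def blk_eq P_def power4_eq_xxxx mult_ac)
    qed
    have sub: "{q \<in> D. \<kappa> q = x} \<subseteq> sorted_quads j k l m" using \<kappa> kl(1) by fastforce
    have "(\<Sum>q\<in>{q \<in> D. \<kappa> q = x}. \<Prod>z\<in>q. w z) \<le> (\<Sum>q\<in>sorted_quads j k l m. \<Prod>z\<in>q. w z)"
      using card_sorted_quads(1)[OF kl(2-4)] sub by (intro sum_mono2) (auto intro: prod_nonneg w_nonneg)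
    also have "\<dots> = real (card (sorted_quads j k l m)) * P" by (simp add: wq)
    also have "\<dots> \<le> ((R j)\<^sup>2 * (C * (3 * R l) * (real (3 * R m))\<^sup>2 * (3 * R k / (3 * R m)) powr (1 / 250))) * P"
    proof (rule mult_right_mono)
      have "real (card (sorted_quads j k l m)) \<le> real ((R j)\<^sup>2 * card (cocircular_triples (3 * R k) (3 * R l) (3 * R m)))"
        using card_sorted_quads(2)[OF kl(2-4)] by (rule of_nat_mono)
      also have "\<dots> = (R j)\<^sup>2 * real (card (cocircular_triples (3 * R k) (3 * R l) (3 * R m)))" by simp
      also have "\<dots> \<le> (R j)\<^sup>2 * (C * (3 * R l) * (real (3 * R m))\<^sup>2 * (3 * R k / (3 * R m)) powr (1 / 250))"
        using R_mono[OF kl(3)] R_mono[OF kl(4)] R_pos[of k] by (intro mult_left_mono[OF C(2)]) auto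
      finally show "real (card (sorted_quads j k l m)) \<le> (R j)\<^sup>2 * (C * (3 * R l) * (real (3 * R m))\<^sup>2 * (3 * R k / (3 * R m)) powr (1 / 250))" .
      show "P \<ge> 0" by (simp add: P_def)
    qed
    also have "\<dots> = 27 * C / L ^ 4 * R m * ((R j / R k) * (R k / R m) powr (1 / 250))"
      using L0 Rp[of j] Rp[of k] Rp[of l] Rp[of m] by (simp add: P_def power2_eq_square)
    also have "\<dots> \<le> 27 * C / L ^ 4 * R m * ((R j / R k) powr (1 / 250) * (R k / R m) powr (1 / 250))"
    proof -
      have "(R j / R k) powr 1 \<le> (R j / R k) powr (1 / 250)"
        using R_mono[OF kl(2)] Rp[of k] by (intro powr_mono') (auto simp: divide_le_eq)
      then have "real (R j) / R k \<le> (R j / R k) powr (1 / 250)" using Rp[of j] Rp[of k] by simp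
      then show ?thesis using C(1) by (intro mult_left_mono mult_right_mono) auto
    qed
    also have "(R j / R k) powr (1 / 250) * (R k / R m) powr (1 / 250) = (R j / R m) powr (1 / 250)"
      using Rp[of j] Rp[of k] Rp[of m] by (simp add: powr_mult[symmetric])
    also have "(R j / R m) powr (1 / 250) = y ^ (4 * (m - j))"
    proof -
      have "real (2 ^ m) = 2 ^ j * 2 ^ (m - j)" using jm by (simp add: power_add[symmetric])
      then have "real (R j) / R m = 1 / 2 ^ (m - j)" using L0 by (simp add: R_def)
      also have "\<dots> = 2 powr - real (m - j)" by (simp add: powr_minus powr_realpow divide_inverse)
      finally have "(R j / R m) powr (1 / 250) = 2 powr (- real (m - j) * (1 / 250))" by (simp only: powr_powr)
      also have "\<dots> = 2 powr (- (1 / 1000) * real (4 * (m - j)))" by simp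
      also have "\<dots> = (2 powr - (1 / 1000)) powr real (4 * (m - j))" by (simp only: powr_powr)
      also have "\<dots> = y ^ (4 * (m - j))" unfolding y by (rule powr_realpow) simp
      finally show ?thesis .
    qed
    finally show ?thesis by (simp only: G_def)
  qed
  have G0: "G \<ge> 0" using C(1) yp by (simp add: G_def)
  have "(\<Sum>q\<in>D. \<Prod>z\<in>q. w z) = (\<Sum>x\<in>J. \<Sum>q\<in>{q \<in> D. \<kappa> q = x}. \<Prod>z\<in>q. w z)"
    using \<kappa> by (intro sum.group[symmetric] finD finJ) auto
  also have "\<dots> \<le> (\<Sum>x\<in>J. G)" by (intro sum_mono part)
  also have "\<dots> = real (card J) * G" by simp
  also have "\<dots> \<le> (real (m - j + 1))\<^sup>2 * G"
  proof -
    have "card J \<le> card ({j..m} \<times> {j..m})" using J by (intro card_mono) auto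
    also have "\<dots> = (m - j + 1)\<^sup>2" using jm by (simp add: power2_eq_square Suc_diff_le)
    finally have "real (card J) \<le> real ((m - j + 1)\<^sup>2)" by (rule of_nat_mono)
    then show ?thesis using G0 by (intro mult_right_mono) auto
  qed
  also have "\<dots> = 27 * C / L ^ 4 * R m * (real (m - j + 1) * y ^ (m - j))\<^sup>2 * y ^ (2 * (m - j))"
  proof -
    have "y ^ (4 * (m - j)) = (y ^ (m - j))\<^sup>2 * y ^ (2 * (m - j))"
      by (simp add: power_mult[symmetric] power_add[symmetric] mult.commute)
    then show ?thesis unfolding G_def power_mult_distrib by (simp only: mult_ac)
  qed
  also have "\<dots> \<le> 27 * C / L ^ 4 * R m * M\<^sup>2 * y ^ (2 * (m - j))"
    using M[of "m - j"] yp C(1) by (intro mult_right_mono mult_left_mono power_mono) auto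
  finally show ?thesis unfolding D_def by (simp add: mult_ac)
qed

text \<open>Deleting one point in the last block of every surviving bad quadruple costs at most half of each block.\<close>

lemma exists_sparse_set:
  assumes C: "C > 0" "\<And>a b c. 1 \<le> a \<Longrightarrow> a \<le> b \<Longrightarrow> b \<le> c \<Longrightarrow>
      real (card (cocircular_triples a b c)) \<le> C * b * c\<^sup>2 * (a / c) powr (1 / 250)"
    and y: "y = 2 powr - (1 / 1000)" and M: "M > 0" "\<And>i::nat. real (i + 1) * y ^ i \<le> M"
    and large: "54 * C * M\<^sup>2 / (1 - y)\<^sup>2 \<le> L"
  shows "\<exists>S. no_four_on_circle_or_line S \<and> (\<forall>k\<ge>1. 2 ^ k \<le> 2 * card (S \<inter> V k))"
proof -
  define \<epsilon> where "\<epsilon> = 27 * C * M\<^sup>2 / L ^ 4"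
  have L0: "real L \<ge> 1" using L by simp
  have y01: "0 < y" "y < 1" unfolding y using powr_less_mono[of "- (1 / 1000)" 0 2] by simp_all
  interpret block_selection V F w Q "\<lambda>m. real (R m)" y \<epsilon>
  proof
    show "V 0 = {}" by (simp add: V_def)
    show "finite q" if "q \<in> Q m" for q m using that by (auto simp: Q_def intro: card_ge_0_finite)
    show "q \<noteq> {}" if "q \<in> Q m" for q m using that by (auto simp: Q_def)
    show "q \<subseteq> (\<Union>k\<le>m. V k)" if "q \<in> Q m" for q m using that by (auto simp: Q_def)
    show "0 < \<epsilon>" using C(1) M(1) L0 by (simp add: \<epsilon>_def)
    show "(\<Sum>q\<in>{q \<in> Q m. q \<inter> V j \<noteq> {} \<and> q \<inter> (\<Union>k<j. V k) = {}}. \<Prod>z\<in>q. w z) \<le> \<epsilon> * real (R m) * y ^ (2 * (m - j))"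
      if "j \<le> m" for j m
      unfolding \<epsilon>_def using Q_weight[OF C y M(2) that] by simp
  qed (use V_disjoint finite_F F_nonempty F_subset w_nonneg F_prob finite_Q R_pos y01 in \<open>auto\<close>)
  obtain B where B: "\<And>k. k \<ge> 1 \<Longrightarrow> B k \<in> F k"
    "\<And>m. real (card {q \<in> Q m. q \<subseteq> (\<Union>k\<in>{1..}. B k)}) \<le> K * R m"
    using selection by blast
  define A where "A = (\<Union>k\<in>{1..}. B k)"
  define surviving where "surviving m = {q \<in> Q m. q \<subseteq> A}" for m
  \<comment> \<open>The factor \<open>L ^ 4\<close> from the four probabilities beats the single
    \<open>L\<close> in \<open>R m\<close>, so a large \<open>L\<close> keeps the survivors to at
    most half of the \<open>2 ^ m\<close> points of block \<open>m\<close>.\<close>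
  have few: "2 * card (surviving m) \<le> 2 ^ m" for m
  proof -
    have "real (card (surviving m)) \<le> K * R m" using B(2) by (simp add: surviving_def A_def)
    also have "\<dots> = (54 * C * M\<^sup>2 / (1 - y)\<^sup>2) * 2 ^ m / (2 * real L ^ 3)"
      unfolding K_def unfolding \<epsilon>_def using L0 by (simp add: R_def power_numeral_reduce)
    also have "\<dots> \<le> real L * 2 ^ m / (2 * real L ^ 3)" by (intro divide_right_mono mult_right_mono[OF large]) simp_all
    also have "\<dots> \<le> 2 ^ m / 2"
    proof -
      have "real L \<le> real L ^ 3" using power_increasing[of 1 3 "real L"] L0 by simp
      then have "real L * 2 ^ m / (2 * real L ^ 3) \<le> real L ^ 3 * 2 ^ m / (2 * real L ^ 3)"
        using L0 by (intro divide_right_mono mult_right_mono) auto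
      then show ?thesis using L0 by simp
    qed
    finally have "real (2 * card (surviving m)) \<le> real (2 ^ m)" by simp
    then show ?thesis by (simp only: of_nat_le_iff)
  qed
  define last_point where "last_point m q = (SOME z. z \<in> q \<inter> V m)" for m and q :: "(int \<times> int) set"
  have last_point: "last_point m q \<in> q \<inter> V m" if "q \<in> Q m" for m q
  proof -
    have "\<exists>z. z \<in> q \<inter> V m" using that by (auto simp: Q_def)
    then show ?thesis unfolding last_point_def by (rule someI_ex)
  qed
  \<comment> \<open>Deleting in the last block keeps the losses separate: block \<open>k\<close>
    loses points only on account of quadruples in \<open>Q k\<close>, of which few survive.\<close>
  define S where "S = A - (\<Union>m. last_point m ` surviving m)"
  have AV: "A \<inter> V k = B k" if "k \<ge> 1" for k
  proof
    show "B k \<subseteq> A \<inter> V k" using that F_subset[OF B(1)[OF that]] by (auto simp: A_def)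
    show "A \<inter> V k \<subseteq> B k"
    proof
      fix z assume "z \<in> A \<inter> V k"
      then obtain i where "i \<ge> 1" "z \<in> B i" "z \<in> V k" by (auto simp: A_def)
      moreover from this have "z \<in> V i" using F_subset[OF B(1)] by blast
      ultimately show "z \<in> B k" using V_disjoint[of i k] by (cases "i = k") auto
    qed
  qed
  have "2 ^ k \<le> 2 * card (S \<inter> V k)" if k: "k \<ge> 1" for k
  proof -
    have "B k - last_point k ` surviving k \<subseteq> S \<inter> V k"
    proof
      fix z assume z: "z \<in> B k - last_point k ` surviving k"
      then have zA: "z \<in> A" "z \<in> V k" using AV[OF k] by auto
      have "z \<notin> last_point m ` surviving m" for m
      proof
        assume "z \<in> last_point m ` surviving m"
        moreover from this have "z \<in> V m" using last_point by (auto simp: surviving_def)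
        then have "m = k" using zA V_disjoint[of m k] by blast
        ultimately show False using z by simp
      qed
      with zA show "z \<in> S \<inter> V k" by (auto simp: S_def)
    qed
    then have "card (B k - last_point k ` surviving k) \<le> card (S \<inter> V k)" by (intro card_mono) auto
    moreover have "card (B k) - card (last_point k ` surviving k) \<le> card (B k - last_point k ` surviving k)"
      using finite_Q[of k] by (intro diff_card_le_card_Diff) (simp add: surviving_def)
    moreover have "card (last_point k ` surviving k) \<le> card (surviving k)"
      using finite_Q[of k] by (intro card_image_le) (simp add: surviving_def)
    ultimately show ?thesis using few[of k] card_member_F[OF B(1)[OF k] k] by linarith
  qed
  moreover have "no_four_on_circle_or_line S"
  proof -
    have "\<not> bad T" if T: "T \<subseteq> S" "card T = 4" for T
    proof
      assume bad: "bad T"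
      have fT: "finite T" "T \<noteq> {}" using T(2) by (auto intro: card_ge_0_finite)
      have TV: "z \<in> V (blk z)" if "z \<in> T" for z
      proof -
        have "z \<in> A" using that T(1) by (auto simp: S_def)
        then obtain k where "k \<ge> 1" "z \<in> B k" by (auto simp: A_def)
        then have "z \<in> V k" using F_subset[OF B(1)] by blast
        then show ?thesis by (simp add: blk_eq)
      qed
      define m where "m = Max (blk ` T)"
      have "m \<in> blk ` T" unfolding m_def using fT by (intro Max_in) auto
      then obtain z where "z \<in> T" "blk z = m" by auto
      then have "T \<inter> V m \<noteq> {}" using TV[of z] by auto
      moreover have "T \<subseteq> (\<Union>k\<le>m. V k)"
      proof
        fix z assume z: "z \<in> T"
        then have "blk z \<le> m" unfolding m_def using fT by (intro Max_ge) auto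
        then show "z \<in> (\<Union>k\<le>m. V k)" using TV[OF z] by blast
      qed
      ultimately have "T \<in> Q m" using T bad by (simp add: Q_def)
      moreover from this have "T \<in> surviving m" using T(1) by (auto simp: surviving_def S_def)
      ultimately have "last_point m T \<in> T" "last_point m T \<notin> S" using last_point by (auto simp: S_def)
      then show False using T(1) by blast
    qed
    then show ?thesis by (auto simp: no_four_on_circle_or_line_def bad_def)
  qed
  ultimately show ?thesis by blast
qed

end

theorem theorem1p1:
  "\<exists>(c::real) (n0::nat) (S::(int \<times> int) set).
     c > 0 \<and> n0 \<ge> 1 \<and> no_four_on_circle_or_line S \<and>
     (\<forall>n\<ge>n0. real (card (S \<inter> grid n)) \<ge> c * real n)"
proof -
  obtain C where C: "C > 0" "\<And>a b c. 1 \<le> a \<Longrightarrow> a \<le> b \<Longrightarrow> b \<le> c \<Longrightarrow>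
      real (card (cocircular_triples a b c)) \<le> C * b * c\<^sup>2 * (a / c) powr (1 / 250)"
    using card_cocircular_triples by blast
  define y :: real where "y = 2 powr - (1 / 1000)"
  have y01: "0 < y" "y < 1" unfolding y_def using powr_less_mono[of "- (1 / 1000)" 0 2] by simp_all
  obtain M where M: "M > 0" "\<And>i::nat. real (i + 1) * y ^ i \<le> M"
    using linear_times_geometric_bounded[OF y01] by blast
  define L where "L = nat \<lceil>54 * C * M\<^sup>2 / (1 - y)\<^sup>2\<rceil> + 1"
  interpret block_grid L by unfold_locales (simp add: L_def)
  have "54 * C * M\<^sup>2 / (1 - y)\<^sup>2 \<le> L" unfolding L_def by linarith
  with exists_sparse_set[OF C y_def M] obtain S
    where S: "no_four_on_circle_or_line S" "\<And>k. k \<ge> 1 \<Longrightarrow> 2 ^ k \<le> 2 * card (S \<inter> V k)" by blast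
  have "real (card (S \<inter> grid n)) \<ge> 1 / (8 * L) * real n" if n: "n \<ge> 4 * L" for n
  proof -
    have "n div (2 * L) \<ge> 2" using n L by (simp add: less_eq_div_iff_mult_less_eq)
    \<comment> \<open>\<open>k\<close> is maximal with \<open>2 * R k \<le> n\<close>: block
      \<open>k\<close> fits into the grid, and \<open>n < 4 * L * 2 ^ k\<close> while at least half
      of its \<open>2 ^ k\<close> points remain, which gives the constant
      \<open>1 / (8 * L)\<close>. The threshold \<open>4 * L\<close> ensures
      \<open>k \<ge> 1\<close>.\<close>
    then obtain k where k: "2 ^ k \<le> n div (2 * L)" "n div (2 * L) < 2 ^ (k + 1)"
      using ex_power_ivl1[of 2 "n div (2 * L)"] by auto
    have k1: "k \<ge> 1"
      using k(2) \<open>n div (2 * L) \<ge> 2\<close> by (cases k) auto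
    have "2 ^ k * (2 * L) \<le> n" using k(1) L by (simp add: less_eq_div_iff_mult_less_eq)
    then have "2 * R k \<le> n" by (simp add: R_def mult_ac)
    then have "2 * int (R k) \<le> int n" by linarith
    then have "V k \<subseteq> grid n" using V_subset[of k] R_pos[of k] unfolding grid_def by fastforce
    then have "card (S \<inter> V k) \<le> card (S \<inter> grid n)" by (intro card_mono) (auto simp: grid_def)
    then have "2 ^ k \<le> 2 * card (S \<inter> grid n)" using S(2)[OF k1] by linarith
    moreover have "n < 2 ^ (k + 1) * (2 * L)" using k(2) L by (simp add: div_less_iff_less_mult)
    then have "n < 4 * L * 2 ^ k" by (simp add: mult_ac)
    moreover have "4 * L * 2 ^ k \<le> 4 * L * (2 * card (S \<inter> grid n))" using calculation(1) by (rule mult_left_mono) simp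
    ultimately have "n \<le> 8 * L * card (S \<inter> grid n)" by linarith
    then have "real n \<le> real (8 * L * card (S \<inter> grid n))" by (rule of_nat_mono)
    then show ?thesis using L by (simp add: divide_le_eq mult_ac)
  qed
  then show ?thesis
    using S(1) L by (intro exI[of _ "1 / (8 * L)"] exI[of _ "4 * L"] exI[of _ S]) auto
qed

end
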